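(* Let $(\mathsf{Gen}_F,\mathsf{Eval}_F,\mathsf{Invert}_F,\mathsf{Check}_F,\mathsf{Good}_F)$ be any noisy trapdoor claw-free function family, and let $(\mathsf{Gen},\mathsf{Commit},\mathsf{Open},\mathsf{Ver},\mathsf{Out})$ be the (non-succinct) multi-qubit classical commitment scheme built from it as described in the context. Then the scheme is correct: for every $\ell=\ell(\lambda)=\mathrm{poly}(\lambda)$, every $\ell$-qubit quantum state $\sigma$ and every basis $\mathbf b=(b_1,\dots,b_\ell)\in\{0,1\}^\ell$, the distribution $\mathsf{Real}(1^\lambda,\sigma,\mathbf b)$ is statistically close (total variation distance $\mathrm{negl}(\lambda)$) to $\sigma(\mathbf b)$. Here $\sigma(\mathbf b)$ is the distribution of the outcome of measuring each qubit $j$ of $\sigma$ in the standard basis if $b_j=0$ and in the Hadamard basis if $b_j=1$, and $\mathsf{Real}(1^\lambda,\sigma,\mathbf b)$ is the output distribution of the following experiment: generate $(\mathsf{pk},\mathsf{sk})\leftarrow\mathsf{Gen}(1^\lambda,1^\ell)$, $(\mathbf y,\rho)\leftarrow\mathsf{Commit}(\mathsf{pk},\sigma)$ and $\mathbf z\leftarrow\mathsf{Open}(\rho,\mathbf b)$; if $\mathsf{Ver}(\mathsf{sk},\mathbf y,\mathbf b,\mathbf z)=0$ output $\bot$; otherwise output $\mathsf{Out}(\mathsf{sk},\mathbf y,\mathbf b,\mathbf z)$.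
   Context: Conventions. $\lambda$ is the security parameter; PPT/QPT mean probabilistic/quantum polynomial time; $\mathrm{negl}$ denotes a negligible function. Basis bit $0$ means standard basis, $1$ means Hadamard basis. For bit strings, $\cdot$ is the inner product modulo 2. Noisy trapdoor claw-free function (NTCF) family. A tuple of PPT algorithms $(\mathsf{Gen}_F,\mathsf{Eval}_F,\mathsf{Invert}_F,\mathsf{Check}_F,\mathsf{Good}_F)$: - $\mathsf{Gen}_F(1^\lambda)\to(\mathsf{pk},\mathsf{sk})$; $\mathsf{pk}$ determines a domain $D_{\mathsf{pk}}\subseteq\{0,1\}^{w}$, $w=w(\lambda)=\mathrm{poly}(\lambda)$, which is efficiently verifiable and samplable, and a range $R_{\mathsf{pk}}$. - $\mathsf{Eval}_F(\mathsf{pk},b,x)\to y$, randomized, $b\in\{0,1\}$, $x\in D_{\mathsf{pk}}$, $y\in R_{\mathsf{pk}}$. - $\mathsf{Invert}_F(\mathsf{sk},y)$, deterministic, outputs $((0,x_0),(1,x_1))$ with $x_0,x_1\in D_{\mathsf{pk}}$, or $\bot$. - $\mathsf{Check}_F(\mathsf{pk},b,x,y)\in\{0,1\}$, deterministic. - $\mathsf{Good}_F(x_0,x_1,d)$, deterministic, for $d\in\{0,1\}^{w+1}$; it ignores the first bit of $d$. It outputs a bit, in which case $G_{x_0,x_1}=\{d:\mathsf{Good}_F(x_0,x_1,d)=1\}$; or, more generally, a vector in $\{0,1\}^\kappa$ ($\kappa=\mathrm{poly}(\lambda)$) obtained by partitioning $d$ into $\kappa$ blocks $d[1],\dots,d[\kappa]$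 and outputting $(\langle a[1],d[1]\rangle,\dots,\langle a[\kappa],d[\kappa]\rangle)$ for nonzero vectors $a[i]$ determined by $x_0,x_1$, in which case $G_{x_0,x_1}=\{d:\mathsf{Good}_F(x_0,x_1,d)\ne 0^\kappa\}$. Required properties. (1) Completeness, for all $(\mathsf{pk},\mathsf{sk})\in\mathrm{Supp}(\mathsf{Gen}_F(1^\lambda))$: (a) for every $b$, $x\in D_{\mathsf{pk}}$ and $y\in\mathrm{Supp}(\mathsf{Eval}_F(\mathsf{pk},b,x))$, $\mathsf{Invert}_F(\mathsf{sk},y)=((0,x_0),(1,x_1))$ with $x_b=x$ and $y\in\mathrm{Supp}(\mathsf{Eval}_F(\mathsf{pk},\beta,x_\beta))$ for both $\beta$; (b) there is a perfect matching $M_{\mathsf{pk}}\subseteq D_{\mathsf{pk}}\times D_{\mathsf{pk}}$ such that $\mathsf{Eval}_F(\mathsf{pk},0,x_0)\equiv\mathsf{Eval}_F(\mathsf{pk},1,x_1)$ iff $(x_0,x_1)\in M_{\mathsf{pk}}$; (c) $\mathsf{Check}_F(\mathsf{pk},b,x,y)=1$ iff $y\in\mathrm{Supp}(\mathsf{Eval}_F(\mathsf{pk},b,x))$; (d) for distinct $x_0,x_1$ the set $G_{x_0,x_1}$ has density $1-\mathrm{negl}(\lambda)$. (2) Efficient range superposition: for each $b$ one can prepare in QPT a state within negligible distance of $|D_{\mathsf{pk}}|^{-1/2}\sum_{x\in D_{\mathsf{pk}},\,y\in R_{\mathsf{pk}}}\sqrt{p_{\mathsf{pk}}(b,x,y)}\,|x\rangle|y\rangle$,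 where $p_{\mathsf{pk}}(b,x,\cdot)$ is the density of $\mathsf{Eval}_F(\mathsf{pk},b,x)$. (3) Adaptive hardcore bit: for every QPT $A$, $\Pr[A(\mathsf{pk})=(y,b,x,d,v):\mathsf{Check}_F(\mathsf{pk},b,x,y)=1\wedge d\in G_{x_0,x_1}\wedge d\cdot(1,x_0\oplus x_1)=v]\le\frac12+\mathrm{negl}(\lambda)$, where $((0,x_0),(1,x_1))=\mathsf{Invert}_F(\mathsf{sk},y)$. Weak commitment $W_{\mathsf{pk}}$ of one qubit: applied to a qubit register in state $\sum_s\alpha_s|s\rangle$ (possibly entangled with other registers), it coherently prepares, controlled on $s$, the range superposition for $b=s$ in fresh registers and measures the $y$ register, obtaining a string $y$ and (up to negligible error) the residual state $\sum_s\alpha_s|s\rangle|x_s\rangle$, where $y\in\mathrm{Supp}(\mathsf{Eval}_F(\mathsf{pk},s,x_s))$; it adds a $w$-qubit register. Single-qubit scheme $(\mathsf{Gen}_1,\mathsf{Commit}_1,\mathsf{Open}_1,\mathsf{Ver}_1,\mathsf{Out}_1)$. - $\mathsf{Gen}_1(1^\lambda)$: for $i=0,\dots,w+1$ sample $(\mathsf{pk}_i,\mathsf{sk}_i)\leftarrow\mathsf{Gen}_F(1^\lambda)$; output $\mathsf{pk}=(\mathsf{pk}_0,\dots,\mathsf{pk}_{w+1})$, $\mathsf{sk}=(\mathsf{sk}_0,\dots,\mathsf{sk}_{w+1})$. - $\mathsf{Commit}_1(\mathsf{pk},\cdot)$ on a qubit: apply $W_{\mathsf{pk}_0}$, obtaining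 $y_0$ and a residual state on $w+1$ qubits; apply $H^{\otimes(w+1)}$ to these qubits; for $i=1,\dots,w+1$ apply $W_{\mathsf{pk}_i}$ to the $i$-th of these qubits, obtaining $y_i$ and a new $w$-qubit register. Output $y=(y_0,\dots,y_{w+1})$ and the $(w+1)^2$-qubit residual state, ordered so that each of the $w+1$ qubits is followed by its $w$-qubit register. - $\mathsf{Open}_1(\rho,b)$: if $b=1$ measure all qubits of $\rho$ in the standard basis; if $b=0$ measure all qubits in the Hadamard basis; output the outcome $z\in\{0,1\}^{(w+1)^2}$. - $\mathsf{Ver}_1(\mathsf{sk},y,b,z)$: If $b=1$, parse $z=(d_1,x'_1,\dots,d_{w+1},x'_{w+1})$, $d=(d_1,\dots,d_{w+1})$, compute $((0,x_0),(1,x_1))=\mathsf{Invert}_F(\mathsf{sk}_0,y_0)$, and output $1$ iff $\mathsf{Check}_F(\mathsf{pk}_i,d_i,x'_i,y_i)=1$ for all $i\in[w+1]$ and $d\in G_{x_0,x_1}$. If $b=0$, parse $z=(z_1,\dots,z_{w+1})$ with $z_i\in\{0,1\}^{w+1}$, compute $((0,x'_{i,0}),(1,x'_{i,1}))=\mathsf{Invert}_F(\mathsf{sk}_i,y_i)$, output $0$ if some $z_i\notin G_{x'_{i,0},x'_{i,1}}$; otherwise set $m_i=z_i\cdot(1,x'_{i,0}\oplus x'_{i,1})$ and output $1$ iff $\mathsf{Check}_F(\mathsf{pk}_0,m_1,(m_2,\dots,m_{w+1}),y_0)=1$. - $\mathsf{Out}_1(\mathsf{sk},y,b,z)$: with the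 same notation, output $d\cdot(1,x_0\oplus x_1)$ if $b=1$, and $m_1=z_1\cdot(1,x'_{1,0}\oplus x'_{1,1})$ if $b=0$. Multi-qubit (non-succinct) scheme. $\mathsf{Gen}(1^\lambda,1^\ell)$ runs $\mathsf{Gen}_1(1^\lambda)$ independently $\ell$ times, giving $\mathsf{pk}=(\mathsf{pk}^{(1)},\dots,\mathsf{pk}^{(\ell)})$ and $\mathsf{sk}=(\mathsf{sk}^{(1)},\dots,\mathsf{sk}^{(\ell)})$. $\mathsf{Commit}(\mathsf{pk},\sigma)$ applies $\mathsf{Commit}_1$ with key $\mathsf{pk}^{(j)}$ to the $j$-th qubit of $\sigma$, for $j=1,\dots,\ell$, and outputs $\mathbf y=(y^{(1)},\dots,y^{(\ell)})$ and the residual state. $\mathsf{Open}$, $\mathsf{Ver}$, $\mathsf{Out}$ act qubit by qubit: on position $j$ and basis $b_j$ they apply $\mathsf{Open}_1,\mathsf{Ver}_1,\mathsf{Out}_1$ to the registers, key and commitment string of position $j$; $\mathsf{Ver}(\mathsf{sk},\mathbf y,\mathbf b,\mathbf z)=1$ iff all positions are accepted, and $\mathsf{Out}$ outputs the $\ell$-bit string of individual outputs.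
   Formalization: Matched pairs (x_0,x_1) in the perfect matching are assumed distinct (otherwise the density condition says nothing and correctness can fail); the range superposition is prepared by a unitary circuit, close in vector norm, with work qubits returned to zero, so that it can be run coherently. *)

theory Defs
  imports
    "HOL-Probability.Probability"
    "HOL-Library.Landau_Symbols"
    "HOL-Library.Groups_Big_Fun"
    "HOL-Library.Monad_Syntax"
begin

section \<open>Bit strings and asymptotics\<close>

type_synonym bits = "bool list"

definition bitstrings :: "nat \<Rightarrow> bits set" where
  "bitstrings k = {z. length z = k}"

definition bxor :: "bits \<Rightarrow> bits \<Rightarrow> bits" where
  "bxor u v = map2 (\<noteq>) u v"

definition ip :: "bits \<Rightarrow> bits \<Rightarrow> bool" where
  "ip u v \<longleftrightarrow> odd (\<Sum>(a, b)\<leftarrow>zip u v. of_bool (a \<and> b) :: nat)"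

primrec blocks :: "nat list \<Rightarrow> bits \<Rightarrow> bits list" where
  "blocks [] z = []"
| "blocks (k # ks) z = take k z # blocks ks (drop k z)"

abbreviation unary :: "nat \<Rightarrow> bits" where
  "unary n \<equiv> replicate n True"

definition negl :: "(nat \<Rightarrow> real) \<Rightarrow> bool" where
  "negl f \<longleftrightarrow> (\<forall>c::nat. f \<in> O(\<lambda>n. inverse (real n ^ c)))"

definition poly_bounded :: "(nat \<Rightarrow> nat) \<Rightarrow> bool" where
  "poly_bounded f \<longleftrightarrow> (\<exists>c. \<forall>n. f n \<le> n ^ c + c)"

definition tv_dist :: "'a pmf \<Rightarrow> 'a pmf \<Rightarrow> real" where
  "tv_dist p q = (SUP A. \<bar>measure_pmf.prob p A - measure_pmf.prob q A\<bar>)"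


section \<open>Classical polynomial-time computation\<close>

text \<open>
  Single-tape deterministic machines on a two-way infinite tape. State 1 is initial and
  state 0 is halting. Symbol 0 is the blank, and symbols 1 and 2 stand for the bits 0 and 1.
  Only the values of the transition function on the finitely many declared states and symbols
  can matter.
\<close>

record tm =
  num_states :: nat
  num_symbols :: nat
  trans :: "nat \<Rightarrow> nat \<Rightarrow> nat \<times> nat \<times> int"

type_synonym config = "nat \<times> (int \<Rightarrow> nat) \<times> int"

definition wf_tm :: "tm \<Rightarrow> bool" where
  "wf_tm M \<longleftrightarrow> num_states M \<ge> 2 \<and> num_symbols M \<ge> 3 \<and>
     (\<forall>q < num_states M. \<forall>s < num_symbols M.
        trans M q s \<in> {..<num_states M} \<times> {..<num_symbols M} \<times> {-1, 0, 1})"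

fun tm_step :: "tm \<Rightarrow> config \<Rightarrow> config" where
  "tm_step M (q, tape, h) =
     (if q = 0 then (q, tape, h)
      else case trans M q (tape h) of (q', s, m) \<Rightarrow> (q', tape(h := s), h + m))"

definition tm_init :: "bits \<Rightarrow> config" where
  "tm_init x = (1, (\<lambda>i. if 0 \<le> i \<and> i < int (length x) then (if x ! nat i then 2 else 1) else 0), 0)"

definition tm_yields :: "tm \<Rightarrow> bits \<Rightarrow> nat \<Rightarrow> bits \<Rightarrow> bool" where
  "tm_yields M x t y \<longleftrightarrow> (case (tm_step M ^^ t) (tm_init x) of (q, tape, h) \<Rightarrow>
     q = 0 \<and> (\<forall>i < length y. tape (int i) = (if y ! i then 2 else 1)) \<and>
     tape (int (length y)) \<notin> {1, 2})"

text \<open>Self-delimiting encoding of tuples of strings: each bit is preceded by 1, each string is closed by 0.\<close>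

definition encode :: "bits list \<Rightarrow> bits" where
  "encode xs = concat (map (\<lambda>x. concat (map (\<lambda>b. [True, b]) x) @ [False]) xs)"

text \<open>
  The problem instances are the elements of an index set; \<open>inp\<close> maps an instance to the
  tuple of strings that is presented to the machine.
\<close>

definition poly_time :: "'i set \<Rightarrow> ('i \<Rightarrow> bits list) \<Rightarrow> ('i \<Rightarrow> bits list) \<Rightarrow> bool" where
  "poly_time I inp f \<longleftrightarrow> (\<exists>M c. wf_tm M \<and> (\<forall>i\<in>I. \<exists>t \<le> length (encode (inp i)) ^ c + c.
     tm_yields M (encode (inp i)) t (encode (f i))))"

text \<open>The number of coins is a fixed polynomial of the input length, so that it carries no advice.\<close>

definition ppt :: "'i set \<Rightarrow> ('i \<Rightarrow> bits list) \<Rightarrow> ('i \<Rightarrow> bits list pmf) \<Rightarrow> bool" where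
  "ppt I inp A \<longleftrightarrow> (\<exists>c f. let coins = (\<lambda>i. bitstrings (length (encode (inp i)) ^ c + c)) in
     poly_time (SIGMA i:I. coins i) (\<lambda>(i, \<omega>). inp i @ [\<omega>]) (\<lambda>(i, \<omega>). f i \<omega>) \<and>
     (\<forall>i\<in>I. A i = map_pmf (f i) (pmf_of_set (coins i))))"


section \<open>Quantum circuits\<close>

datatype gate = H nat | T nat | CNOT nat nat

primrec wf_gate :: "nat \<Rightarrow> gate \<Rightarrow> bool" where
  "wf_gate N (H i) \<longleftrightarrow> i < N"
| "wf_gate N (T i) \<longleftrightarrow> i < N"
| "wf_gate N (CNOT i j) \<longleftrightarrow> i < N \<and> j < N \<and> i \<noteq> j"

primrec apply_gate :: "gate \<Rightarrow> (bits \<Rightarrow> complex) \<Rightarrow> (bits \<Rightarrow> complex)" where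
  "apply_gate (H i) \<psi> = (\<lambda>z. (\<psi> (z[i := False]) + (if z ! i then -1 else 1) * \<psi> (z[i := True]))
                               / complex_of_real (sqrt 2))"
| "apply_gate (T i) \<psi> = (\<lambda>z. (if z ! i then cis (pi / 4) else 1) * \<psi> z)"
| "apply_gate (CNOT i j) \<psi> = (\<lambda>z. \<psi> (z[j := (z ! j \<noteq> z ! i)]))"

text \<open>Amplitudes of the state obtained by running a circuit on \<open>N\<close> qubits in the all-zero state.\<close>

definition run_circuit :: "nat \<Rightarrow> gate list \<Rightarrow> bits \<Rightarrow> complex" where
  "run_circuit N C = fold apply_gate C (\<lambda>z. if z = replicate N False then 1 else 0)"

definition circuit_outcome :: "nat \<Rightarrow> gate list \<Rightarrow> bits pmf" where
  "circuit_outcome N C = embed_pmf (\<lambda>z. if length z = N then (cmod (run_circuit N C z))\<^sup>2 else 0)"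

primrec gate_code :: "gate \<Rightarrow> bits list" where
  "gate_code (H i) = [[False, False], unary i, []]"
| "gate_code (T i) = [[False, True], unary i, []]"
| "gate_code (CNOT i j) = [[True, True], unary i, unary j]"

definition circuit_code :: "nat \<Rightarrow> gate list \<Rightarrow> bits list" where
  "circuit_code N C = unary N # concat (map gate_code C)"

definition uniform_circuits ::
    "'i set \<Rightarrow> ('i \<Rightarrow> bits list) \<Rightarrow> ('i \<Rightarrow> nat) \<Rightarrow> ('i \<Rightarrow> gate list) \<Rightarrow> bool" where
  "uniform_circuits I inp N C \<longleftrightarrow>
     poly_time I inp (\<lambda>i. circuit_code (N i) (C i)) \<and> (\<forall>i\<in>I. \<forall>g\<in>set (C i). wf_gate (N i) g)"

text \<open>
  A polynomial-time machine writes a circuit for the given (classical) input; the circuit is run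
  and measured, and the outcome is post-processed in polynomial time.
\<close>

definition qpt :: "'i set \<Rightarrow> ('i \<Rightarrow> bits list) \<Rightarrow> ('i \<Rightarrow> bits list pmf) \<Rightarrow> bool" where
  "qpt I inp A \<longleftrightarrow> (\<exists>N C f. uniform_circuits I inp N C \<and>
     poly_time (SIGMA i:I. bitstrings (N i)) (\<lambda>(i, z). inp i @ [z]) (\<lambda>(i, z). f i z) \<and>
     (\<forall>i\<in>I. A i = map_pmf (f i) (circuit_outcome (N i) (C i))))"


section \<open>Noisy trapdoor claw-free functions\<close>

text \<open>
  Strings in the range have a fixed length \<open>range_len n\<close>, so that they fit into a qubit register.
  A value \<open>Some (x0, x1)\<close> of \<open>Invert\<close> stands for ((0,x0),(1,x1)) and \<open>None\<close> for the failure symbol.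
  \<open>Prep pk b\<close> is the circuit that prepares the range superposition for \<open>b\<close>; it acts on the
  registers for x and y and on \<open>anc pk\<close> work qubits. The argument \<open>n\<close> is the security parameter.
\<close>

record ntcf_algorithms =
  width :: "nat \<Rightarrow> nat"
  range_len :: "nat \<Rightarrow> nat"
  GenF :: "nat \<Rightarrow> (bits \<times> bits) pmf"
  Dom :: "bits \<Rightarrow> bits set"
  Rng :: "bits \<Rightarrow> bits set"
  Eval :: "bits \<Rightarrow> bool \<Rightarrow> bits \<Rightarrow> bits pmf"
  Invert :: "bits \<Rightarrow> bits \<Rightarrow> (bits \<times> bits) option"
  Check :: "bits \<Rightarrow> bool \<Rightarrow> bits \<Rightarrow> bits \<Rightarrow> bool"
  Good :: "bits \<Rightarrow> bits \<Rightarrow> bits \<Rightarrow> bits"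
  anc :: "bits \<Rightarrow> nat"
  Prep :: "bits \<Rightarrow> bool \<Rightarrow> gate list"

definition pks :: "ntcf_algorithms \<Rightarrow> nat \<Rightarrow> bits set" where
  "pks F n = fst ` set_pmf (GenF F n)"

text \<open>Covers one-bit outputs, where it says that the output is 1, as well as vector outputs.\<close>

definition good_set :: "ntcf_algorithms \<Rightarrow> nat \<Rightarrow> bits \<Rightarrow> bits \<Rightarrow> bits set" where
  "good_set F n x0 x1 = {d \<in> bitstrings (width F n + 1). True \<in> set (Good F x0 x1 d)}"

definition ntcf_syntax :: "ntcf_algorithms \<Rightarrow> bool" where
  "ntcf_syntax F \<longleftrightarrow> poly_bounded (width F) \<and> poly_bounded (range_len F) \<and>
     (\<forall>n. \<forall>(pk, sk)\<in>set_pmf (GenF F n).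
        Dom F pk \<noteq> {} \<and> Dom F pk \<subseteq> bitstrings (width F n) \<and> Rng F pk \<subseteq> bitstrings (range_len F n) \<and>
        (\<forall>b. \<forall>x\<in>Dom F pk. set_pmf (Eval F pk b x) \<subseteq> Rng F pk) \<and>
        (\<forall>y x0 x1. Invert F sk y = Some (x0, x1) \<longrightarrow> x0 \<in> Dom F pk \<and> x1 \<in> Dom F pk))"

definition good_form :: "ntcf_algorithms \<Rightarrow> bool" where
  "good_form F \<longleftrightarrow>
     (\<forall>n. \<forall>x0\<in>bitstrings (width F n). \<forall>x1\<in>bitstrings (width F n). \<forall>d\<in>bitstrings (width F n).
        Good F x0 x1 (False # d) = Good F x0 x1 (True # d)) \<and>
     ((\<forall>n. \<forall>x0\<in>bitstrings (width F n). \<forall>x1\<in>bitstrings (width F n). \<forall>d\<in>bitstrings (width F n + 1).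
         length (Good F x0 x1 d) = 1) \<or>
      (\<exists>\<kappa> ks a. poly_bounded \<kappa> \<and>
         (\<forall>n. length (ks n) = \<kappa> n \<and> sum_list (ks n) = width F n + 1 \<and>
            (\<forall>x0\<in>bitstrings (width F n). \<forall>x1\<in>bitstrings (width F n). x0 \<noteq> x1 \<longrightarrow>
               map length (a n x0 x1) = ks n \<and> (\<forall>v\<in>set (a n x0 x1). True \<in> set v) \<and>
               (\<forall>d\<in>bitstrings (width F n + 1).
                  Good F x0 x1 d = map2 ip (a n x0 x1) (blocks (ks n) d))))))"

text \<open>
  Every algorithm also receives the security parameter in unary. The domain has to be
  decidable and samplable up to negligible error.
\<close>

definition ntcf_efficient :: "ntcf_algorithms \<Rightarrow> bool" where
  "ntcf_efficient F \<longleftrightarrow>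
     ppt UNIV (\<lambda>n. [unary n]) (\<lambda>n. map_pmf (\<lambda>(pk, sk). [pk, sk]) (GenF F n)) \<and>
     poly_time {(n, pk, x). pk \<in> pks F n \<and> x \<in> bitstrings (width F n)}
       (\<lambda>(n, pk, x). [unary n, pk, x]) (\<lambda>(n, pk, x). [[x \<in> Dom F pk]]) \<and>
     (\<exists>S \<nu>. ppt {(n, pk). pk \<in> pks F n} (\<lambda>(n, pk). [unary n, pk])
              (\<lambda>(n, pk). map_pmf (\<lambda>x. [x]) (S n pk)) \<and>
            negl \<nu> \<and> (\<forall>n. \<forall>pk\<in>pks F n. tv_dist (S n pk) (pmf_of_set (Dom F pk)) \<le> \<nu> n)) \<and>
     ppt {(n, pk, b, x). pk \<in> pks F n \<and> x \<in> Dom F pk}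
       (\<lambda>(n, pk, b, x). [unary n, pk, [b], x])
       (\<lambda>(n, pk, b, x). map_pmf (\<lambda>y. [y]) (Eval F pk b x)) \<and>
     poly_time {(n, sk, y). sk \<in> snd ` set_pmf (GenF F n)}
       (\<lambda>(n, sk, y). [unary n, sk, y])
       (\<lambda>(n, sk, y). case Invert F sk y of None \<Rightarrow> [] | Some (x0, x1) \<Rightarrow> [x0, x1]) \<and>
     poly_time {(n, pk, b, x, y). pk \<in> pks F n \<and> x \<in> bitstrings (width F n)}
       (\<lambda>(n, pk, b, x, y). [unary n, pk, [b], x, y])
       (\<lambda>(n, pk, b, x, y). [[Check F pk b x y]]) \<and>
     poly_time {(n, x0, x1, d). x0 \<in> bitstrings (width F n) \<and> x1 \<in> bitstrings (width F n) \<and>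
                                d \<in> bitstrings (width F n + 1)}
       (\<lambda>(n, x0, x1, d). [unary n, x0, x1, d])
       (\<lambda>(n, x0, x1, d). [Good F x0 x1 d])"

text \<open>
  A perfect matching between two copies of \<open>D\<close>, the arguments for b = 0 and those for b = 1.
  Loops are excluded: the two members of a claw are distinct.
\<close>

definition perfect_matching :: "bits set \<Rightarrow> (bits \<times> bits) set \<Rightarrow> bool" where
  "perfect_matching D M \<longleftrightarrow> M \<subseteq> D \<times> D \<and> irrefl M \<and>
     (\<forall>x0\<in>D. \<exists>!x1. (x0, x1) \<in> M) \<and> (\<forall>x1\<in>D. \<exists>!x0. (x0, x1) \<in> M)"

definition ntcf_complete :: "ntcf_algorithms \<Rightarrow> bool" where
  "ntcf_complete F \<longleftrightarrow>
     (\<forall>n. \<forall>(pk, sk)\<in>set_pmf (GenF F n).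
        (\<forall>b. \<forall>x\<in>Dom F pk. \<forall>y\<in>set_pmf (Eval F pk b x).
           \<exists>x0 x1. Invert F sk y = Some (x0, x1) \<and> (if b then x1 else x0) = x \<and>
                   y \<in> set_pmf (Eval F pk False x0) \<and> y \<in> set_pmf (Eval F pk True x1)) \<and>
        (\<exists>M. perfect_matching (Dom F pk) M \<and>
           (\<forall>x0\<in>Dom F pk. \<forall>x1\<in>Dom F pk.
              Eval F pk False x0 = Eval F pk True x1 \<longleftrightarrow> (x0, x1) \<in> M)) \<and>
        (\<forall>b. \<forall>x\<in>Dom F pk. \<forall>y. Check F pk b x y \<longleftrightarrow> y \<in> set_pmf (Eval F pk b x))) \<and>
     (\<exists>\<nu>. negl \<nu> \<and> (\<forall>n. \<forall>pk\<in>pks F n. \<forall>x0\<in>Dom F pk. \<forall>x1\<in>Dom F pk. x0 \<noteq> x1 \<longrightarrow>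
        real (card (good_set F n x0 x1)) / 2 ^ (width F n + 1) \<ge> 1 - \<nu> n))"

definition prep_qubits :: "ntcf_algorithms \<Rightarrow> nat \<Rightarrow> bits \<Rightarrow> nat" where
  "prep_qubits F n pk = width F n + range_len F n + anc F pk"

text \<open>The ideal range superposition, with the work qubits in the all-zero state.\<close>

definition range_superposition :: "ntcf_algorithms \<Rightarrow> nat \<Rightarrow> bits \<Rightarrow> bool \<Rightarrow> bits \<Rightarrow> complex" where
  "range_superposition F n pk b z =
     (let x = take (width F n) z;
          y = take (range_len F n) (drop (width F n) z);
          g = drop (width F n + range_len F n) z
      in if x \<in> Dom F pk \<and> y \<in> Rng F pk \<and> g = replicate (anc F pk) False
         then complex_of_real (sqrt (pmf (Eval F pk b x) y) / sqrt (card (Dom F pk))) else 0)"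

text \<open>
  The distance is that of state vectors. The trace distance, or an uncontrolled state of the
  work qubits, would leave a relative phase or decoherence between b = 0 and b = 1 once the
  preparation is controlled on b.
\<close>

definition ntcf_range_superposition :: "ntcf_algorithms \<Rightarrow> bool" where
  "ntcf_range_superposition F \<longleftrightarrow>
     uniform_circuits {(n, pk, b). pk \<in> pks F n} (\<lambda>(n, pk, b). [unary n, pk, [b]])
       (\<lambda>(n, pk, b). prep_qubits F n pk) (\<lambda>(n, pk, b). Prep F pk b) \<and>
     (\<exists>\<nu>. negl \<nu> \<and> (\<forall>n. \<forall>pk\<in>pks F n. \<forall>b.
        L2_set (\<lambda>z. cmod (run_circuit (prep_qubits F n pk) (Prep F pk b) z
                           - range_superposition F n pk b z))
               (bitstrings (prep_qubits F n pk)) \<le> \<nu> n))"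

definition claw_bit :: "bits \<Rightarrow> bits \<Rightarrow> bits \<Rightarrow> bool" where
  "claw_bit d x0 x1 = ip d (True # bxor x0 x1)"

definition hardcore_win :: "ntcf_algorithms \<Rightarrow> nat \<Rightarrow> bits \<Rightarrow> bits \<Rightarrow>
    bits \<times> bool \<times> bits \<times> bits \<times> bool \<Rightarrow> bool" where
  "hardcore_win F n pk sk = (\<lambda>(y, b, x, d, v). Check F pk b x y \<and>
     (case Invert F sk y of None \<Rightarrow> False
      | Some (x0, x1) \<Rightarrow> d \<in> good_set F n x0 x1 \<and> claw_bit d x0 x1 = v))"

definition ntcf_adaptive_hardcore :: "ntcf_algorithms \<Rightarrow> bool" where
  "ntcf_adaptive_hardcore F \<longleftrightarrow>
     (\<forall>A. qpt {(n, pk). pk \<in> pks F n} (\<lambda>(n, pk). [unary n, pk])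
            (\<lambda>(n, pk). map_pmf (\<lambda>(y, b, x, d, v). [y, [b], x, d, [v]]) (A n pk)) \<longrightarrow>
        (\<exists>\<nu>. negl \<nu> \<and> (\<forall>n.
           pmf (do { (pk, sk) \<leftarrow> GenF F n; out \<leftarrow> A n pk; return_pmf (hardcore_win F n pk sk out) }) True
             \<le> 1 / 2 + \<nu> n)))"

definition ntcf :: "ntcf_algorithms \<Rightarrow> bool" where
  "ntcf F \<longleftrightarrow> ntcf_syntax F \<and> good_form F \<and> ntcf_efficient F \<and> ntcf_complete F \<and>
     ntcf_range_superposition F \<and> ntcf_adaptive_hardcore F"


section \<open>Operations on quantum states\<close>

text \<open>
  Operators on qubits are given by their matrix entries in the standard basis, which is
  labelled by bit strings. A block is a set of consecutive qubits, given by the position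
  of its first qubit and its size.
\<close>

type_synonym qop = "bits \<Rightarrow> bits \<Rightarrow> complex"

definition qtrace :: "qop \<Rightarrow> complex" where
  "qtrace \<rho> = Sum_any (\<lambda>i. \<rho> i i)"

definition density_operator :: "nat \<Rightarrow> qop \<Rightarrow> bool" where
  "density_operator N \<rho> \<longleftrightarrow>
     (\<forall>i j. \<rho> i j \<noteq> 0 \<longrightarrow> i \<in> bitstrings N \<and> j \<in> bitstrings N) \<and>
     (\<forall>v. (\<Sum>i\<in>bitstrings N. \<Sum>j\<in>bitstrings N. cnj (v i) * \<rho> i j * v j) \<in> \<real>\<^sub>\<ge>\<^sub>0) \<and>
     qtrace \<rho> = 1"

text \<open>
  Conjugation by a linear map \<open>V\<close> that takes the block of \<open>k\<close> qubits at position \<open>p\<close> to a block of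
  \<open>k'\<close> qubits; \<open>V u i\<close> is the coefficient of the basis vector \<open>i\<close> in the image of \<open>u\<close>.
\<close>

definition apply_block :: "nat \<Rightarrow> nat \<Rightarrow> nat \<Rightarrow> (bits \<Rightarrow> bits \<Rightarrow> complex) \<Rightarrow> qop \<Rightarrow> qop" where
  "apply_block p k k' V \<rho> = (\<lambda>i j. \<Sum>u\<in>bitstrings k. \<Sum>v\<in>bitstrings k.
     V u (take k' (drop p i)) * cnj (V v (take k' (drop p j))) *
     \<rho> (take p i @ u @ drop (p + k') i) (take p j @ v @ drop (p + k') j))"

text \<open>The unnormalised state of the remaining qubits when the block at \<open>p\<close> is found to be \<open>m\<close>.\<close>

definition project_block :: "nat \<Rightarrow> bits \<Rightarrow> qop \<Rightarrow> qop" where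
  "project_block p m \<rho> = (\<lambda>i j. \<rho> (take p i @ m @ drop p i) (take p j @ m @ drop p j))"

definition discard_block :: "nat \<Rightarrow> nat \<Rightarrow> qop \<Rightarrow> qop" where
  "discard_block p k \<rho> = (\<lambda>i j. \<Sum>m\<in>bitstrings k. project_block p m \<rho> i j)"

text \<open>Standard-basis measurement; the measured qubits are removed.\<close>

definition measure_block :: "nat \<Rightarrow> nat \<Rightarrow> qop \<Rightarrow> (bits \<times> qop) pmf" where
  "measure_block p k \<rho> = do {
     m \<leftarrow> embed_pmf (\<lambda>m. if m \<in> bitstrings k then Re (qtrace (project_block p m \<rho>)) else 0);
     return_pmf (m, \<lambda>i j. project_block p m \<rho> i j / qtrace (project_block p m \<rho>)) }"

definition hadamard :: "bits \<Rightarrow> bits \<Rightarrow> complex" where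
  "hadamard u i = (if length i = length u
     then (if ip u i then -1 else 1) / complex_of_real (sqrt 2) ^ length u else 0)"

abbreviation hadamard_block :: "nat \<Rightarrow> nat \<Rightarrow> qop \<Rightarrow> qop" where
  "hadamard_block p k \<rho> \<equiv> apply_block p k k hadamard \<rho>"

text \<open>
  Runs \<open>f a\<close> for the successive list elements \<open>a\<close> at the positions \<open>p\<close>, \<open>p + s\<close>, \<open>p + 2 s\<close>, and so on.
  Here \<open>s\<close> is the number of qubits that a single step leaves in place of those it acts on:
  positive for commitments, and 0 for measurements, which remove their block.
\<close>

primrec in_sequence :: "('a \<Rightarrow> nat \<Rightarrow> qop \<Rightarrow> ('c \<times> qop) pmf) \<Rightarrow> nat \<Rightarrow> 'a list \<Rightarrow> nat \<Rightarrow> qop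
    \<Rightarrow> ('c list \<times> qop) pmf" where
  "in_sequence f s [] p \<rho> = return_pmf ([], \<rho>)"
| "in_sequence f s (a # as) p \<rho> = do {
     (c, \<rho>') \<leftarrow> f a p \<rho>;
     (cs, \<rho>'') \<leftarrow> in_sequence f s as (p + s) \<rho>';
     return_pmf (c # cs, \<rho>'') }"

definition measure_qubit :: "bool \<Rightarrow> nat \<Rightarrow> qop \<Rightarrow> (bits \<times> qop) pmf" where
  "measure_qubit b p \<rho> = measure_block p 1 (if b then hadamard_block p 1 \<rho> else \<rho>)"

definition basis_measurement :: "qop \<Rightarrow> bits \<Rightarrow> bits pmf" where
  "basis_measurement \<sigma> bs = map_pmf (\<lambda>(ms, _). concat ms) (in_sequence measure_qubit 0 bs 0 \<sigma>)"


section \<open>The commitment scheme\<close>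

text \<open>The isometry that takes the basis vector s to s followed by the state prepared for b = s.\<close>

definition controlled_prep :: "ntcf_algorithms \<Rightarrow> nat \<Rightarrow> bits \<Rightarrow> bits \<Rightarrow> bits \<Rightarrow> complex" where
  "controlled_prep F n pk u i =
     (if i \<noteq> [] \<and> [hd i] = u then run_circuit (prep_qubits F n pk) (Prep F pk (hd i)) (tl i) else 0)"

definition weak_commit :: "ntcf_algorithms \<Rightarrow> nat \<Rightarrow> bits \<Rightarrow> nat \<Rightarrow> qop \<Rightarrow> (bits \<times> qop) pmf" where
  "weak_commit F n pk p \<rho> = do {
     (y, \<rho>') \<leftarrow> measure_block (p + 1 + width F n) (range_len F n)
                 (apply_block p 1 (1 + prep_qubits F n pk) (controlled_prep F n pk) \<rho>);
     return_pmf (y, discard_block (p + 1 + width F n) (anc F pk) \<rho>') }"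

definition Gen1 :: "ntcf_algorithms \<Rightarrow> nat \<Rightarrow> (bits list \<times> bits list) pmf" where
  "Gen1 F n = map_pmf (\<lambda>ks. (map fst ks, map snd ks)) (replicate_pmf (width F n + 2) (GenF F n))"

definition Commit1 :: "ntcf_algorithms \<Rightarrow> nat \<Rightarrow> bits list \<Rightarrow> nat \<Rightarrow> qop \<Rightarrow> (bits list \<times> qop) pmf" where
  "Commit1 F n pk p \<rho> = do {
     (y0, \<rho>') \<leftarrow> weak_commit F n (hd pk) p \<rho>;
     (ys, \<rho>'') \<leftarrow> in_sequence (weak_commit F n) (width F n + 1) (tl pk) p
                    (hadamard_block p (width F n + 1) \<rho>');
     return_pmf (y0 # ys, \<rho>'') }"

definition Open1 :: "ntcf_algorithms \<Rightarrow> nat \<Rightarrow> bool \<Rightarrow> nat \<Rightarrow> qop \<Rightarrow> (bits \<times> qop) pmf" where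
  "Open1 F n b p \<rho> =
     (let k = (width F n + 1)\<^sup>2 in measure_block p k (if b then \<rho> else hadamard_block p k \<rho>))"

definition opening_blocks :: "ntcf_algorithms \<Rightarrow> nat \<Rightarrow> bits \<Rightarrow> bits list" where
  "opening_blocks F n z = blocks (replicate (width F n + 1) (width F n + 1)) z"

text \<open>
  With \<open>Z = opening_blocks F n z\<close>, the block \<open>Z ! i\<close> belongs to the keys and the commitment string
  with index \<open>i + 1\<close>.
\<close>

definition decoded_bit :: "ntcf_algorithms \<Rightarrow> bits list \<Rightarrow> bits list \<Rightarrow> bits list \<Rightarrow> nat \<Rightarrow> bool" where
  "decoded_bit F sk y Z i = (case Invert F (sk ! (i + 1)) (y ! (i + 1)) of
       None \<Rightarrow> False | Some (x0, x1) \<Rightarrow> claw_bit (Z ! i) x0 x1)"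

definition Ver1 :: "ntcf_algorithms \<Rightarrow> nat \<Rightarrow> bits list \<Rightarrow> bits list \<Rightarrow> bits list \<Rightarrow> bool \<Rightarrow> bits \<Rightarrow> bool" where
  "Ver1 F n pk sk y b z = (let Z = opening_blocks F n z; w = width F n in
     if b then
       (case Invert F (sk ! 0) (y ! 0) of None \<Rightarrow> False | Some (x0, x1) \<Rightarrow>
          (\<forall>i < w + 1. Check F (pk ! (i + 1)) (hd (Z ! i)) (tl (Z ! i)) (y ! (i + 1))) \<and>
          map hd Z \<in> good_set F n x0 x1)
     else
       (\<forall>i < w + 1. case Invert F (sk ! (i + 1)) (y ! (i + 1)) of None \<Rightarrow> False
          | Some (x0, x1) \<Rightarrow> Z ! i \<in> good_set F n x0 x1) \<and>
       Check F (pk ! 0) (decoded_bit F sk y Z 0) (map (decoded_bit F sk y Z) [1..<w + 1]) (y ! 0))"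

definition Out1 :: "ntcf_algorithms \<Rightarrow> nat \<Rightarrow> bits list \<Rightarrow> bits list \<Rightarrow> bool \<Rightarrow> bits \<Rightarrow> bool" where
  "Out1 F n sk y b z = (let Z = opening_blocks F n z in
     if b then (case Invert F (sk ! 0) (y ! 0) of None \<Rightarrow> False
                | Some (x0, x1) \<Rightarrow> claw_bit (map hd Z) x0 x1)
     else decoded_bit F sk y Z 0)"

definition Gen :: "ntcf_algorithms \<Rightarrow> nat \<Rightarrow> nat \<Rightarrow> (bits list list \<times> bits list list) pmf" where
  "Gen F n L = map_pmf (\<lambda>ks. (map fst ks, map snd ks)) (replicate_pmf L (Gen1 F n))"

definition Commit :: "ntcf_algorithms \<Rightarrow> nat \<Rightarrow> bits list list \<Rightarrow> qop \<Rightarrow> (bits list list \<times> qop) pmf" where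
  "Commit F n pk \<sigma> = in_sequence (Commit1 F n) ((width F n + 1)\<^sup>2) pk 0 \<sigma>"

definition Open :: "ntcf_algorithms \<Rightarrow> nat \<Rightarrow> qop \<Rightarrow> bits \<Rightarrow> bits list pmf" where
  "Open F n \<rho> bs = map_pmf fst (in_sequence (Open1 F n) 0 bs 0 \<rho>)"

definition Ver :: "ntcf_algorithms \<Rightarrow> nat \<Rightarrow> bits list list \<Rightarrow> bits list list \<Rightarrow> bits list list \<Rightarrow>
    bits \<Rightarrow> bits list \<Rightarrow> bool" where
  "Ver F n pk sk y bs z \<longleftrightarrow> (\<forall>j < length bs. Ver1 F n (pk ! j) (sk ! j) (y ! j) (bs ! j) (z ! j))"

definition Out :: "ntcf_algorithms \<Rightarrow> nat \<Rightarrow> bits list list \<Rightarrow> bits list list \<Rightarrow> bits \<Rightarrow> bits list \<Rightarrow> bits" where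
  "Out F n sk y bs z = map (\<lambda>j. Out1 F n (sk ! j) (y ! j) (bs ! j) (z ! j)) [0..<length bs]"

definition Real_experiment :: "ntcf_algorithms \<Rightarrow> nat \<Rightarrow> nat \<Rightarrow> qop \<Rightarrow> bits \<Rightarrow> bits option pmf" where
  "Real_experiment F n L \<sigma> bs = do {
     (pk, sk) \<leftarrow> Gen F n L;
     (y, \<rho>) \<leftarrow> Commit F n pk \<sigma>;
     z \<leftarrow> Open F n \<rho> bs;
     return_pmf (if Ver F n pk sk y bs z then Some (Out F n sk y bs z) else None) }"

end

theory Submission
  imports Defs
begin

text \<open>
  Once the keys are fixed, every step of the protocol is a completely positive map on a block of
  qubits, so the whole experiment is a measurement of \<open>\<sigma>\<close> whose effects are tensor products
  over the positions. Two observations reduce the theorem to a single weak commitment: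

  \<^item> Opening a weak commitment in the standard or Hadamard basis and decoding is, up to a negligible
    error, a measurement of the committed qubit in that basis. In the Hadamard basis each claw
    contributes amplitudes whose interference depends only on the decoded bit, and for each value
    of that bit the outcomes outside the good set have negligible weight.
  \<^item> If two families of measurements are close on all positive operators, so are their
    tensor products: exchange the factors one at a time; contracting the other factors leaves
    positive operators whose traces add up to the original trace.

  The second fact, applied to the inner commitments of one position, shows that opening them in the
  basis \<open>\<not> b\<close> amounts to measuring the register of the outer commitment in the basis \<open>\<not> b\<close> after
  the Hadamard transform, that is, in the basis \<open>b\<close>. The first fact then applies to the outer
  commitment, and the second one again to the positions.
\<close>

text \<open>The procedures renormalise the state after every measurement, and a branch of trace zero
  has no conditional state. All effects are therefore computed from unnormalised operators
  (\<open>sop\<close>), and \<open>instr_bind\<close> shows that the normalised procedures sample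
  from them. The blocks acted on may be entangled with the rest of the register, so kernels carry
  spectator qubits on both sides.

  Raw transcripts of the real and the ideal measurement are not comparable; only decoded outcomes in
  \<open>bool option\<close> are. A weak commitment produces exponentially many transcripts, but its
  input is one qubit, so every decoded outcome is a 2 by 2 effect and entrywise estimates cost only
  a factor 4, with no loss exponential in w. The preparation error, an L2 distance of state vectors,
  survives the opening because the change of basis is unitary. It enters with the factor 4 * 2 (two
  amplitudes in each entry), the defect of the good set with 4 * 3 (three decoded outcomes). A
  position contains w + 2 weak commitments, so the total error is L (w + 2) times their sum.\<close>

lemma finite_bitstrings [simp]: "finite (bitstrings k)"
  using finite_lists_length_eq[of "UNIV :: bool set" k] by (simp add: bitstrings_def)

lemma mem_bitstrings: "z \<in> bitstrings k \<longleftrightarrow> length z = k"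
  by (simp add: bitstrings_def)

lemma bitstrings_0 [simp]: "bitstrings 0 = {[]}"
  by (auto simp: bitstrings_def)

lemma bij_betw_append_bitstrings:
  "bij_betw (\<lambda>(a, b). a @ b) (bitstrings k \<times> bitstrings m) (bitstrings (k + m))"
  by (rule bij_betwI[where g = "\<lambda>z. (take k z, drop k z)"]) (auto simp: bitstrings_def)

lemma sum_bitstrings_append:
  "(\<Sum>u\<in>bitstrings (k + m). f u) = (\<Sum>a\<in>bitstrings k. \<Sum>b\<in>bitstrings m. f (a @ b))"
  by (simp add: sum.cartesian_product split_def
      flip: sum.reindex_bij_betw[OF bij_betw_append_bitstrings])

lemma bitstrings_1: "bitstrings (Suc 0) = {[False], [True]}"
  by (auto simp: bitstrings_def length_Suc_conv)

lemma sum_bitstrings_1: "(\<Sum>u\<in>bitstrings (Suc 0). f u) = f [False] + f [True]"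
  by (simp add: bitstrings_1)

lemma sum_bitstrings_Suc:
  "(\<Sum>u\<in>bitstrings (Suc k). f u) = (\<Sum>a\<in>UNIV. \<Sum>b\<in>bitstrings k. f (a # b))"
  using sum_bitstrings_append[of f "Suc 0" k] by (simp add: bitstrings_1 UNIV_bool)

lemma card_bitstrings: "card (bitstrings k) = 2 ^ k"
  using card_lists_length_eq[of "UNIV :: bool set" k] by (simp add: bitstrings_def)

lemma split3_bitstrings:
  assumes "length i = p + s + r"
  obtains a U c where "i = a @ U @ c" "length a = p" "length U = s" "length c = r"
proof
  show "i = take p i @ take s (drop p i) @ drop s (drop p i)"
    by (simp only: append_take_drop_id)
qed (use assms in auto)

lemma sum_rotate3:
  "(\<Sum>u\<in>S. \<Sum>a\<in>A. \<Sum>c\<in>C. f u a c) = (\<Sum>a\<in>A. \<Sum>c\<in>C. \<Sum>u\<in>S. f u a c)"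
  by (subst sum.swap) (intro sum.cong refl sum.swap)

lemma sum_double_swap:
  "(\<Sum>a\<in>A. \<Sum>b\<in>B. \<Sum>u\<in>U. \<Sum>v\<in>V. f a b u v) = (\<Sum>u\<in>U. \<Sum>v\<in>V. \<Sum>a\<in>A. \<Sum>b\<in>B. f a b u v)"
  by (rule trans[OF sum.cong[OF refl sum_rotate3] sum_rotate3])

lemma sum_mult_mult_sum:
  fixes A B :: "_ \<Rightarrow> 'z::semiring_0"
  shows "(\<Sum>u\<in>U. A u) * r * (\<Sum>v\<in>V. B v) = (\<Sum>u\<in>U. \<Sum>v\<in>V. A u * r * B v)"
  by (subst sum_distrib_right) (rule sum_product)

section \<open>Local superoperators\<close>

definition supported :: "nat \<Rightarrow> qop \<Rightarrow> bool" where
  "supported N \<rho> \<longleftrightarrow> (\<forall>i j. \<rho> i j \<noteq> 0 \<longrightarrow> i \<in> bitstrings N \<and> j \<in> bitstrings N)"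

text \<open>A quadratic form with real values only already has a Hermitian matrix. In contrast to
  \<open>density_operator\<close> the trace is free, so that unnormalised measurement branches
  qualify.\<close>

definition psd :: "nat \<Rightarrow> qop \<Rightarrow> bool" where
  "psd N \<rho> \<longleftrightarrow> supported N \<rho> \<and>
     (\<forall>v. (\<Sum>i\<in>bitstrings N. \<Sum>j\<in>bitstrings N. cnj (v i) * \<rho> i j * v j) \<in> \<real>\<^sub>\<ge>\<^sub>0)"

lemma density_operator_iff: "density_operator N \<rho> \<longleftrightarrow> psd N \<rho> \<and> qtrace \<rho> = 1"
  by (auto simp: density_operator_def psd_def supported_def)

lemma supported_eqI:
  assumes "supported N X" "supported N Y"
    and "\<And>i j. length i = N \<Longrightarrow> length j = N \<Longrightarrow> X i j = Y i j"
  shows "X = Y"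
proof (intro ext)
  fix i j
  show "X i j = Y i j"
    using assms(3)[of i j] assms(1,2)[unfolded supported_def mem_bitstrings, rule_format, of i j] by fastforce
qed

lemma qtrace_eq_sum: "supported N \<rho> \<Longrightarrow> qtrace \<rho> = (\<Sum>i\<in>bitstrings N. \<rho> i i)"
  unfolding qtrace_def by (rule Sum_any.expand_superset) (auto simp: supported_def)

lemma nonneg_Reals_iff_of_real: "z \<in> \<real>\<^sub>\<ge>\<^sub>0 \<longleftrightarrow> (\<exists>t\<ge>0. z = complex_of_real t)"
  by (auto simp: nonneg_Reals_def)

lemma sum_nonneg_Reals: "(\<And>x. x \<in> A \<Longrightarrow> f x \<in> \<real>\<^sub>\<ge>\<^sub>0) \<Longrightarrow> sum f A \<in> (\<real>\<^sub>\<ge>\<^sub>0 :: complex set)"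
  by (induction A rule: infinite_finite_induct) (auto intro: nonneg_Reals_add_I)

lemma psd_diag:
  assumes "psd N \<rho>" "k \<in> bitstrings N"
  shows "\<rho> k k \<in> \<real>\<^sub>\<ge>\<^sub>0"
proof -
  let ?B = bitstrings
  have "(\<Sum>i\<in>?B N. \<Sum>j\<in>?B N. cnj (of_bool (i = k)) * \<rho> i j * of_bool (j = k)) \<in> \<real>\<^sub>\<ge>\<^sub>0"
    by (rule conjunct2[OF assms(1)[unfolded psd_def], THEN spec])
  also have "(\<Sum>i\<in>?B N. \<Sum>j\<in>?B N. cnj (of_bool (i = k)) * \<rho> i j * of_bool (j = k))
      = (\<Sum>i\<in>?B N. if i = k then \<rho> k k else 0)"
    by (intro sum.cong refl) (use assms(2) in \<open>auto simp: of_bool_def if_distrib cong: if_cong\<close>)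
  also have "\<dots> = \<rho> k k" using assms(2) by simp
  finally show ?thesis .
qed

lemma psd_qtrace: "psd N \<rho> \<Longrightarrow> qtrace \<rho> \<in> \<real>\<^sub>\<ge>\<^sub>0"
  using qtrace_eq_sum[of N \<rho>] psd_diag[of N \<rho>] by (simp add: psd_def sum_nonneg_Reals)

lemma psd_qtrace_of_real: "psd N \<rho> \<Longrightarrow> qtrace \<rho> = complex_of_real (Re (qtrace \<rho>))"
  by (drule psd_qtrace) (auto simp: nonneg_Reals_iff_of_real)

lemma psd_qtrace_nonneg: "psd N \<rho> \<Longrightarrow> 0 \<le> Re (qtrace \<rho>)"
  by (drule psd_qtrace) (auto simp: nonneg_Reals_iff_of_real)

text \<open>The matrix of a linear map on operators with respect to matrix units:
  \<open>\<kappa> u v U V\<close> is the weight with which the input entry at (u, v) contributes to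
  the output entry at (U, V). A map that consumes its block has output size 0, so that U and V are
  empty.\<close>

type_synonym kernel = "bits \<Rightarrow> bits \<Rightarrow> bits \<Rightarrow> bits \<Rightarrow> complex"

text \<open>
  The block of \<open>k\<close> qubits to which \<open>\<kappa>\<close> is applied has \<open>p\<close> qubits before and \<open>r\<close> qubits behind it.
  The guard on the lengths makes the composition laws unconditional.
\<close>

definition sop :: "nat \<Rightarrow> nat \<Rightarrow> nat \<Rightarrow> nat \<Rightarrow> kernel \<Rightarrow> qop \<Rightarrow> qop" where
  "sop p k s r \<kappa> \<rho> = (\<lambda>i j. if length i = p + s + r \<and> length j = p + s + r then
     (\<Sum>u\<in>bitstrings k. \<Sum>v\<in>bitstrings k. \<kappa> u v (take s (drop p i)) (take s (drop p j)) *
       \<rho> (take p i @ u @ drop (p + s) i) (take p j @ v @ drop (p + s) j)) else 0)"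

lemma supported_sop: "supported (p + s + r) (sop p k s r \<kappa> \<rho>)"
  by (auto simp: supported_def sop_def bitstrings_def)

lemma sop_append:
  assumes "length a = p" "length a' = p" "length U = s" "length V = s" "length c = r" "length c' = r"
  shows "sop p k s r \<kappa> \<rho> (a @ U @ c) (a' @ V @ c') =
    (\<Sum>u\<in>bitstrings k. \<Sum>v\<in>bitstrings k. \<kappa> u v U V * \<rho> (a @ u @ c) (a' @ v @ c'))"
  using assms by (simp add: sop_def)

text \<open>Indices of the right length split into the part before, in and behind the block; at all
  others both sides vanish. This reduces every law for \<open>sop\<close> to an identity of finite
  sums.\<close>

lemma eq_sopI:
  assumes "supported (p + s + r) X"
    and "\<And>a a' U V c c'. \<lbrakk>length a = p; length a' = p; length U = s; length V = s; length c = r; length c' = r\<rbrakk>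
      \<Longrightarrow> X (a @ U @ c) (a' @ V @ c') =
          (\<Sum>u\<in>bitstrings k. \<Sum>v\<in>bitstrings k. \<kappa> u v U V * \<rho> (a @ u @ c) (a' @ v @ c'))"
  shows "X = sop p k s r \<kappa> \<rho>"
proof (rule supported_eqI[OF assms(1) supported_sop])
  fix i j :: bits assume "length i = p + s + r" "length j = p + s + r"
  then obtain a U c a' V c' where "i = a @ U @ c" "length a = p" "length U = s" "length c = r"
    "j = a' @ V @ c'" "length a' = p" "length V = s" "length c' = r"
    by (metis split3_bitstrings)
  then show "X i j = sop p k s r \<kappa> \<rho> i j" by (simp add: assms(2) sop_append)
qed

lemma sop_cong:
  assumes "\<And>u v U V. \<lbrakk>length u = k; length v = k; length U = s; length V = s\<rbrakk> \<Longrightarrow> \<kappa> u v U V = \<kappa>' u v U V"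
  shows "sop p k s r \<kappa> \<rho> = sop p k s r \<kappa>' \<rho>"
  by (rule eq_sopI[OF supported_sop])
     (simp add: sop_append assms mem_bitstrings cong: sum.cong_simp)

text \<open>The matrix product of superoperators, summed over the pair of intermediate
  indices.\<close>

definition kcomp :: "nat \<Rightarrow> kernel \<Rightarrow> kernel \<Rightarrow> kernel" where
  "kcomp m \<kappa>2 \<kappa>1 u v U V = (\<Sum>a\<in>bitstrings m. \<Sum>b\<in>bitstrings m. \<kappa>2 a b U V * \<kappa>1 u v a b)"

lemma sop_sop: "sop p m s r \<kappa>2 (sop p k m r \<kappa>1 \<rho>) = sop p k s r (kcomp m \<kappa>2 \<kappa>1) \<rho>"
proof (rule eq_sopI[OF supported_sop])
  let ?B = bitstrings
  fix a a' U V c c' :: bits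
  assume l: "length a = p" "length a' = p" "length U = s" "length V = s" "length c = r" "length c' = r"
  have "sop p m s r \<kappa>2 (sop p k m r \<kappa>1 \<rho>) (a @ U @ c) (a' @ V @ c') =
    (\<Sum>x\<in>?B m. \<Sum>y\<in>?B m. \<kappa>2 x y U V *
       (\<Sum>u\<in>?B k. \<Sum>v\<in>?B k. \<kappa>1 u v x y * \<rho> (a @ u @ c) (a' @ v @ c')))"
    using l by (simp add: sop_append mem_bitstrings cong: sum.cong_simp)
  also have "\<dots> = (\<Sum>u\<in>?B k. \<Sum>v\<in>?B k. \<Sum>x\<in>?B m. \<Sum>y\<in>?B m.
       \<kappa>2 x y U V * (\<kappa>1 u v x y * \<rho> (a @ u @ c) (a' @ v @ c')))"
    unfolding sum_distrib_left by (rule sum_double_swap)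
  also have "\<dots> = (\<Sum>u\<in>?B k. \<Sum>v\<in>?B k. kcomp m \<kappa>2 \<kappa>1 u v U V * \<rho> (a @ u @ c) (a' @ v @ c'))"
    by (simp add: kcomp_def sum_distrib_right mult.assoc)
  finally show "sop p m s r \<kappa>2 (sop p k m r \<kappa>1 \<rho>) (a @ U @ c) (a' @ V @ c') = \<dots>" .
qed

definition kten :: "nat \<Rightarrow> nat \<Rightarrow> kernel \<Rightarrow> kernel \<Rightarrow> kernel" where
  "kten k s \<kappa>1 \<kappa>2 u v U V = \<kappa>1 (take k u) (take k v) (take s U) (take s V) *
     \<kappa>2 (drop k u) (drop k v) (drop s U) (drop s V)"

lemma kten_append:
  "\<lbrakk>length u = k; length v = k; length U = s; length V = s\<rbrakk> \<Longrightarrow>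
   kten k s \<kappa>1 \<kappa>2 (u @ u') (v @ v') (U @ U') (V @ V') = \<kappa>1 u v U V * \<kappa>2 u' v' U' V'"
  by (simp add: kten_def)

lemma split_append: "length U = a + b \<Longrightarrow> \<exists>U1 U2. U = U1 @ U2 \<and> length U1 = a \<and> length U2 = b"
  by (rule exI[of _ "take a U"], rule exI[of _ "drop a U"]) simp

lemma kten_sum:
  assumes "length U1 = s" "length V1 = s"
  shows "(\<Sum>u\<in>bitstrings (k + m). \<Sum>v\<in>bitstrings (k + m). kten k s \<kappa>1 \<kappa>2 u v (U1 @ U2) (V1 @ V2) * f u v)
     = (\<Sum>u\<in>bitstrings k. \<Sum>v\<in>bitstrings k. \<Sum>u'\<in>bitstrings m. \<Sum>v'\<in>bitstrings m.
          \<kappa>1 u v U1 V1 * \<kappa>2 u' v' U2 V2 * f (u @ u') (v @ v'))"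
proof -
  let ?B = bitstrings
  have "(\<Sum>u\<in>?B (k + m). \<Sum>v\<in>?B (k + m). kten k s \<kappa>1 \<kappa>2 u v (U1 @ U2) (V1 @ V2) * f u v)
     = (\<Sum>u\<in>?B k. \<Sum>u'\<in>?B m. \<Sum>v\<in>?B k. \<Sum>v'\<in>?B m.
          \<kappa>1 u v U1 V1 * \<kappa>2 u' v' U2 V2 * f (u @ u') (v @ v'))"
    using assms by (simp add: sum_bitstrings_append kten_append mem_bitstrings cong: sum.cong_simp)
  also have "\<dots> = (\<Sum>u\<in>?B k. \<Sum>v\<in>?B k. \<Sum>u'\<in>?B m. \<Sum>v'\<in>?B m.
          \<kappa>1 u v U1 V1 * \<kappa>2 u' v' U2 V2 * f (u @ u') (v @ v'))"
    by (intro sum.cong refl sum.swap)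
  finally show ?thesis .
qed

lemma sop_kten:
  "sop (p + s) m t r \<kappa>2 (sop p k s (m + r) \<kappa>1 \<rho>) = sop p (k + m) (s + t) r (kten k s \<kappa>1 \<kappa>2) \<rho>"
proof (rule eq_sopI)
  let ?B = bitstrings
  show "supported (p + (s + t) + r) (sop (p + s) m t r \<kappa>2 (sop p k s (m + r) \<kappa>1 \<rho>))"
    using supported_sop[of "p + s" t r] by (simp add: add.assoc)
  fix a a' U V c c' :: bits
  assume l: "length a = p" "length a' = p" "length U = s + t" "length V = s + t" "length c = r" "length c' = r"
  obtain U1 U2 V1 V2 where UV: "U = U1 @ U2" "V = V1 @ V2" "length U1 = s" "length V1 = s" "length U2 = t" "length V2 = t"
    using split_append[OF l(3)] split_append[OF l(4)] by blast
  have "sop (p + s) m t r \<kappa>2 (sop p k s (m + r) \<kappa>1 \<rho>) ((a @ U1) @ U2 @ c) ((a' @ V1) @ V2 @ c') =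
    (\<Sum>x\<in>?B m. \<Sum>y\<in>?B m. \<kappa>2 x y U2 V2 * sop p k s (m + r) \<kappa>1 \<rho> (a @ U1 @ x @ c) (a' @ V1 @ y @ c'))"
    using l UV by (subst sop_append) simp_all
  also have "\<dots> = (\<Sum>x\<in>?B m. \<Sum>y\<in>?B m. \<kappa>2 x y U2 V2 *
     (\<Sum>u\<in>?B k. \<Sum>v\<in>?B k. \<kappa>1 u v U1 V1 * \<rho> (a @ u @ x @ c) (a' @ v @ y @ c')))"
    using l UV by (intro sum.cong refl arg_cong2[of _ _ _ _ "(*)"] sop_append) (auto simp: mem_bitstrings)
  also have "\<dots> = (\<Sum>u\<in>?B k. \<Sum>v\<in>?B k. \<Sum>x\<in>?B m. \<Sum>y\<in>?B m.
     \<kappa>2 x y U2 V2 * (\<kappa>1 u v U1 V1 * \<rho> (a @ u @ x @ c) (a' @ v @ y @ c')))"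
    unfolding sum_distrib_left by (rule sum_double_swap)
  also have "\<dots> = (\<Sum>u\<in>?B (k + m). \<Sum>v\<in>?B (k + m). kten k s \<kappa>1 \<kappa>2 u v U V * \<rho> (a @ u @ c) (a' @ v @ c'))"
    unfolding UV(1,2) kten_sum[OF UV(3,4)] by (simp add: mult_ac)
  finally show "sop (p + s) m t r \<kappa>2 (sop p k s (m + r) \<kappa>1 \<rho>) (a @ U @ c) (a' @ V @ c') = \<dots>"
    by (simp add: UV)
qed

text \<open>Here the right factor acts first, while the left block still has its input size, whence
  the position \<open>p + k\<close> instead of \<open>p + s\<close>. Having both orders allows
  either factor of a tensor product to be contracted first, which the exchange argument in
  \<open>close_tens\<close> requires.\<close>

lemma sop_kten':
  "sop p k s (t + r) \<kappa>1 (sop (p + k) m t r \<kappa>2 \<rho>) = sop p (k + m) (s + t) r (kten k s \<kappa>1 \<kappa>2) \<rho>"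
proof (rule eq_sopI)
  let ?B = bitstrings
  show "supported (p + (s + t) + r) (sop p k s (t + r) \<kappa>1 (sop (p + k) m t r \<kappa>2 \<rho>))"
    using supported_sop[of p s "t + r"] by (simp add: add.assoc)
  fix a a' U V c c' :: bits
  assume l: "length a = p" "length a' = p" "length U = s + t" "length V = s + t" "length c = r" "length c' = r"
  obtain U1 U2 V1 V2 where UV: "U = U1 @ U2" "V = V1 @ V2" "length U1 = s" "length V1 = s" "length U2 = t" "length V2 = t"
    using split_append[OF l(3)] split_append[OF l(4)] by blast
  have *: "sop (p + k) m t r \<kappa>2 \<rho> (a @ u @ U2 @ c) (a' @ v @ V2 @ c') =
      (\<Sum>x\<in>?B m. \<Sum>y\<in>?B m. \<kappa>2 x y U2 V2 * \<rho> (a @ u @ x @ c) (a' @ v @ y @ c'))"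
    if "u \<in> ?B k" "v \<in> ?B k" for u v
    using sop_append[of "a @ u" "p + k" "a' @ v" U2 t V2 c r c'] l UV that by (simp add: mem_bitstrings)
  have "sop p k s (t + r) \<kappa>1 (sop (p + k) m t r \<kappa>2 \<rho>) (a @ U1 @ U2 @ c) (a' @ V1 @ V2 @ c') =
    (\<Sum>u\<in>?B k. \<Sum>v\<in>?B k. \<kappa>1 u v U1 V1 * sop (p + k) m t r \<kappa>2 \<rho> (a @ u @ U2 @ c) (a' @ v @ V2 @ c'))"
    using l UV by (subst sop_append) simp_all
  also have "\<dots> = (\<Sum>u\<in>?B (k + m). \<Sum>v\<in>?B (k + m). kten k s \<kappa>1 \<kappa>2 u v U V * \<rho> (a @ u @ c) (a' @ v @ c'))"
    using UV by (simp add: kten_sum * sum_distrib_left mult.assoc)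
  finally show "sop p k s (t + r) \<kappa>1 (sop (p + k) m t r \<kappa>2 \<rho>) (a @ U @ c) (a' @ V @ c') = \<dots>"
    by (simp add: UV)
qed

lemma sop_sum_kernel:
  "sop p k s r (\<lambda>u v U V. \<Sum>c\<in>C. \<kappa> c u v U V) \<rho> = (\<lambda>i j. \<Sum>c\<in>C. sop p k s r (\<kappa> c) \<rho> i j)"
proof (intro ext)
  fix i j
  show "sop p k s r (\<lambda>u v U V. \<Sum>c\<in>C. \<kappa> c u v U V) \<rho> i j = (\<Sum>c\<in>C. sop p k s r (\<kappa> c) \<rho> i j)"
  proof (cases "length i = p + s + r \<and> length j = p + s + r")
    case True
    then show ?thesis
      by (simp add: sop_def sum_distrib_right) (rule sum_rotate3[symmetric])
  qed (auto simp: sop_def)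
qed

lemma sop_divide: "sop p k s r \<kappa> (\<lambda>i j. \<rho> i j / t) = (\<lambda>i j. sop p k s r \<kappa> \<rho> i j / t)"
  by (intro ext) (simp add: sop_def sum_divide_distrib)

lemma sop_one: "supported (p + r) \<rho> \<Longrightarrow> sop p 0 0 r (\<lambda>_ _ _ _. 1) \<rho> = \<rho>"
  by (rule eq_sopI[symmetric]) auto

section \<open>Complete positivity\<close>

lemma psd_sum:
  assumes "\<And>c. c \<in> C \<Longrightarrow> psd N (X c)"
  shows "psd N (\<lambda>i j. \<Sum>c\<in>C. X c i j)"
  unfolding psd_def
proof (intro conjI allI)
  let ?B = bitstrings
  show "supported N (\<lambda>i j. \<Sum>c\<in>C. X c i j)"
    using assms unfolding psd_def supported_def by (meson sum.not_neutral_contains_not_neutral)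
  fix v
  have "(\<Sum>i\<in>?B N. \<Sum>j\<in>?B N. cnj (v i) * (\<Sum>c\<in>C. X c i j) * v j) =
     (\<Sum>c\<in>C. \<Sum>i\<in>?B N. \<Sum>j\<in>?B N. cnj (v i) * X c i j * v j)"
    unfolding sum_distrib_left sum_distrib_right
    by (rule trans[OF sum.cong[OF refl sum.swap] sum.swap])
  then show "(\<Sum>i\<in>?B N. \<Sum>j\<in>?B N. cnj (v i) * (\<Sum>c\<in>C. X c i j) * v j) \<in> \<real>\<^sub>\<ge>\<^sub>0"
    using assms by (simp add: psd_def sum_nonneg_Reals)
qed

text \<open>Complete positivity in operational form: positivity survives in the presence of any
  number of spectator qubits on either side.\<close>

definition cp :: "nat \<Rightarrow> nat \<Rightarrow> kernel \<Rightarrow> bool" where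
  "cp k s \<kappa> \<longleftrightarrow> (\<forall>p r \<rho>. psd (p + k + r) \<rho> \<longrightarrow> psd (p + s + r) (sop p k s r \<kappa> \<rho>))"

lemma cpD: "cp k s \<kappa> \<Longrightarrow> psd (p + k + r) \<rho> \<Longrightarrow> psd (p + s + r) (sop p k s r \<kappa> \<rho>)"
  by (simp add: cp_def)

lemma cp_kcomp: "cp k m \<kappa>1 \<Longrightarrow> cp m s \<kappa>2 \<Longrightarrow> cp k s (kcomp m \<kappa>2 \<kappa>1)"
  by (simp add: cp_def flip: sop_sop)

lemma cp_kten:
  assumes "cp k s \<kappa>1" "cp m t \<kappa>2" shows "cp (k + m) (s + t) (kten k s \<kappa>1 \<kappa>2)"
  unfolding cp_def
proof (intro allI impI)
  fix p r \<rho> assume "psd (p + (k + m) + r) \<rho>"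
  then have "psd (p + s + (m + r)) (sop p k s (m + r) \<kappa>1 \<rho>)"
    using assms(1) by (intro cpD) (simp_all add: add_ac)
  then show "psd (p + (s + t) + r) (sop p (k + m) (s + t) r (kten k s \<kappa>1 \<kappa>2) \<rho>)"
    using cpD[OF assms(2), of "p + s" r] by (simp add: add_ac flip: sop_kten)
qed

lemma cp_sum: "(\<And>c. c \<in> C \<Longrightarrow> cp k s (\<kappa> c)) \<Longrightarrow> cp k s (\<lambda>u v U V. \<Sum>c\<in>C. \<kappa> c u v U V)"
  by (simp add: cp_def sop_sum_kernel psd_sum)

lemma cp_one: "cp 0 0 (\<lambda>_ _ _ _. 1)"
  by (auto simp: cp_def psd_def sop_one)

text \<open>Conjugation by one Kraus operator, where \<open>K u U\<close> is the coefficient of the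
  basis vector U in the image of u.\<close>

definition kraus :: "(bits \<Rightarrow> bits \<Rightarrow> complex) \<Rightarrow> kernel" where
  "kraus K u v U V = K u U * cnj (K v V)"

text \<open>The quadratic form of the image at x is the quadratic form of \<open>\<rho>\<close> at
  \<open>y\<close>, the adjoint of the local operator applied to x with the spectator indices
  carried along.\<close>

lemma cp_kraus: "cp k s (kraus K)"
  unfolding cp_def
proof (intro allI impI)
  fix p r \<rho> assume \<rho>: "psd (p + k + r) \<rho>"
  show "psd (p + s + r) (sop p k s r (kraus K) \<rho>)"
    unfolding psd_def
  proof (intro conjI allI supported_sop)
    fix x :: "bits \<Rightarrow> complex"
    let ?B = bitstrings
    define y where "y i = (\<Sum>U\<in>?B s. x (take p i @ U @ drop (p + k) i) * cnj (K (take k (drop p i)) U))" for i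
    have y: "y (a @ u @ c) = (\<Sum>U\<in>?B s. x (a @ U @ c) * cnj (K u U))"
      if "a \<in> ?B p" "u \<in> ?B k" "c \<in> ?B r" for a u c using that by (simp add: y_def mem_bitstrings)
    have split: "(\<Sum>i\<in>?B (p + q + r). f i) = (\<Sum>a\<in>?B p. \<Sum>c\<in>?B r. \<Sum>u\<in>?B q. f (a @ u @ c))" for f :: "bits \<Rightarrow> complex" and q
    proof -
      have "(\<Sum>i\<in>?B (p + q + r). f i) = (\<Sum>a\<in>?B p. \<Sum>u\<in>?B q. \<Sum>c\<in>?B r. f (a @ u @ c))"
        by (simp add: sum_bitstrings_append)
      also have "\<dots> = (\<Sum>a\<in>?B p. \<Sum>c\<in>?B r. \<Sum>u\<in>?B q. f (a @ u @ c))"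
        by (intro sum.cong refl sum.swap)
      finally show ?thesis .
    qed
    have "(\<Sum>i\<in>?B (p + s + r). \<Sum>j\<in>?B (p + s + r). cnj (x i) * sop p k s r (kraus K) \<rho> i j * x j)
      = (\<Sum>a\<in>?B p. \<Sum>c\<in>?B r. \<Sum>a'\<in>?B p. \<Sum>c'\<in>?B r. \<Sum>U\<in>?B s. \<Sum>V\<in>?B s.
          cnj (x (a @ U @ c)) * sop p k s r (kraus K) \<rho> (a @ U @ c) (a' @ V @ c') * x (a' @ V @ c'))"
      unfolding split by (rule sum.cong[OF refl], rule sum.cong[OF refl], rule sum_rotate3)
    also have "\<dots> = (\<Sum>a\<in>?B p. \<Sum>c\<in>?B r. \<Sum>a'\<in>?B p. \<Sum>c'\<in>?B r. \<Sum>U\<in>?B s. \<Sum>V\<in>?B s.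
        \<Sum>u\<in>?B k. \<Sum>v\<in>?B k. cnj (x (a @ U @ c)) * (K u U * cnj (K v V) * \<rho> (a @ u @ c) (a' @ v @ c')) * x (a' @ V @ c'))"
      by (intro sum.cong refl) (simp add: sop_append mem_bitstrings kraus_def sum_distrib_left sum_distrib_right)
    also have "\<dots> = (\<Sum>a\<in>?B p. \<Sum>c\<in>?B r. \<Sum>a'\<in>?B p. \<Sum>c'\<in>?B r. \<Sum>u\<in>?B k. \<Sum>v\<in>?B k.
        \<Sum>U\<in>?B s. \<Sum>V\<in>?B s. cnj (x (a @ U @ c)) * (K u U * cnj (K v V) * \<rho> (a @ u @ c) (a' @ v @ c')) * x (a' @ V @ c'))"
      by (intro sum.cong refl sum_double_swap)
    also have "\<dots> = (\<Sum>a\<in>?B p. \<Sum>c\<in>?B r. \<Sum>a'\<in>?B p. \<Sum>c'\<in>?B r. \<Sum>u\<in>?B k. \<Sum>v\<in>?B k.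
        cnj (y (a @ u @ c)) * \<rho> (a @ u @ c) (a' @ v @ c') * y (a' @ v @ c'))"
      by (intro sum.cong refl) (simp only: y cnj_sum complex_cnj_mult complex_cnj_cnj sum_mult_mult_sum, simp only: mult_ac)
    also have "\<dots> = (\<Sum>i\<in>?B (p + k + r). \<Sum>j\<in>?B (p + k + r). cnj (y i) * \<rho> i j * y j)"
      unfolding split by (rule sum.cong[OF refl], rule sum.cong[OF refl], rule sum_rotate3[symmetric])
    finally show "(\<Sum>i\<in>?B (p + s + r). \<Sum>j\<in>?B (p + s + r). cnj (x i) * sop p k s r (kraus K) \<rho> i j * x j) \<in> \<real>\<^sub>\<ge>\<^sub>0"
      using \<rho> by (simp add: psd_def)
  qed
qed

section \<open>Instruments\<close>

text \<open>The hypothesis on \<open>\<kappa>\<close> is the completeness relation of Kraus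
  operators in kernel form: tracing out the output and summing over the outcomes leaves the identity
  on the input.\<close>

lemma sum_qtrace_sop:
  assumes \<rho>: "supported (p + k + r) \<rho>"
    and one: "\<And>u v. \<lbrakk>length u = k; length v = k\<rbrakk> \<Longrightarrow>
      (\<Sum>c\<in>C. \<Sum>U\<in>bitstrings s. \<kappa> c u v U U) = of_bool (u = v)"
  shows "(\<Sum>c\<in>C. qtrace (sop p k s r (\<kappa> c) \<rho>)) = qtrace \<rho>"
proof -
  let ?B = bitstrings
  have "(\<Sum>c\<in>C. qtrace (sop p k s r (\<kappa> c) \<rho>)) =
     (\<Sum>c\<in>C. \<Sum>a\<in>?B p. \<Sum>U\<in>?B s. \<Sum>e\<in>?B r. sop p k s r (\<kappa> c) \<rho> (a @ U @ e) (a @ U @ e))"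
    by (simp add: qtrace_eq_sum[OF supported_sop] sum_bitstrings_append)
  also have "\<dots> = (\<Sum>c\<in>C. \<Sum>a\<in>?B p. \<Sum>U\<in>?B s. \<Sum>e\<in>?B r. \<Sum>u\<in>?B k. \<Sum>v\<in>?B k.
      \<kappa> c u v U U * \<rho> (a @ u @ e) (a @ v @ e))"
    by (intro sum.cong refl) (simp add: sop_append mem_bitstrings)
  also have "\<dots> = (\<Sum>c\<in>C. \<Sum>a\<in>?B p. \<Sum>e\<in>?B r. \<Sum>U\<in>?B s. \<Sum>u\<in>?B k. \<Sum>v\<in>?B k.
      \<kappa> c u v U U * \<rho> (a @ u @ e) (a @ v @ e))"
    by (rule sum.cong[OF refl], rule sum.cong[OF refl], rule sum.swap)
  also have "\<dots> = (\<Sum>a\<in>?B p. \<Sum>e\<in>?B r. \<Sum>c\<in>C. \<Sum>U\<in>?B s. \<Sum>u\<in>?B k. \<Sum>v\<in>?B k.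
      \<kappa> c u v U U * \<rho> (a @ u @ e) (a @ v @ e))"
    by (rule sum_rotate3)
  also have "\<dots> = (\<Sum>a\<in>?B p. \<Sum>e\<in>?B r. \<Sum>u\<in>?B k. \<Sum>v\<in>?B k. \<Sum>c\<in>C. \<Sum>U\<in>?B s.
      \<kappa> c u v U U * \<rho> (a @ u @ e) (a @ v @ e))"
    by (rule sum.cong[OF refl], rule sum.cong[OF refl], rule sum_double_swap)
  also have "\<dots> = (\<Sum>a\<in>?B p. \<Sum>e\<in>?B r. \<Sum>u\<in>?B k. \<Sum>v\<in>?B k. of_bool (u = v) * \<rho> (a @ u @ e) (a @ v @ e))"
    by (intro sum.cong refl) (simp add: one[symmetric] mem_bitstrings sum_distrib_right)
  also have "\<dots> = (\<Sum>a\<in>?B p. \<Sum>e\<in>?B r. \<Sum>u\<in>?B k. \<rho> (a @ u @ e) (a @ u @ e))"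
    by (intro sum.cong refl) (simp add: of_bool_def if_distribR if_distrib[of "\<lambda>x. x * _"] cong: if_cong)
  also have "\<dots> = (\<Sum>a\<in>?B p. \<Sum>u\<in>?B k. \<Sum>e\<in>?B r. \<rho> (a @ u @ e) (a @ u @ e))"
    by (rule sum.cong[OF refl], rule sum.swap)
  also have "\<dots> = qtrace \<rho>"
    by (simp add: qtrace_eq_sum[OF \<rho>] sum_bitstrings_append)
  finally show ?thesis .
qed

text \<open>A quantum instrument: one completely positive map for each outcome, with
  trace-preserving sum. The trace condition ranges over all supported operators, not only positive
  ones; it is linear, so it passes to compositions without any positivity argument.\<close>

definition instrument :: "'c set \<Rightarrow> nat \<Rightarrow> nat \<Rightarrow> ('c \<Rightarrow> kernel) \<Rightarrow> bool" where
  "instrument C k s \<kappa> \<longleftrightarrow> finite C \<and> (\<forall>c\<in>C. cp k s (\<kappa> c)) \<and>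
     (\<forall>p r \<rho>. supported (p + k + r) \<rho> \<longrightarrow> (\<Sum>c\<in>C. qtrace (sop p k s r (\<kappa> c) \<rho>)) = qtrace \<rho>)"

lemma instrumentI:
  assumes "finite C" "\<And>c. c \<in> C \<Longrightarrow> cp k s (\<kappa> c)"
    and "\<And>u v. \<lbrakk>length u = k; length v = k\<rbrakk> \<Longrightarrow>
      (\<Sum>c\<in>C. \<Sum>U\<in>bitstrings s. \<kappa> c u v U U) = of_bool (u = v)"
  shows "instrument C k s \<kappa>"
  using assms by (auto simp: instrument_def intro!: sum_qtrace_sop)

lemma instrument_finite: "instrument C k s \<kappa> \<Longrightarrow> finite C"
  by (simp add: instrument_def)

lemma instrument_psd: "instrument C k s \<kappa> \<Longrightarrow> c \<in> C \<Longrightarrow> psd (p + k + r) \<rho> \<Longrightarrow> psd (p + s + r) (sop p k s r (\<kappa> c) \<rho>)"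
  by (simp add: instrument_def cpD)

lemma instrument_qtrace:
  "instrument C k s \<kappa> \<Longrightarrow> psd (p + k + r) \<rho> \<Longrightarrow> (\<Sum>c\<in>C. qtrace (sop p k s r (\<kappa> c) \<rho>)) = qtrace \<rho>"
  by (simp add: instrument_def psd_def)

text \<open>The injective labelling \<open>h\<close> leaves the shape of the joint outcome open: the
  later instances are \<open>#\<close>, \<open>Pair\<close> and, after a trivial first outcome, the
  second projection.\<close>

lemma instrument_kcomp:
  assumes 1: "instrument C k m \<kappa>1" and 2: "instrument D m s \<kappa>2"
    and inj: "inj_on (\<lambda>(c, d). h c d) (C \<times> D)"
    and \<kappa>: "\<And>c d. c \<in> C \<Longrightarrow> d \<in> D \<Longrightarrow> \<kappa> (h c d) = kcomp m (\<kappa>2 d) (\<kappa>1 c)"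
  shows "instrument ((\<lambda>(c, d). h c d) ` (C \<times> D)) k s \<kappa>"
  unfolding instrument_def
proof (intro conjI allI impI ballI)
  fix x assume "x \<in> (\<lambda>(c, d). h c d) ` (C \<times> D)"
  then show "cp k s (\<kappa> x)" using 1 2 by (auto simp: instrument_def \<kappa> cp_kcomp)
next
  fix p r \<rho> assume \<rho>: "supported (p + k + r) \<rho>"
  have "(\<Sum>x\<in>(\<lambda>(c, d). h c d) ` (C \<times> D). qtrace (sop p k s r (\<kappa> x) \<rho>)) =
      (\<Sum>c\<in>C. \<Sum>d\<in>D. qtrace (sop p m s r (\<kappa>2 d) (sop p k m r (\<kappa>1 c) \<rho>)))"
    by (subst sum.reindex[OF inj], simp add: sum.cartesian_product sop_sop, intro sum.cong refl)
       (auto simp: \<kappa>)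
  also have "\<dots> = (\<Sum>c\<in>C. qtrace (sop p k m r (\<kappa>1 c) \<rho>))"
    using 2 supported_sop by (intro sum.cong refl) (auto simp: instrument_def)
  finally show "(\<Sum>x\<in>(\<lambda>(c, d). h c d) ` (C \<times> D). qtrace (sop p k s r (\<kappa> x) \<rho>)) = qtrace \<rho>"
    using 1 \<rho> by (simp add: instrument_def)
qed (use 1 2 in \<open>auto simp: instrument_def\<close>)

lemma instrument_kten:
  assumes 1: "instrument C k s \<kappa>1" and 2: "instrument D m t \<kappa>2"
    and inj: "inj_on (\<lambda>(c, d). h c d) (C \<times> D)"
    and \<kappa>: "\<And>c d. c \<in> C \<Longrightarrow> d \<in> D \<Longrightarrow> \<kappa> (h c d) = kten k s (\<kappa>1 c) (\<kappa>2 d)"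
  shows "instrument ((\<lambda>(c, d). h c d) ` (C \<times> D)) (k + m) (s + t) \<kappa>"
  unfolding instrument_def
proof (intro conjI allI impI ballI)
  fix x assume "x \<in> (\<lambda>(c, d). h c d) ` (C \<times> D)"
  then show "cp (k + m) (s + t) (\<kappa> x)" using 1 2 by (auto simp: instrument_def \<kappa> cp_kten)
next
  fix p r \<rho> assume \<rho>: "supported (p + (k + m) + r) \<rho>"
  have "(\<Sum>x\<in>(\<lambda>(c, d). h c d) ` (C \<times> D). qtrace (sop p (k + m) (s + t) r (\<kappa> x) \<rho>)) =
      (\<Sum>c\<in>C. \<Sum>d\<in>D. qtrace (sop (p + s) m t r (\<kappa>2 d) (sop p k s (m + r) (\<kappa>1 c) \<rho>)))"
    by (subst sum.reindex[OF inj], simp add: sum.cartesian_product sop_kten, intro sum.cong refl)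
       (auto simp: \<kappa>)
  also have "\<dots> = (\<Sum>c\<in>C. qtrace (sop p k s (m + r) (\<kappa>1 c) \<rho>))"
    using 2 supported_sop[of p s "m + r"] by (intro sum.cong refl) (auto simp: instrument_def add.assoc)
  finally show "(\<Sum>x\<in>(\<lambda>(c, d). h c d) ` (C \<times> D). qtrace (sop p (k + m) (s + t) r (\<kappa> x) \<rho>)) = qtrace \<rho>"
    using 1 \<rho> by (simp add: instrument_def add.assoc)
qed (use 1 2 in \<open>auto simp: instrument_def\<close>)

section \<open>Sampling an instrument: outcome distributions and normalised states\<close>

definition normal :: "qop \<Rightarrow> qop" where
  "normal X = (\<lambda>i j. X i j / qtrace X)"

definition outcome :: "'c set \<Rightarrow> ('c \<Rightarrow> qop) \<Rightarrow> 'c pmf" where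
  "outcome C \<Phi> = embed_pmf (\<lambda>c. if c \<in> C then Re (qtrace (\<Phi> c)) else 0)"

definition instr :: "'c set \<Rightarrow> ('c \<Rightarrow> qop) \<Rightarrow> ('c \<times> qop) pmf" where
  "instr C \<Phi> = map_pmf (\<lambda>c. (c, normal (\<Phi> c))) (outcome C \<Phi>)"

lemma pmf_outcome:
  assumes "finite C" "\<And>c. c \<in> C \<Longrightarrow> psd N (\<Phi> c)" "(\<Sum>c\<in>C. qtrace (\<Phi> c)) = 1"
  shows "pmf (outcome C \<Phi>) c = (if c \<in> C then Re (qtrace (\<Phi> c)) else 0)"
  unfolding outcome_def
proof (rule pmf_embed_pmf)
  show "0 \<le> (if c \<in> C then Re (qtrace (\<Phi> c)) else 0)" for c
    using assms(2) psd_qtrace_nonneg by auto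
  have "(\<integral>\<^sup>+ c. ennreal (if c \<in> C then Re (qtrace (\<Phi> c)) else 0) \<partial>count_space UNIV) = (\<Sum>c\<in>C. ennreal (Re (qtrace (\<Phi> c))))"
    using assms(1) by (subst nn_integral_count_space'[of C]) auto
  also have "\<dots> = ennreal (\<Sum>c\<in>C. Re (qtrace (\<Phi> c)))"
    using assms(2) psd_qtrace_nonneg by (intro sum_ennreal) auto
  finally show "(\<integral>\<^sup>+ c. ennreal (if c \<in> C then Re (qtrace (\<Phi> c)) else 0) \<partial>count_space UNIV) = 1"
    using assms(3) by (simp flip: Re_sum)
qed

lemma supported_divide: "supported N X \<Longrightarrow> supported N (\<lambda>i j. X i j / t)"
  by (auto simp: supported_def)

lemma qtrace_divide: "supported N X \<Longrightarrow> qtrace (\<lambda>i j. X i j / t) = qtrace X / t"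
  by (simp add: qtrace_eq_sum[of N] supported_divide sum_divide_distrib)

lemma psd_normal:
  assumes "psd N X" shows "psd N (normal X)"
  unfolding psd_def normal_def
proof (intro conjI allI)
  let ?B = bitstrings
  show "supported N (\<lambda>i j. X i j / qtrace X)"
    using assms by (simp add: psd_def supported_divide)
  fix v
  have "(\<Sum>i\<in>?B N. \<Sum>j\<in>?B N. cnj (v i) * (X i j / qtrace X) * v j)
     = (\<Sum>i\<in>?B N. \<Sum>j\<in>?B N. cnj (v i) * X i j * v j) / qtrace X"
    by (simp add: sum_divide_distrib)
  also have "\<dots> \<in> \<real>\<^sub>\<ge>\<^sub>0"
    using assms psd_qtrace[OF assms] by (intro nonneg_Reals_divide_I) (auto simp: psd_def)
  finally show "(\<Sum>i\<in>?B N. \<Sum>j\<in>?B N. cnj (v i) * (X i j / qtrace X) * v j) \<in> \<real>\<^sub>\<ge>\<^sub>0" .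
qed

lemma density_normal: "psd N X \<Longrightarrow> qtrace X \<noteq> 0 \<Longrightarrow> density_operator N (normal X)"
  using psd_normal[of N X] qtrace_divide[of N X "qtrace X"]
  by (simp add: density_operator_iff psd_def normal_def)

lemma normal_divide: "supported N Y \<Longrightarrow> t \<noteq> 0 \<Longrightarrow> normal (\<lambda>i j. Y i j / t) = normal Y"
  by (simp add: normal_def qtrace_divide)

lemma normal_id: "qtrace X = 1 \<Longrightarrow> normal X = X"
  by (simp add: normal_def)

lemma outcome_image:
  assumes "finite C" "\<And>c. c \<in> C \<Longrightarrow> psd N (\<Phi> (h c))" "(\<Sum>c\<in>C. qtrace (\<Phi> (h c))) = 1" "inj_on h C"
  shows "outcome (h ` C) \<Phi> = map_pmf h (outcome C (\<lambda>c. \<Phi> (h c)))"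
proof (rule pmf_eqI)
  fix x
  have out: "pmf (outcome C (\<lambda>c. \<Phi> (h c))) c = (if c \<in> C then Re (qtrace (\<Phi> (h c))) else 0)" for c
    by (rule pmf_outcome) (use assms in auto)
  have L: "pmf (outcome (h ` C) \<Phi>) x = (if x \<in> h ` C then Re (qtrace (\<Phi> x)) else 0)"
    by (rule pmf_outcome[of _ N]) (use assms in \<open>auto simp: sum.reindex\<close>)
  have S: "set_pmf (outcome C (\<lambda>c. \<Phi> (h c))) \<subseteq> C"
    using out by (auto simp: set_pmf_iff split: if_splits)
  show "pmf (outcome (h ` C) \<Phi>) x = pmf (map_pmf h (outcome C (\<lambda>c. \<Phi> (h c)))) x"
  proof (cases "x \<in> h ` set_pmf (outcome C (\<lambda>c. \<Phi> (h c)))")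
    case True
    then obtain c where c: "x = h c" "c \<in> set_pmf (outcome C (\<lambda>c. \<Phi> (h c)))" by auto
    then have "pmf (map_pmf h (outcome C (\<lambda>c. \<Phi> (h c)))) x = pmf (outcome C (\<lambda>c. \<Phi> (h c))) c"
      using pmf_map_inj inj_on_subset[OF assms(4) S] by metis
    then show ?thesis using c S L out by auto
  next
    case False
    then have "pmf (map_pmf h (outcome C (\<lambda>c. \<Phi> (h c)))) x = 0"
      by (rule pmf_map_outside)
    moreover have "Re (qtrace (\<Phi> x)) = 0" if "x \<in> h ` C"
      using that False out by (auto simp: set_pmf_iff)
    ultimately show ?thesis by (auto simp: L)
  qed
qed

lemma pmf_bind_Pair: "pmf (bind_pmf p (\<lambda>c. map_pmf (Pair c) (q c))) (c, d) = pmf p c * pmf (q c) d"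
proof -
  have "pmf (map_pmf (Pair c') (q c')) (c, d) = indicator {c} c' * pmf (q c) d" for c'
  proof (cases "c' = c")
    case True
    then show ?thesis using pmf_map_inj'[of "Pair c" "q c" d] by (simp add: inj_on_def)
  next
    case False
    then show ?thesis by (auto intro!: pmf_map_outside)
  qed
  then have "pmf (bind_pmf p (\<lambda>c. map_pmf (Pair c) (q c))) (c, d) = (\<integral>c'. indicator {c} c' * pmf (q c) d \<partial>measure_pmf p)"
    by (simp add: pmf_bind)
  then show ?thesis by (simp add: measure_pmf_single)
qed

text \<open>Chain rule. The probability of c is the trace of its branch, and by homogeneity of
  \<open>\<Psi>\<close> the conditional probability of d is the trace of the joint branch divided by
  it; the normalisations cancel, so two sampling steps are one step of the joint family.\<close>

lemma instr_bind:
  assumes C: "finite C" "\<And>c. c \<in> C \<Longrightarrow> psd N (\<Phi> c)" "(\<Sum>c\<in>C. qtrace (\<Phi> c)) = 1"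
    and D: "finite D" "\<And>c d X. \<lbrakk>c \<in> C; d \<in> D; psd N X\<rbrakk> \<Longrightarrow> psd M (\<Psi> c d X)"
      "\<And>c X. \<lbrakk>c \<in> C; psd N X\<rbrakk> \<Longrightarrow> (\<Sum>d\<in>D. qtrace (\<Psi> c d X)) = qtrace X"
      "\<And>c d X t. \<Psi> c d (\<lambda>i j. X i j / t) = (\<lambda>i j. \<Psi> c d X i j / t)"
    and inj: "inj_on (\<lambda>(c, d). h c d) (C \<times> D)"
    and g: "\<And>c \<rho>. c \<in> C \<Longrightarrow> density_operator N \<rho> \<Longrightarrow> g c \<rho> = instr D (\<lambda>d. \<Psi> c d \<rho>)"
    and \<Xi>: "\<And>c d. c \<in> C \<Longrightarrow> d \<in> D \<Longrightarrow> \<Xi> (h c d) = \<Psi> c d (\<Phi> c)"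
  shows "bind_pmf (instr C \<Phi>) (\<lambda>(c, \<rho>). bind_pmf (g c \<rho>) (\<lambda>(d, \<rho>'). return_pmf (h c d, \<rho>'))) =
     instr ((\<lambda>(c, d). h c d) ` (C \<times> D)) \<Xi>"
    (is "bind_pmf _ ?F = instr ?CD \<Xi>")
proof -
  let ?X = "\<lambda>x. \<Xi> (case x of (c, d) \<Rightarrow> h c d)"
  let ?q = "\<lambda>c. outcome D (\<lambda>d. \<Psi> c d (normal (\<Phi> c)))"
  have out: "pmf (outcome C \<Phi>) c = (if c \<in> C then Re (qtrace (\<Phi> c)) else 0)" for c
    using C by (rule pmf_outcome)
  have nz: "c \<in> C \<and> qtrace (\<Phi> c) \<noteq> 0" if "c \<in> set_pmf (outcome C \<Phi>)" for c
    using that by (auto simp: set_pmf_iff out split: if_splits)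
  have q: "pmf (?q c) d = (if d \<in> D then Re (qtrace (\<Psi> c d (\<Phi> c))) / Re (qtrace (\<Phi> c)) else 0)"
    if c: "c \<in> C" "qtrace (\<Phi> c) \<noteq> 0" for c d
  proof -
    have dn: "density_operator N (normal (\<Phi> c))" using C c density_normal by blast
    have "pmf (?q c) d = (if d \<in> D then Re (qtrace (\<Psi> c d (normal (\<Phi> c)))) else 0)"
      by (rule pmf_outcome[of _ M]) (use D c dn in \<open>auto simp: density_operator_iff\<close>)
    moreover have "Re (qtrace (\<Psi> c d (normal (\<Phi> c)))) = Re (qtrace (\<Psi> c d (\<Phi> c))) / Re (qtrace (\<Phi> c))" if "d \<in> D"
    proof -
      have "qtrace (\<Psi> c d (normal (\<Phi> c))) = qtrace (\<Psi> c d (\<Phi> c)) / qtrace (\<Phi> c)"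
        using D(2)[OF c(1) that C(2)[OF c(1)]] by (simp add: normal_def D(4) qtrace_divide[of M] psd_def)
      also have "qtrace (\<Phi> c) = complex_of_real (Re (qtrace (\<Phi> c)))"
        using C(2) c psd_qtrace_of_real by blast
      finally show ?thesis by (metis Re_divide_of_real)
    qed
    ultimately show ?thesis by simp
  qed
  have setq: "set_pmf (?q c) \<subseteq> D" if "c \<in> C" "qtrace (\<Phi> c) \<noteq> 0" for c
    using q[OF that] by (auto simp: set_pmf_iff split: if_splits)
  \<comment> \<open>If the branch c has trace zero its conditional distribution carries no
    information. The continuations have nonnegative traces with sum zero, so the joint weights
    vanish as well and the product formula persists.\<close>
  have zero: "qtrace (\<Psi> c d (\<Phi> c)) = 0" if c: "c \<in> C" "d \<in> D" "qtrace (\<Phi> c) = 0" for c d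
  proof -
    have "(\<Sum>d\<in>D. Re (qtrace (\<Psi> c d (\<Phi> c)))) = 0"
      using D(3)[OF c(1) C(2)[OF c(1)]] c(3) by (simp flip: Re_sum)
    moreover have psd: "psd M (\<Psi> c d (\<Phi> c))" if "d \<in> D" for d using D(2) C(2) c(1) that by blast
    ultimately have "Re (qtrace (\<Psi> c d (\<Phi> c))) = 0"
      using D(1) c(2) psd_qtrace_nonneg by (subst (asm) sum_nonneg_eq_0_iff) auto
    then show ?thesis using psd_qtrace_of_real[OF psd[OF c(2)]] by simp
  qed
  have total: "(\<Sum>x\<in>C \<times> D. qtrace (?X x)) = 1"
  proof -
    have "(\<Sum>x\<in>C \<times> D. qtrace (?X x)) = (\<Sum>c\<in>C. \<Sum>d\<in>D. qtrace (\<Psi> c d (\<Phi> c)))"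
      by (simp add: sum.cartesian_product, intro sum.cong refl) (auto simp: \<Xi>)
    then show ?thesis using C(3) by (simp add: D(3) C(2))
  qed
  have psd\<Xi>: "psd M (?X x)" if "x \<in> C \<times> D" for x
    using that D(2) C(2) by (auto simp: \<Xi>)
  have pair: "bind_pmf (outcome C \<Phi>) (\<lambda>c. map_pmf (Pair c) (?q c)) =
      outcome (C \<times> D) ?X"
  proof (rule pmf_eqI)
    fix x :: "'a \<times> 'b"
    obtain c d where x: "x = (c, d)" by force
    have "pmf (outcome (C \<times> D) ?X) (c, d) =
       (if (c, d) \<in> C \<times> D then Re (qtrace (\<Xi> (case (c, d) of (c, d) \<Rightarrow> h c d))) else 0)"
      by (rule pmf_outcome[of _ M]) (use C D psd\<Xi> total in auto)
    also have "\<dots> = pmf (outcome C \<Phi>) c * pmf (?q c) d"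
      by (cases "c \<in> C"; cases "qtrace (\<Phi> c) = 0")
         (auto simp: out q \<Xi> zero dest: psd_qtrace_of_real[OF C(2)])
    finally show "pmf (bind_pmf (outcome C \<Phi>) (\<lambda>c. map_pmf (Pair c) (?q c))) x =
       pmf (outcome (C \<times> D) ?X) x"
      by (simp add: x pmf_bind_Pair)
  qed
  have "bind_pmf (instr C \<Phi>) ?F =
    bind_pmf (outcome C \<Phi>) (\<lambda>c. bind_pmf (g c (normal (\<Phi> c))) (\<lambda>(d, \<rho>'). return_pmf (h c d, \<rho>')))"
    by (simp add: instr_def bind_map_pmf)
  also have "\<dots> = bind_pmf (outcome C \<Phi>) (\<lambda>c. map_pmf (\<lambda>d. (h c d, normal (\<Xi> (h c d)))) (?q c))"
  proof (rule bind_pmf_cong[OF refl])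
    \<comment> \<open>\<open>g\<close> is known only on density operators. On the support of the
      first outcome the branch has nonzero trace, so its normalisation is one.\<close>
    fix c assume "c \<in> set_pmf (outcome C \<Phi>)"
    then have c: "c \<in> C" "qtrace (\<Phi> c) \<noteq> 0" using nz by auto
    have "bind_pmf (g c (normal (\<Phi> c))) (\<lambda>(d, \<rho>'). return_pmf (h c d, \<rho>')) =
       map_pmf (\<lambda>d. (h c d, normal (\<Psi> c d (normal (\<Phi> c))))) (?q c)"
      using g[OF c(1) density_normal[OF C(2) c(2)]] c by (simp add: instr_def map_pmf_def bind_assoc_pmf bind_return_pmf)
    also have "\<dots> = map_pmf (\<lambda>d. (h c d, normal (\<Xi> (h c d)))) (?q c)"
    proof (rule map_pmf_cong[OF refl])
      fix d assume "d \<in> set_pmf (?q c)"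
      then have d: "d \<in> D" using setq c by blast
      have "normal (\<Psi> c d (normal (\<Phi> c))) = normal (\<Psi> c d (\<Phi> c))"
        using D(2)[OF c(1) d C(2)[OF c(1)]] c(2)
        by (simp add: normal_def[of "\<Phi> c"] D(4) normal_divide[of M] psd_def)
      then show "(h c d, normal (\<Psi> c d (normal (\<Phi> c)))) = (h c d, normal (\<Xi> (h c d)))"
        by (simp add: \<Xi> c d)
    qed
    finally show "bind_pmf (g c (normal (\<Phi> c))) (\<lambda>(d, \<rho>'). return_pmf (h c d, \<rho>')) = \<dots>" .
  qed
  also have "\<dots> = map_pmf (\<lambda>x. (x, normal (\<Xi> x))) (map_pmf (\<lambda>(c, d). h c d)
      (bind_pmf (outcome C \<Phi>) (\<lambda>c. map_pmf (Pair c) (?q c))))"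
    by (simp add: map_bind_pmf map_pmf_comp)
  also have "\<dots> = map_pmf (\<lambda>x. (x, normal (\<Xi> x))) (outcome ?CD \<Xi>)"
    unfolding pair by (subst outcome_image[of _ M]) (use C D psd\<Xi> total inj in auto)
  finally show ?thesis by (simp add: instr_def)
qed

text \<open>Only states of trace one are constrained: the measurements build their distribution with
  \<open>embed_pmf\<close>, whose value is controlled only if the weights sum to 1.\<close>

definition implements :: "(nat \<Rightarrow> qop \<Rightarrow> ('c \<times> qop) pmf) \<Rightarrow> 'c set \<Rightarrow> nat \<Rightarrow> nat \<Rightarrow> ('c \<Rightarrow> kernel) \<Rightarrow> bool" where
  "implements f C k s \<kappa> \<longleftrightarrow> instrument C k s \<kappa> \<and>
     (\<forall>p r \<rho>. density_operator (p + k + r) \<rho> \<longrightarrow> f p \<rho> = instr C (\<lambda>c. sop p k s r (\<kappa> c) \<rho>))"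

lemma implements_kcomp:
  assumes f: "implements f C k m \<kappa>1" and g: "implements g D m s \<kappa>2"
    and inj: "inj_on (\<lambda>(c, d). h c d) (C \<times> D)"
    and \<kappa>: "\<And>c d. c \<in> C \<Longrightarrow> d \<in> D \<Longrightarrow> \<kappa> (h c d) = kcomp m (\<kappa>2 d) (\<kappa>1 c)"
  shows "implements (\<lambda>p \<rho>. bind_pmf (f p \<rho>) (\<lambda>(c, \<rho>'). bind_pmf (g p \<rho>') (\<lambda>(d, \<rho>''). return_pmf (h c d, \<rho>''))))
     ((\<lambda>(c, d). h c d) ` (C \<times> D)) k s \<kappa>" (is "implements ?f ?CD _ _ _")
  unfolding implements_def
proof (intro conjI allI impI)
  have 1: "instrument C k m \<kappa>1" and 2: "instrument D m s \<kappa>2"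
    using f g by (simp_all add: implements_def)
  show "instrument ?CD k s \<kappa>"
    by (rule instrument_kcomp[OF 1 2 inj \<kappa>])
  fix p r \<rho> assume \<rho>: "density_operator (p + k + r) \<rho>"
  then have "f p \<rho> = instr C (\<lambda>c. sop p k m r (\<kappa>1 c) \<rho>)"
    using f by (simp add: implements_def)
  also have "bind_pmf \<dots> (\<lambda>(c, \<rho>'). bind_pmf (g p \<rho>') (\<lambda>(d, \<rho>''). return_pmf (h c d, \<rho>''))) =
    instr ?CD (\<lambda>x. sop p k s r (\<kappa> x) \<rho>)"
    by (rule instr_bind[where N = "p + m + r" and M = "p + s + r" and \<Psi> = "\<lambda>_ d. sop p m s r (\<kappa>2 d)"])
       (use 1 2 inj \<rho> g in \<open>auto simp: instrument_finite instrument_psd instrument_qtrace density_operator_iff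
          sop_divide sop_sop \<kappa> implements_def\<close>)
  finally show "?f p \<rho> = instr ?CD (\<lambda>x. sop p k s r (\<kappa> x) \<rho>)" .
qed

text \<open>The \<open>m\<close> qubits that await the second procedure are spectators behind the
  first one, and the \<open>s\<close> qubits left by the first are spectators before the second.
  Apart from this regrouping of sizes the argument is that of sequential composition.\<close>

lemma implements_kten:
  assumes f: "implements f C k s \<kappa>1" and g: "implements g D m t \<kappa>2"
    and inj: "inj_on (\<lambda>(c, d). h c d) (C \<times> D)"
    and \<kappa>: "\<And>c d. c \<in> C \<Longrightarrow> d \<in> D \<Longrightarrow> \<kappa> (h c d) = kten k s (\<kappa>1 c) (\<kappa>2 d)"
  shows "implements (\<lambda>p \<rho>. bind_pmf (f p \<rho>) (\<lambda>(c, \<rho>'). bind_pmf (g (p + s) \<rho>') (\<lambda>(d, \<rho>''). return_pmf (h c d, \<rho>''))))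
     ((\<lambda>(c, d). h c d) ` (C \<times> D)) (k + m) (s + t) \<kappa>" (is "implements ?f ?CD _ _ _")
  unfolding implements_def
proof (intro conjI allI impI)
  have 1: "instrument C k s \<kappa>1" and 2: "instrument D m t \<kappa>2"
    using f g by (simp_all add: implements_def)
  show "instrument ?CD (k + m) (s + t) \<kappa>"
    by (rule instrument_kten[OF 1 2 inj \<kappa>])
  fix p r \<rho> assume \<rho>: "density_operator (p + (k + m) + r) \<rho>"
  then have \<rho>': "density_operator (p + k + (m + r)) \<rho>" by (simp add: add_ac)
  then have "f p \<rho> = instr C (\<lambda>c. sop p k s (m + r) (\<kappa>1 c) \<rho>)"
    using f by (simp add: implements_def)
  also have "bind_pmf \<dots> (\<lambda>(c, \<rho>'). bind_pmf (g (p + s) \<rho>') (\<lambda>(d, \<rho>''). return_pmf (h c d, \<rho>''))) =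
    instr ?CD (\<lambda>x. sop p (k + m) (s + t) r (\<kappa> x) \<rho>)"
  proof (rule instr_bind[where N = "p + s + (m + r)" and M = "p + s + t + r" and \<Psi> = "\<lambda>_ d. sop (p + s) m t r (\<kappa>2 d)"])
    show "psd (p + s + t + r) (sop (p + s) m t r (\<kappa>2 d) X)" if "d \<in> D" "psd (p + s + (m + r)) X" for d X
      using instrument_psd[OF 2 that(1), of "p + s" r X] that(2) by (simp add: add.assoc)
    show "(\<Sum>d\<in>D. qtrace (sop (p + s) m t r (\<kappa>2 d) X)) = qtrace X" if "psd (p + s + (m + r)) X" for X
      using instrument_qtrace[OF 2, of "p + s" r X] that by (simp add: add.assoc)
    show "g (p + s) \<rho> = instr D (\<lambda>d. sop (p + s) m t r (\<kappa>2 d) \<rho>)" if "density_operator (p + s + (m + r)) \<rho>" for \<rho>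
      using g that by (simp add: implements_def add.assoc)
  qed (use 1 2 inj \<rho>' in \<open>auto simp: instrument_finite instrument_psd instrument_qtrace density_operator_iff
          sop_divide sop_kten \<kappa>\<close>)
  finally show "?f p \<rho> = instr ?CD (\<lambda>x. sop p (k + m) (s + t) r (\<kappa> x) \<rho>)" .
qed

primrec tens :: "nat \<Rightarrow> nat \<Rightarrow> kernel list \<Rightarrow> kernel" where
  "tens k s [] = (\<lambda>_ _ _ _. 1)"
| "tens k s (\<kappa> # \<kappa>s) = kten k s \<kappa> (tens k s \<kappa>s)"

lemma listset_Cons: "listset (A # As) = (\<lambda>(x, xs). x # xs) ` (A \<times> listset As)"
  by (auto simp: set_Cons_def)

lemma inj_on_Cons: "inj_on (\<lambda>(x, xs). x # xs) A"
  by (auto simp: inj_on_def)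

lemma outcome_singleton:
  assumes "density_operator N (\<Phi> c)"
  shows "outcome {c} \<Phi> = return_pmf c"
proof (rule pmf_eqI)
  fix i
  have "pmf (outcome {c} \<Phi>) i = (if i \<in> {c} then Re (qtrace (\<Phi> i)) else 0)"
    by (rule pmf_outcome[of _ N]) (use assms in \<open>auto simp: density_operator_iff\<close>)
  then show "pmf (outcome {c} \<Phi>) i = pmf (return_pmf c) i"
    using assms by (auto simp: density_operator_iff indicator_def)
qed

lemma instr_singleton: "density_operator N (\<Phi> c) \<Longrightarrow> instr {c} \<Phi> = return_pmf (c, \<Phi> c)"
  using outcome_singleton[of N \<Phi> c] by (simp add: instr_def normal_id density_operator_iff)

text \<open>Each step meets a fresh block of \<open>k\<close> qubits right behind the
  \<open>s\<close> qubits left by its predecessor, so the loop is a tensor product of instruments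
  and not a composition on one block.\<close>

lemma implements_in_sequence:
  assumes "\<And>a. a \<in> set as \<Longrightarrow> implements (f a) (C a) k s (\<kappa> a)"
  shows "implements (in_sequence f s as) (listset (map C as)) (k * length as) (s * length as)
     (\<lambda>cs. tens k s (map2 \<kappa> as cs))"
  using assms
proof (induction as)
  case Nil
  have "instrument {[]} 0 0 (\<lambda>cs. tens k s [])"
    by (rule instrumentI) (simp_all add: cp_one)
  moreover have "in_sequence f s [] p \<rho> = instr {[]} (\<lambda>c. sop p 0 0 r (tens k s []) \<rho>)"
    if "density_operator (p + 0 + r) \<rho>" for p r \<rho>
  proof -
    have "sop p 0 0 r (tens k s []) \<rho> = \<rho>" using that by (simp add: sop_one density_operator_iff psd_def)
    then show ?thesis using that by (simp add: instr_singleton[of "p + r"])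
  qed
  ultimately show ?case by (simp add: implements_def)
next
  case (Cons a as)
  have "implements (\<lambda>p \<rho>. bind_pmf (f a p \<rho>) (\<lambda>(c, \<rho>'). bind_pmf (in_sequence f s as (p + s) \<rho>') (\<lambda>(d, \<rho>''). return_pmf (c # d, \<rho>''))))
     ((\<lambda>(c, d). c # d) ` (C a \<times> listset (map C as))) (k + k * length as) (s + s * length as)
     (\<lambda>cs. tens k s (map2 \<kappa> (a # as) cs))"
    by (rule implements_kten[OF Cons.prems Cons.IH]) (use Cons.prems inj_on_Cons in auto)
  moreover have "in_sequence f s (a # as) = (\<lambda>p \<rho>. bind_pmf (f a p \<rho>) (\<lambda>(c, \<rho>'). bind_pmf (in_sequence f s as (p + s) \<rho>') (\<lambda>(d, \<rho>''). return_pmf (c # d, \<rho>''))))"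
    by (intro ext) simp
  ultimately show ?case by (simp only: list.map listset_Cons list.size mult_Suc_right add_Suc_right add_0_right)
qed

section \<open>Hadamard transform and measurements\<close>

lemma ip_append: "length u = length z \<Longrightarrow> ip (u @ u') (z @ z') \<longleftrightarrow> ip u z \<noteq> ip u' z'"
  by (auto simp: ip_def)

lemma ip_Cons: "ip (a # u) (b # z) \<longleftrightarrow> (a \<and> b) \<noteq> ip u z"
  by (auto simp: ip_def)

lemma ip_commute: "ip u z = ip z u"
proof -
  have "(\<Sum>(a, b)\<leftarrow>zip u z. of_bool (a \<and> b) :: nat) = (\<Sum>(a, b)\<leftarrow>zip z u. of_bool (a \<and> b))"
  proof (induction u arbitrary: z)
    case (Cons a u) then show ?case by (cases z) (auto simp: conj_commute)
  qed simp
  then show ?thesis by (simp add: ip_def)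
qed

lemma hadamard_append:
  "length u = length z \<Longrightarrow> hadamard (u @ u') (z @ z') = hadamard u z * hadamard u' z'"
  by (auto simp: hadamard_def ip_append power_add)

lemma hadamard_commute: "hadamard u z = hadamard z u"
  by (auto simp: hadamard_def ip_commute)

lemma cnj_hadamard [simp]: "cnj (hadamard u z) = hadamard u z"
  by (simp add: hadamard_def)

lemma hadamard_1: "hadamard [a] [b] = (if a \<and> b then -1 else 1) / complex_of_real (sqrt 2)"
  by (simp add: hadamard_def ip_def)

lemma of_real_sqrt2_squared: "complex_of_real (sqrt 2) * complex_of_real (sqrt 2) = 2"
  by (simp flip: of_real_mult)

lemma hadamard_orthonormal:
  assumes "length u = k" "length v = k"
  shows "(\<Sum>z\<in>bitstrings k. hadamard u z * hadamard v z) = of_bool (u = v)"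
  using assms
proof (induction k arbitrary: u v)
  case 0
  then show ?case by (simp add: hadamard_def ip_def)
next
  case (Suc k)
  then obtain a u' b v' where uv: "u = a # u'" "v = b # v'" "length u' = k" "length v' = k"
    by (metis length_Suc_conv)
  have h: "hadamard (x # y) (x' # y') = hadamard [x] [x'] * hadamard y y'" for x y x' y'
    using hadamard_append[of "[x]" "[x']" y y'] by simp
  have "(\<Sum>z\<in>bitstrings (Suc k). hadamard u z * hadamard v z) =
      (\<Sum>c\<in>UNIV. hadamard [a] [c] * hadamard [b] [c] * (\<Sum>z\<in>bitstrings k. hadamard u' z * hadamard v' z))"
    unfolding sum_bitstrings_Suc uv(1,2) h[of a u'] h[of b v'] sum_distrib_left by (simp add: mult_ac)
  also have "\<dots> = of_bool (u = v)"
    using Suc.IH[of u' v'] uv of_real_sqrt2_squared by (auto simp: UNIV_bool hadamard_1)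
  finally show ?case .
qed

text \<open>The overlap of u with the outcome z; \<open>c = True\<close> stands for the Hadamard
  basis, as for basis bits.\<close>

definition basis_amp :: "bool \<Rightarrow> bits \<Rightarrow> bits \<Rightarrow> complex" where
  "basis_amp c u z = (if c then hadamard u z else of_bool (u = z))"

lemma basis_amp_append:
  "length u = length z \<Longrightarrow> basis_amp c (u @ u') (z @ z') = basis_amp c u z * basis_amp c u' z'"
  by (auto simp: basis_amp_def hadamard_append)

lemma cnj_basis_amp [simp]: "cnj (basis_amp c u z) = basis_amp c u z"
  by (simp add: basis_amp_def)

lemma basis_amp_orthonormal:
  assumes "length u = k" "length v = k"
  shows "(\<Sum>z\<in>bitstrings k. basis_amp c u z * basis_amp c v z) = of_bool (u = v)"
proof (cases c)
  case False
  have "(\<Sum>z\<in>bitstrings k. basis_amp c u z * basis_amp c v z) = (\<Sum>z\<in>bitstrings k. if z = u then of_bool (u = v) else 0)"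
    using False by (intro sum.cong) (auto simp: basis_amp_def)
  then show ?thesis using assms by (simp add: mem_bitstrings)
qed (simp add: basis_amp_def hadamard_orthonormal assms)

text \<open>Orthonormality makes the Hadamard transform its own inverse, so it exchanges the two
  bases. This is what the Hadamard layer between the outer and the inner commitments does.\<close>

lemma basis_amp_after_hadamard:
  assumes "length u = k" "length z = k"
  shows "(\<Sum>U\<in>bitstrings k. basis_amp (\<not> c) U z * hadamard u U) = basis_amp c u z"
proof (cases c)
  case True
  have "(\<Sum>U\<in>bitstrings k. basis_amp (\<not> c) U z * hadamard u U) = (\<Sum>U\<in>bitstrings k. if U = z then hadamard u z else 0)"
    using True by (intro sum.cong) (auto simp: basis_amp_def)
  then show ?thesis using assms True by (simp add: mem_bitstrings basis_amp_def)
next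
  case False
  then show ?thesis
    using hadamard_orthonormal[OF assms(2,1)] by (auto simp: basis_amp_def hadamard_commute[of _ z])
qed

text \<open>The Kraus operator is the functional that takes the overlap with the basis vector z; it
  leaves no qubits, so the output index is ignored.\<close>

definition meas_kernel :: "bool \<Rightarrow> bits \<Rightarrow> kernel" where
  "meas_kernel c z = kraus (\<lambda>u _. basis_amp c u z)"

lemma meas_kernel_eq: "meas_kernel c z u v U V = basis_amp c u z * basis_amp c v z"
  by (simp add: meas_kernel_def kraus_def)

lemma kcomp_kraus: "kcomp m (kraus K2) (kraus K1) = kraus (\<lambda>u U. \<Sum>a\<in>bitstrings m. K2 a U * K1 u a)"
  by (intro ext) (simp add: kcomp_def kraus_def sum_product mult_ac)

lemma sop_meas_hadamard:
  assumes "length z = k"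
  shows "sop p k 0 r (kcomp k (meas_kernel (\<not> c) z) (kraus hadamard)) \<rho> = sop p k 0 r (meas_kernel c z) \<rho>"
  unfolding meas_kernel_def kcomp_kraus
  by (rule sop_cong) (simp add: kraus_def basis_amp_after_hadamard assms)

text \<open>\<open>apply_block\<close> has no guard on lengths, so \<open>V\<close> must supply it:
  a nonzero entry forces \<open>take k' (drop p i)\<close> to have full length, and with
  \<open>k' > 0\<close> this means that i reaches beyond the block.\<close>

lemma apply_block_eq_sop:
  assumes \<rho>: "supported (p + k + r) \<rho>" and "k' > 0"
    and V: "\<And>u U. V u U \<noteq> 0 \<Longrightarrow> length U = k'"
  shows "apply_block p k k' V \<rho> = sop p k k' r (kraus V) \<rho>"
proof (rule eq_sopI)
  have "length i = p + k' + r \<and> length j = p + k' + r" if nz: "apply_block p k k' V \<rho> i j \<noteq> 0" for i j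
  proof -
    from nz obtain u v where "u \<in> bitstrings k" "v \<in> bitstrings k" "V u (take k' (drop p i)) \<noteq> 0"
      "V v (take k' (drop p j)) \<noteq> 0"
      and nz\<rho>: "\<rho> (take p i @ u @ drop (p + k') i) (take p j @ v @ drop (p + k') j) \<noteq> 0"
      unfolding apply_block_def
      by (elim sum.not_neutral_contains_not_neutral) simp
    then show ?thesis
      using V[of u "take k' (drop p i)"] V[of v "take k' (drop p j)"] \<rho> \<open>k' > 0\<close>
      by (fastforce simp: supported_def mem_bitstrings min_def split: if_splits)
  qed
  then show "supported (p + k' + r) (apply_block p k k' V \<rho>)"
    by (auto simp: supported_def mem_bitstrings)
qed (simp add: apply_block_def kraus_def)

lemma hadamard_block_eq_sop:
  assumes "supported (p + k + r) \<rho>" "k > 0"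
  shows "hadamard_block p k \<rho> = sop p k k r (kraus hadamard) \<rho>"
proof -
  \<comment> \<open>\<open>hadamard\<close> has nonzero entries for equal lengths of any size;
    cutting it down to length k meets the support condition on the map.\<close>
  have "apply_block p k k hadamard \<rho> = apply_block p k k (\<lambda>u U. if length u = k then hadamard u U else 0) \<rho>"
    by (simp add: apply_block_def mem_bitstrings cong: sum.cong_simp)
  also have "\<dots> = sop p k k r (kraus (\<lambda>u U. if length u = k then hadamard u U else 0)) \<rho>"
    by (rule apply_block_eq_sop[OF assms]) (auto simp: hadamard_def split: if_splits)
  also have "\<dots> = sop p k k r (kraus hadamard) \<rho>"
    by (rule sop_cong) (simp add: kraus_def)
  finally show ?thesis .
qed

lemma project_block_eq_sop:
  assumes "supported (p + length m + r) \<rho>"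
  shows "project_block p m \<rho> = sop p (length m) 0 r (meas_kernel False m) \<rho>"
proof (rule eq_sopI)
  let ?B = bitstrings
  show "supported (p + 0 + r) (project_block p m \<rho>)"
    using assms by (fastforce simp: supported_def project_block_def mem_bitstrings)
  fix a a' U V c c' :: bits
  assume l: "length a = p" "length a' = p" "length U = 0" "length V = 0" "length c = r" "length c' = r"
  have "(\<Sum>u\<in>?B (length m). \<Sum>v\<in>?B (length m). meas_kernel False m u v U V * \<rho> (a @ u @ c) (a' @ v @ c'))
    = (\<Sum>u\<in>?B (length m). if u = m then \<rho> (a @ m @ c) (a' @ m @ c') else 0)"
    by (intro sum.cong refl) (auto simp: meas_kernel_eq basis_amp_def of_bool_def mem_bitstrings if_distrib[of "\<lambda>x. x * _"] cong: if_cong)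
  then show "project_block p m \<rho> (a @ U @ c) (a' @ V @ c') =
    (\<Sum>u\<in>?B (length m). \<Sum>v\<in>?B (length m). meas_kernel False m u v U V * \<rho> (a @ u @ c) (a' @ v @ c'))"
    using l by (simp add: project_block_def mem_bitstrings)
qed

lemma measure_block_eq_instr: "measure_block p k \<rho> = instr (bitstrings k) (\<lambda>m. project_block p m \<rho>)"
  by (simp add: measure_block_def instr_def outcome_def map_pmf_def normal_def)

lemma instrument_meas: "instrument (bitstrings k) k 0 (meas_kernel c)"
  by (rule instrumentI) (simp_all add: meas_kernel_def cp_kraus, simp add: kraus_def basis_amp_orthonormal)

text \<open>The families agree only on C. Positivity and total trace 1 guarantee that the sampled
  outcome lies there, so that the attached states agree too.\<close>

lemma instr_cong: "(\<And>c. c \<in> C \<Longrightarrow> \<Phi> c = \<Psi> c) \<Longrightarrow> finite C \<Longrightarrow> (\<And>c. c \<in> C \<Longrightarrow> psd N (\<Phi> c)) \<Longrightarrow>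
   (\<Sum>c\<in>C. qtrace (\<Phi> c)) = 1 \<Longrightarrow> instr C \<Phi> = instr C \<Psi>"
  unfolding instr_def
proof (rule map_pmf_cong)
  assume eq: "\<And>c. c \<in> C \<Longrightarrow> \<Phi> c = \<Psi> c"
  then have "(\<lambda>c. if c \<in> C then Re (qtrace (\<Phi> c)) else 0) = (\<lambda>c. if c \<in> C then Re (qtrace (\<Psi> c)) else 0)"
    by auto
  then show *: "outcome C \<Phi> = outcome C \<Psi>" by (simp add: outcome_def)
  fix c assume "c \<in> set_pmf (outcome C \<Psi>)"
    and "finite C" "\<And>c. c \<in> C \<Longrightarrow> psd N (\<Phi> c)" "(\<Sum>c\<in>C. qtrace (\<Phi> c)) = 1"
  then have "c \<in> C"
    using pmf_outcome[of C N \<Phi> c] * by (auto simp: set_pmf_iff split: if_splits)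
  then show "(c, normal (\<Phi> c)) = (c, normal (\<Psi> c))" by (simp add: eq)
qed

lemma implements_measure:
  assumes "k > 0"
  shows "implements (\<lambda>p \<rho>. measure_block p k (if c then hadamard_block p k \<rho> else \<rho>)) (bitstrings k) k 0 (meas_kernel c)"
  unfolding implements_def
proof (intro conjI allI impI instrument_meas)
  let ?B = bitstrings
  fix p r \<rho> assume \<rho>: "density_operator (p + k + r) \<rho>"
  have supp: "supported (p + k + r) \<rho>" using \<rho> by (simp add: density_operator_iff psd_def)
  have eq: "sop p k 0 r (meas_kernel c m) \<rho> = project_block p m (if c then hadamard_block p k \<rho> else \<rho>)"
    if "m \<in> ?B k" for m
  proof (cases c)
    case True
    have "sop p k 0 r (meas_kernel c m) \<rho> = sop p k 0 r (meas_kernel False m) (hadamard_block p k \<rho>)"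
      using that True sop_meas_hadamard[of m k p r True \<rho>] supp \<open>k > 0\<close>
      by (simp add: hadamard_block_eq_sop[of p k r] sop_sop mem_bitstrings)
    then show ?thesis
      using that True supp \<open>k > 0\<close> supported_sop
      by (simp add: project_block_eq_sop[of p m r] mem_bitstrings hadamard_block_eq_sop[of p k r])
  qed (use that supp in \<open>simp add: project_block_eq_sop[of p m r] mem_bitstrings\<close>)
  show "measure_block p k (if c then hadamard_block p k \<rho> else \<rho>) = instr (?B k) (\<lambda>m. sop p k 0 r (meas_kernel c m) \<rho>)"
    unfolding measure_block_eq_instr
  proof (rule instr_cong[symmetric, of _ _ _ "p + 0 + r"])
    show "psd (p + 0 + r) (sop p k 0 r (meas_kernel c m) \<rho>)" if "m \<in> ?B k" for m
      using \<rho> that by (intro instrument_psd[OF instrument_meas]) (auto simp: density_operator_iff)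
    show "(\<Sum>m\<in>?B k. qtrace (sop p k 0 r (meas_kernel c m) \<rho>)) = 1"
      using \<rho> instrument_qtrace[OF instrument_meas] by (auto simp: density_operator_iff)
  qed (simp_all add: eq)
qed

text \<open>A unitary is an instrument with a single outcome.\<close>

lemma instrument_hadamard: "instrument {()} k k (\<lambda>_. kraus hadamard)"
  by (rule instrumentI) (simp_all add: cp_kraus, simp add: kraus_def hadamard_orthonormal)

lemma implements_after_hadamard:
  assumes g: "implements g D m s \<kappa>" and "m > 0"
  shows "implements (\<lambda>p \<rho>. g p (hadamard_block p m \<rho>)) D m s (\<lambda>d. kcomp m (\<kappa> d) (kraus hadamard))"
  unfolding implements_def
proof (intro conjI allI impI)
  have "instrument ((\<lambda>(c, d). d) ` ({()} \<times> D)) m s (\<lambda>d. kcomp m (\<kappa> d) (kraus hadamard))"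
    by (rule instrument_kcomp[OF instrument_hadamard, of D m s \<kappa>]) (use g in \<open>auto simp: implements_def inj_on_def\<close>)
  also have "(\<lambda>(c, d). d) ` ({()} \<times> D) = D" by force
  finally show "instrument D m s (\<lambda>d. kcomp m (\<kappa> d) (kraus hadamard))" .
  fix p r \<rho> assume \<rho>: "density_operator (p + m + r) \<rho>"
  then have "density_operator (p + m + r) (sop p m m r (kraus hadamard) \<rho>)"
    using instrument_psd[OF instrument_hadamard] instrument_qtrace[OF instrument_hadamard]
    by (auto simp: density_operator_iff)
  then have "g p (sop p m m r (kraus hadamard) \<rho>) = instr D (\<lambda>c. sop p m s r (\<kappa> c) (sop p m m r (kraus hadamard) \<rho>))"
    using g by (simp add: implements_def)
  then show "g p (hadamard_block p m \<rho>) = instr D (\<lambda>c. sop p m s r (kcomp m (\<kappa> c) (kraus hadamard)) \<rho>)"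
    using \<rho> \<open>m > 0\<close> by (simp add: hadamard_block_eq_sop[of p m r] density_operator_iff psd_def sop_sop)
qed

section \<open>Circuits and the weak commitment\<close>

lemma apply_gate_support:
  assumes "\<And>z. \<psi> z \<noteq> 0 \<Longrightarrow> length z = N" "apply_gate g \<psi> z \<noteq> 0"
  shows "length z = N"
proof (cases g)
  case (H i)
  then have "\<psi> (z[i := False]) \<noteq> 0 \<or> \<psi> (z[i := True]) \<noteq> 0" using assms(2) by auto
  then show ?thesis using assms(1) by fastforce
next
  case (T i)
  then show ?thesis using assms by (auto split: if_splits)
next
  case (CNOT i j)
  then show ?thesis using assms(1)[of "z[j := (z ! j \<noteq> z ! i)]"] assms(2) by auto
qed

lemma fold_apply_gate_support:
  "(\<And>z. \<psi> z \<noteq> 0 \<Longrightarrow> length z = N) \<Longrightarrow> fold apply_gate C \<psi> z \<noteq> 0 \<Longrightarrow> length z = N"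
proof (induction C arbitrary: \<psi>)
  case (Cons g C)
  show ?case
  proof (rule Cons.IH)
    show "apply_gate g \<psi> z \<noteq> 0 \<Longrightarrow> length z = N" for z
      using Cons.prems(1) by (rule apply_gate_support)
    show "fold apply_gate C (apply_gate g \<psi>) z \<noteq> 0" using Cons.prems(2) by simp
  qed
qed simp

lemma run_circuit_support: "run_circuit N C z \<noteq> 0 \<Longrightarrow> length z = N"
  unfolding run_circuit_def by (erule fold_apply_gate_support[rotated]) (auto split: if_splits)

lemma bij_betw_flip:
  "i < N \<Longrightarrow> bij_betw (\<lambda>z. z[i := \<not> z ! i]) (bitstrings N) (bitstrings N)"
  by (rule bij_betwI[where g = "\<lambda>z. z[i := \<not> z ! i]"]) (auto simp: mem_bitstrings)

text \<open>For \<open>H\<close> every string is added to the one with bit i flipped: on such a pair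
  the gate preserves the norm by the parallelogram law \<open>par\<close>, and both sides count each
  string twice. \<open>T\<close> only changes phases, and \<open>CNOT\<close> permutes the strings
  by an involution.\<close>

lemma norm_apply_gate:
  assumes "wf_gate N g"
  shows "(\<Sum>z\<in>bitstrings N. (cmod (apply_gate g \<psi> z))\<^sup>2) = (\<Sum>z\<in>bitstrings N. (cmod (\<psi> z))\<^sup>2)"
proof (cases g)
  case (H i)
  then have i: "i < N" using assms by simp
  let ?f = "\<lambda>z::bits. z[i := \<not> z ! i]"
  have flip: "(\<Sum>z\<in>bitstrings N. h (?f z)) = (\<Sum>z\<in>bitstrings N. h z)" for h :: "bits \<Rightarrow> real"
    using sum.reindex_bij_betw[OF bij_betw_flip[OF i]] by simp
  have par: "(cmod ((a + b) / complex_of_real (sqrt 2)))\<^sup>2 + (cmod ((a - b) / complex_of_real (sqrt 2)))\<^sup>2 = (cmod a)\<^sup>2 + (cmod b)\<^sup>2" for a b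
    by (simp add: norm_divide power_divide cmod_power2) (simp add: power2_eq_square field_simps)
  have "(cmod (apply_gate g \<psi> z))\<^sup>2 + (cmod (apply_gate g \<psi> (?f z)))\<^sup>2 = (cmod (\<psi> z))\<^sup>2 + (cmod (\<psi> (?f z)))\<^sup>2"
    if "z \<in> bitstrings N" for z
  proof (cases "z ! i")
    case True
    then have "z[i := True] = z" by (metis list_update_id)
    then show ?thesis using par[of "\<psi> (z[i := False])" "\<psi> z"] H True i that by (simp add: mem_bitstrings)
  next
    case False
    then have "z[i := False] = z" by (metis list_update_id)
    then show ?thesis using par[of "\<psi> z" "\<psi> (z[i := True])"] H False i that by (simp add: mem_bitstrings)
  qed
  then have "(\<Sum>z\<in>bitstrings N. (cmod (apply_gate g \<psi> z))\<^sup>2 + (cmod (apply_gate g \<psi> (?f z)))\<^sup>2) =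
     (\<Sum>z\<in>bitstrings N. (cmod (\<psi> z))\<^sup>2 + (cmod (\<psi> (?f z)))\<^sup>2)"
    by (rule sum.cong[OF refl])
  then show ?thesis
    using flip[of "\<lambda>z. (cmod (apply_gate g \<psi> z))\<^sup>2"] flip[of "\<lambda>z. (cmod (\<psi> z))\<^sup>2"] by (simp add: sum.distrib)
next
  case (T i)
  then show ?thesis by (intro sum.cong refl) (simp add: norm_mult)
next
  case (CNOT i j)
  then have ij: "i < N" "j < N" "i \<noteq> j" using assms by auto
  have "bij_betw (\<lambda>z. z[j := (z ! j \<noteq> z ! i)]) (bitstrings N) (bitstrings N)"
    by (rule bij_betwI[where g = "\<lambda>z. z[j := (z ! j \<noteq> z ! i)]"])
       (use ij in \<open>auto simp: mem_bitstrings list_eq_iff_nth_eq nth_list_update\<close>)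
  from sum.reindex_bij_betw[OF this, of "\<lambda>z. (cmod (\<psi> z))\<^sup>2"] show ?thesis
    using CNOT by simp
qed

lemma norm_run_circuit:
  assumes "\<forall>g\<in>set C. wf_gate N g"
  shows "(\<Sum>z\<in>bitstrings N. (cmod (run_circuit N C z))\<^sup>2) = 1"
proof -
  have "(\<Sum>z\<in>bitstrings N. (cmod (fold apply_gate C \<psi> z))\<^sup>2) = (\<Sum>z\<in>bitstrings N. (cmod (\<psi> z))\<^sup>2)" for \<psi>
    using assms by (induction C arbitrary: \<psi>) (auto simp: norm_apply_gate)
  moreover have "(\<Sum>z\<in>bitstrings N. (cmod (if z = replicate N False then 1 else 0))\<^sup>2) = (1::real)"
    by (simp add: if_distrib[of cmod] if_distrib[of "\<lambda>x. x\<^sup>2"] mem_bitstrings cong: if_cong)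
  ultimately show ?thesis by (simp add: run_circuit_def)
qed

text \<open>\<open>controlled_prep\<close> with the prepared state as a parameter, so that the
  output of the circuit and the ideal superposition can be inserted into the same protocol.\<close>

definition prep_vec :: "(bool \<Rightarrow> bits \<Rightarrow> complex) \<Rightarrow> bits \<Rightarrow> bits \<Rightarrow> complex" where
  "prep_vec \<psi> u i = (if i \<noteq> [] \<and> [hd i] = u then \<psi> (hd i) (tl i) else 0)"

text \<open>The string y has been observed and the work qubits traced out, which gives one Kraus
  operator for each content g of the work qubits.\<close>

definition prep_kernel :: "nat \<Rightarrow> (bool \<Rightarrow> bits \<Rightarrow> complex) \<Rightarrow> bits \<Rightarrow> kernel" where
  "prep_kernel G \<psi> y = (\<lambda>u v U V. \<Sum>g\<in>bitstrings G. kraus (\<lambda>u U. prep_vec \<psi> u (U @ y @ g)) u v U V)"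

text \<open>The committed bit is kept as the first output qubit, so the diagonal output entries
  vanish for different inputs; for equal inputs the total weight is the squared norm of the prepared
  state.\<close>

lemma instrument_prep:
  assumes "\<And>b. (\<Sum>z\<in>bitstrings (w + R + G). (cmod (\<psi> b z))\<^sup>2) = 1"
  shows "instrument (bitstrings R) 1 (Suc w) (prep_kernel G \<psi>)"
proof (rule instrumentI)
  let ?B = bitstrings
  show "cp 1 (Suc w) (prep_kernel G \<psi> c)" for c
    unfolding prep_kernel_def by (intro cp_sum cp_kraus)
  fix u v :: bits assume "length u = 1" "length v = 1"
  then obtain a b where uv: "u = [a]" "v = [b]" by (auto simp: length_Suc_conv)
  have "(\<Sum>y\<in>?B R. \<Sum>U\<in>?B (Suc w). prep_kernel G \<psi> y u v U U) =
    (\<Sum>y\<in>?B R. \<Sum>x\<in>?B w. \<Sum>g\<in>?B G. of_bool (a = b) * complex_of_real ((cmod (\<psi> a (x @ y @ g)))\<^sup>2))"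
    unfolding sum_bitstrings_Suc
    by (intro sum.cong refl)
       (auto simp: UNIV_bool uv prep_kernel_def kraus_def prep_vec_def complex_norm_square simp flip: of_real_power intro!: sum.cong)
  also have "\<dots> = of_bool (a = b) * complex_of_real (\<Sum>z\<in>?B (w + R + G). (cmod (\<psi> a z))\<^sup>2)"
    by (simp add: sum_bitstrings_append sum_distrib_left sum.swap[of _ "?B R"])
  finally show "(\<Sum>y\<in>?B R. \<Sum>U\<in>?B (Suc w). prep_kernel G \<psi> y u v U U) = of_bool (u = v)"
    using assms by (simp add: uv)
qed simp

lemma discard_block_eq_sop:
  assumes "supported (p + k + r) \<rho>"
  shows "discard_block p k \<rho> = sop p k 0 r (\<lambda>u v _ _. of_bool (u = v)) \<rho>"
proof (rule eq_sopI)
  have "length i = p + r \<and> length j = p + r" if nz: "discard_block p k \<rho> i j \<noteq> 0" for i j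
  proof -
    from nz obtain m where "m \<in> bitstrings k" "\<rho> (take p i @ m @ drop p i) (take p j @ m @ drop p j) \<noteq> 0"
      unfolding discard_block_def project_block_def
      by (elim sum.not_neutral_contains_not_neutral) simp
    then show ?thesis using assms by (fastforce simp: supported_def mem_bitstrings)
  qed
  then show "supported (p + 0 + r) (discard_block p k \<rho>)"
    by (auto simp: supported_def mem_bitstrings)
  fix a a' U V c c' :: bits
  assume l: "length a = p" "length a' = p" "length U = 0" "length V = 0" "length c = r" "length c' = r"
  then show "discard_block p k \<rho> (a @ U @ c) (a' @ V @ c') =
    (\<Sum>u\<in>bitstrings k. \<Sum>v\<in>bitstrings k. of_bool (u = v) * \<rho> (a @ u @ c) (a' @ v @ c'))"
    by (auto simp: discard_block_def project_block_def of_bool_def if_distrib[of "\<lambda>x. x * _"] intro!: sum.cong cong: if_cong)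
qed

lemma qtrace_discard_block:
  assumes "supported (p + k + r) \<rho>"
  shows "qtrace (discard_block p k \<rho>) = qtrace \<rho>"
  using sum_qtrace_sop[OF assms, where C = "{()}" and s = 0 and \<kappa> = "\<lambda>_ u v _ _. of_bool (u = v)"]
  by (simp add: discard_block_eq_sop[OF assms])

text \<open>Once the register of y is removed, the work qubits move up to position
  \<open>p + 1 + w\<close>, which is why projection and discarding name the same position.\<close>

lemma sop_prep_kernel:
  fixes w R G :: nat
  assumes "supported (p + 1 + r) \<rho>" "length y = R"
  shows "discard_block (p + 1 + w) G (project_block (p + 1 + w) y (sop p 1 (1 + (w + R + G)) r (kraus (prep_vec \<psi>)) \<rho>)) =
    sop p 1 (Suc w) r (prep_kernel G \<psi> y) \<rho>" (is "?L = _")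
proof (rule eq_sopI)
  let ?B = bitstrings
  have supp: "supported (p + 1 + w + length y + (G + r)) (sop p 1 (1 + (w + R + G)) r (kraus (prep_vec \<psi>)) \<rho>)"
    using supported_sop[of p "1 + (w + R + G)" r] assms by (simp add: add_ac)
  show "supported (p + Suc w + r) ?L"
    unfolding project_block_eq_sop[OF supp]
    using supported_sop[of "p + 1 + w" 0 "G + r"] supported_sop[of "p + 1 + w" 0 r]
    by (subst discard_block_eq_sop[of _ _ r]) (simp_all add: add_ac)
  fix a a' U V c c' :: bits
  assume l: "length a = p" "length a' = p" "length U = Suc w" "length V = Suc w" "length c = r" "length c' = r"
  have "?L (a @ U @ c) (a' @ V @ c') =
    (\<Sum>g\<in>?B G. sop p 1 (1 + (w + R + G)) r (kraus (prep_vec \<psi>)) \<rho> (a @ (U @ y @ g) @ c) (a' @ (V @ y @ g) @ c'))"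
    using l by (simp add: discard_block_def project_block_def)
  also have "\<dots> = (\<Sum>g\<in>?B G. \<Sum>u\<in>?B 1. \<Sum>v\<in>?B 1.
      kraus (prep_vec \<psi>) u v (U @ y @ g) (V @ y @ g) * \<rho> (a @ u @ c) (a' @ v @ c'))"
    using l assms(2) by (intro sum.cong refl sop_append) (auto simp: mem_bitstrings)
  also have "\<dots> = (\<Sum>u\<in>?B 1. \<Sum>v\<in>?B 1. prep_kernel G \<psi> y u v U V * \<rho> (a @ u @ c) (a' @ v @ c'))"
    unfolding prep_kernel_def sum_distrib_right by (simp only: sum_rotate3[of _ "?B 1"] kraus_def)
  finally show "?L (a @ U @ c) (a' @ V @ c') = \<dots>" .
qed

definition real_prep :: "ntcf_algorithms \<Rightarrow> nat \<Rightarrow> bits \<Rightarrow> bool \<Rightarrow> bits \<Rightarrow> complex" where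
  "real_prep F n pk b = run_circuit (prep_qubits F n pk) (Prep F pk b)"

abbreviation weak_kernel :: "ntcf_algorithms \<Rightarrow> nat \<Rightarrow> bits \<Rightarrow> bits \<Rightarrow> kernel" where
  "weak_kernel F n pk \<equiv> prep_kernel (anc F pk) (real_prep F n pk)"

text \<open>The procedure normalises between measuring y and discarding the work qubits. Discarding
  is linear and preserves the trace (\<open>tr\<close>), so the normalisation can be moved to the
  end.\<close>

lemma implements_weak_commit:
  assumes "\<And>b g. g \<in> set (Prep F pk b) \<Longrightarrow> wf_gate (prep_qubits F n pk) g"
  shows "implements (weak_commit F n pk) (bitstrings (range_len F n)) 1 (Suc (width F n)) (weak_kernel F n pk)"
  unfolding implements_def
proof (intro conjI allI impI)
  let ?B = bitstrings
  let ?w = "width F n" let ?R = "range_len F n" let ?G = "anc F pk"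
  show inst: "instrument (?B ?R) 1 (Suc ?w) (weak_kernel F n pk)"
    by (rule instrument_prep) (use assms norm_run_circuit in \<open>simp add: real_prep_def prep_qubits_def\<close>)
  fix p r \<rho> assume \<rho>: "density_operator (p + 1 + r) \<rho>"
  then have supp: "supported (p + 1 + r) \<rho>" by (simp add: density_operator_iff psd_def)
  let ?X = "sop p 1 (1 + (?w + ?R + ?G)) r (kraus (prep_vec (real_prep F n pk))) \<rho>"
  let ?q = "p + 1 + ?w"
  have V: "controlled_prep F n pk = prep_vec (real_prep F n pk)"
    by (intro ext) (simp add: controlled_prep_def prep_vec_def real_prep_def)
  have len: "length U = 1 + (?w + ?R + ?G)" if "prep_vec (real_prep F n pk) u U \<noteq> 0" for u U
    using that by (cases U) (auto simp: prep_vec_def real_prep_def prep_qubits_def dest!: run_circuit_support split: if_splits)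
  have X: "apply_block p 1 (1 + prep_qubits F n pk) (controlled_prep F n pk) \<rho> = ?X"
    unfolding V prep_qubits_def
    by (rule apply_block_eq_sop[OF supp]) (simp_all add: len)
  have suppX: "supported (?q + length y + (?G + r)) ?X" if "length y = ?R" for y :: bits
    using that supported_sop[of p "1 + (?w + ?R + ?G)" r] by (simp add: add_ac)
  have eq: "discard_block ?q ?G (project_block ?q y ?X) = sop p 1 (Suc ?w) r (weak_kernel F n pk y) \<rho>"
    if "length y = ?R" for y by (rule sop_prep_kernel[OF supp that])
  have tr: "qtrace (project_block ?q y ?X) = qtrace (sop p 1 (Suc ?w) r (weak_kernel F n pk y) \<rho>)"
    if "length y = ?R" for y
    unfolding eq[OF that, symmetric] project_block_eq_sop[OF suppX[OF that]]
    using supported_sop[of ?q 0 "?G + r"] by (subst qtrace_discard_block[of _ _ r]) (simp_all add: add_ac)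
  let ?O = "outcome (?B ?R) (\<lambda>y. sop p 1 (Suc ?w) r (weak_kernel F n pk y) \<rho>)"
  have O: "outcome (?B ?R) (\<lambda>y. project_block ?q y ?X) = ?O"
    unfolding outcome_def using tr by (auto simp: mem_bitstrings intro!: arg_cong[of _ _ embed_pmf])
  have setO: "set_pmf ?O \<subseteq> ?B ?R"
  proof
    fix y assume "y \<in> set_pmf ?O"
    moreover have "pmf ?O y = (if y \<in> ?B ?R then Re (qtrace (sop p 1 (Suc ?w) r (weak_kernel F n pk y) \<rho>)) else 0)"
      by (rule pmf_outcome[of _ "p + Suc ?w + r"])
         (use \<rho> instrument_psd[OF inst] instrument_qtrace[OF inst] in \<open>auto simp: density_operator_iff\<close>)
    ultimately show "y \<in> ?B ?R" by (auto simp: set_pmf_iff split: if_splits)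
  qed
  have "weak_commit F n pk p \<rho> = map_pmf (\<lambda>y. (y, discard_block ?q ?G (normal (project_block ?q y ?X)))) ?O"
    unfolding weak_commit_def X measure_block_eq_instr instr_def O
    by (simp add: map_pmf_def bind_assoc_pmf bind_return_pmf)
  also have "\<dots> = map_pmf (\<lambda>y. (y, normal (sop p 1 (Suc ?w) r (weak_kernel F n pk y) \<rho>))) ?O"
  proof (rule map_pmf_cong[OF refl])
    fix y assume "y \<in> set_pmf ?O"
    then have y: "length y = ?R" using setO by (auto simp: mem_bitstrings)
    have "discard_block ?q ?G (normal (project_block ?q y ?X)) =
       (\<lambda>i j. discard_block ?q ?G (project_block ?q y ?X) i j / qtrace (project_block ?q y ?X))"
      by (simp add: discard_block_def project_block_def normal_def sum_divide_distrib)
    then show "(y, discard_block ?q ?G (normal (project_block ?q y ?X))) = (y, normal (sop p 1 (Suc ?w) r (weak_kernel F n pk y) \<rho>))"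
      by (simp only: eq[OF y] tr[OF y] normal_def)
  qed
  finally show "weak_commit F n pk p \<rho> = instr (?B ?R) (\<lambda>c. sop p 1 (Suc ?w) r (weak_kernel F n pk c) \<rho>)"
    by (simp add: instr_def)
qed

section \<open>Closeness of measurements\<close>

text \<open>Without output qubits the result is a 1 by 1 operator. Its entry is the trace of
  \<open>\<rho>\<close> against the effect, the unnormalised probability of the outcome.\<close>

definition val :: "nat \<Rightarrow> kernel \<Rightarrow> qop \<Rightarrow> complex" where
  "val N \<kappa> \<rho> = sop 0 N 0 0 \<kappa> \<rho> [] []"

lemma val_eq: "val N \<kappa> \<rho> = (\<Sum>u\<in>bitstrings N. \<Sum>v\<in>bitstrings N. \<kappa> u v [] [] * \<rho> u v)"
  by (simp add: val_def sop_def)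

lemma qtrace_sop_eq_val: "qtrace (sop 0 N 0 0 \<kappa> \<rho>) = val N \<kappa> \<rho>"
  using qtrace_eq_sum[OF supported_sop[of 0 0 0 N \<kappa> \<rho>]] by (simp add: val_def)

lemma val_sop: "val m \<kappa>2 (sop 0 k m 0 \<kappa>1 \<rho>) = val k (kcomp m \<kappa>2 \<kappa>1) \<rho>"
  by (simp add: val_def sop_sop)

lemma val_kten: "val m \<kappa>2 (sop 0 k 0 m \<kappa>1 \<rho>) = val (k + m) (kten k 0 \<kappa>1 \<kappa>2) \<rho>"
  using sop_kten[of 0 0 m 0 0 \<kappa>2 k \<kappa>1 \<rho>] by (simp add: val_def)

lemma val_kten': "val k \<kappa>1 (sop k m 0 0 \<kappa>2 \<rho>) = val (k + m) (kten k 0 \<kappa>1 \<kappa>2) \<rho>"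
  using sop_kten'[of 0 k 0 0 0 \<kappa>1 m \<kappa>2 \<rho>] by (simp add: val_def)

lemma val_sum: "val N (\<lambda>u v U V. \<Sum>c\<in>C. \<kappa> c u v U V) \<rho> = (\<Sum>c\<in>C. val N (\<kappa> c) \<rho>)"
  by (simp add: val_def sop_sum_kernel)

lemma val_cong:
  "(\<And>u v. \<lbrakk>length u = N; length v = N\<rbrakk> \<Longrightarrow> \<kappa> u v [] [] = \<kappa>' u v [] []) \<Longrightarrow> val N \<kappa> \<rho> = val N \<kappa>' \<rho>"
  unfolding val_def by (subst sop_cong[where \<kappa>' = \<kappa>']) auto

text \<open>The bound scales with the trace, so that it applies to the unnormalised operators left
  after contracting the other factors of a tensor product.\<close>

definition close :: "nat \<Rightarrow> ('o \<Rightarrow> kernel) \<Rightarrow> ('o \<Rightarrow> kernel) \<Rightarrow> real \<Rightarrow> bool" where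
  "close N E E' \<delta> \<longleftrightarrow> (\<forall>\<rho>. psd N \<rho> \<longrightarrow>
     (\<Sum>x\<in>UNIV. cmod (val N (E x) \<rho> - val N (E' x) \<rho>)) \<le> \<delta> * Re (qtrace \<rho>))"

lemma close_trans:
  assumes "close N E E' \<delta>" "close N E' E'' \<delta>'"
  shows "close N E E'' (\<delta> + \<delta>')"
  unfolding close_def
proof (intro allI impI)
  fix \<rho> assume \<rho>: "psd N \<rho>"
  have "(\<Sum>x\<in>UNIV. cmod (val N (E x) \<rho> - val N (E'' x) \<rho>)) \<le>
     (\<Sum>x\<in>UNIV. cmod (val N (E x) \<rho> - val N (E' x) \<rho>) + cmod (val N (E' x) \<rho> - val N (E'' x) \<rho>))"
    by (intro sum_mono) (metis norm_triangle_ineq diff_add_cancel add_diff_eq)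
  also have "\<dots> \<le> \<delta> * Re (qtrace \<rho>) + \<delta>' * Re (qtrace \<rho>)"
    using assms \<rho> by (simp add: sum.distrib close_def add_mono)
  finally show "(\<Sum>x\<in>UNIV. cmod (val N (E x) \<rho> - val N (E'' x) \<rho>)) \<le> (\<delta> + \<delta>') * Re (qtrace \<rho>)"
    by (simp add: algebra_simps)
qed

text \<open>The quadratic form at the vectors (1, t) with t = 1, -1 bounds the sum of the two
  off-diagonal entries by the trace, and with t = \<open>\<i>\<close>, \<open>-\<i>\<close> their
  difference. Half the sum and half the difference of these give the entries themselves.\<close>

lemma psd_1_entry_le:
  assumes "psd (Suc 0) \<rho>"
  shows "cmod (\<rho> [a] [b]) \<le> Re (qtrace \<rho>)"
proof -
  let ?a = "\<rho> [False] [False]" let ?b = "\<rho> [False] [True]" let ?c = "\<rho> [True] [False]" let ?d = "\<rho> [True] [True]"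
  have tr: "qtrace \<rho> = ?a + ?d"
    using assms by (simp add: psd_def qtrace_eq_sum[of "Suc 0"] sum_bitstrings_1)
  have diag: "?a \<in> \<real>\<^sub>\<ge>\<^sub>0" "?d \<in> \<real>\<^sub>\<ge>\<^sub>0"
    using psd_diag[OF assms] by (auto simp: bitstrings_1)
  have q: "?a + t * ?b + cnj t * ?c + cnj t * t * ?d \<in> \<real>\<^sub>\<ge>\<^sub>0" for t
  proof -
    have "(\<Sum>i\<in>bitstrings (Suc 0). \<Sum>j\<in>bitstrings (Suc 0). cnj (if i = [True] then t else 1) * \<rho> i j * (if j = [True] then t else 1)) \<in> \<real>\<^sub>\<ge>\<^sub>0"
      by (rule conjunct2[OF assms[unfolded psd_def], THEN spec])
    then show ?thesis by (simp add: sum_bitstrings_1 algebra_simps)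
  qed
  have *: "cmod z \<le> Re w" if "w + z \<in> \<real>\<^sub>\<ge>\<^sub>0" "w - z \<in> \<real>\<^sub>\<ge>\<^sub>0" for w z
  proof -
    from that have "Im z = 0" "Re w + Re z \<ge> 0" "Re w - Re z \<ge> 0"
      by (auto simp: complex_nonneg_Reals_iff)
    then show ?thesis by (simp add: cmod_eq_Re)
  qed
  have 1: "cmod (?b + ?c) \<le> Re (qtrace \<rho>)"
    using q[of 1] q[of "-1"] by (intro *) (simp_all add: tr algebra_simps)
  have 2: "cmod (\<i> * (?b - ?c)) \<le> Re (qtrace \<rho>)"
    using q[of \<i>] q[of "-\<i>"] by (intro *) (simp_all add: tr algebra_simps)
  have b: "cmod ?b \<le> Re (qtrace \<rho>)" and c: "cmod ?c \<le> Re (qtrace \<rho>)"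
    using norm_triangle_ineq[of "?b + ?c" "?b - ?c"] norm_triangle_ineq4[of "?b + ?c" "?b - ?c"] 1 2
      norm_mult[of 2 ?b] norm_mult[of 2 ?c]
    by (simp_all add: norm_mult)
  have d: "cmod ?a \<le> Re (qtrace \<rho>)" "cmod ?d \<le> Re (qtrace \<rho>)"
    using diag by (auto simp: tr nonneg_Reals_iff_of_real)
  show ?thesis using b c d by (cases a; cases b) auto
qed

text \<open>The factor 4 is the number of entries of a one-qubit operator, each at most its
  trace.\<close>

lemma close_1I:
  fixes E E' :: "'o::finite \<Rightarrow> kernel"
  assumes "\<And>a b. (\<Sum>x\<in>UNIV. cmod (E x [a] [b] [] [] - E' x [a] [b] [] [])) \<le> \<delta>"
  shows "close (Suc 0) E E' (4 * \<delta>)"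
  unfolding close_def
proof (intro allI impI)
  fix \<rho> assume \<rho>: "psd (Suc 0) \<rho>"
  let ?t = "Re (qtrace \<rho>)"
  let ?D = "\<lambda>x a b. cmod (E x [a] [b] [] [] - E' x [a] [b] [] [])"
  have B: "bitstrings (Suc 0) = (\<lambda>a. [a]) ` UNIV" by (auto simp: bitstrings_def length_Suc_conv)
  have val1: "val (Suc 0) \<kappa> \<rho> = (\<Sum>a\<in>UNIV. \<Sum>b\<in>UNIV. \<kappa> [a] [b] [] [] * \<rho> [a] [b])" for \<kappa>
    unfolding val_eq B by (simp add: sum.reindex inj_on_def)
  have "(\<Sum>x\<in>UNIV. cmod (val (Suc 0) (E x) \<rho> - val (Suc 0) (E' x) \<rho>)) \<le>
     (\<Sum>x\<in>UNIV. \<Sum>a\<in>UNIV. \<Sum>b\<in>UNIV. ?D x a b * ?t)"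
  proof (rule sum_mono)
    fix x
    have "cmod (val (Suc 0) (E x) \<rho> - val (Suc 0) (E' x) \<rho>) =
        cmod (\<Sum>a\<in>UNIV. \<Sum>b\<in>UNIV. (E x [a] [b] [] [] - E' x [a] [b] [] []) * \<rho> [a] [b])"
      by (simp add: val1 sum_subtractf left_diff_distrib)
    also have "\<dots> \<le> (\<Sum>a\<in>UNIV. \<Sum>b\<in>UNIV. ?D x a b * ?t)"
      by (intro sum_norm_le) (auto simp: norm_mult intro!: mult_left_mono psd_1_entry_le \<rho>)
    finally show "cmod (val (Suc 0) (E x) \<rho> - val (Suc 0) (E' x) \<rho>) \<le> (\<Sum>a\<in>UNIV. \<Sum>b\<in>UNIV. ?D x a b * ?t)" .
  qed
  also have "\<dots> = (\<Sum>a\<in>UNIV. \<Sum>b\<in>UNIV. (\<Sum>x\<in>UNIV. ?D x a b) * ?t)"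
    unfolding sum_distrib_right by (rule sum_rotate3)
  also have "\<dots> \<le> (\<Sum>a\<in>(UNIV::bool set). \<Sum>b\<in>(UNIV::bool set). \<delta> * ?t)"
    by (intro sum_mono mult_right_mono assms psd_qtrace_nonneg[OF \<rho>])
  also have "\<dots> = 4 * \<delta> * ?t" by (simp add: UNIV_bool)
  finally show "(\<Sum>x\<in>UNIV. cmod (val (Suc 0) (E x) \<rho> - val (Suc 0) (E' x) \<rho>)) \<le> 4 * \<delta> * ?t" .
qed

lemma instrument_tens:
  assumes "\<And>a. a \<in> set as \<Longrightarrow> instrument (C a) k s (\<kappa> a)"
  shows "instrument (listset (map C as)) (k * length as) (s * length as) (\<lambda>cs. tens k s (map2 \<kappa> as cs))"
  using assms
proof (induction as)
  case Nil
  show ?case by (rule instrumentI) (simp_all add: cp_one)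
next
  case (Cons a as)
  have "instrument ((\<lambda>(c, d). c # d) ` (C a \<times> listset (map C as))) (k + k * length as) (s + s * length as)
     (\<lambda>cs. tens k s (map2 \<kappa> (a # as) cs))"
    by (rule instrument_kten[of "C a" k s "\<kappa> a" "listset (map C as)" _ _ "\<lambda>cs. tens k s (map2 \<kappa> as cs)"])
       (use Cons inj_on_Cons in auto)
  then show ?case by (simp only: list.map listset_Cons list.size mult_Suc_right add_Suc_right add_0_right)
qed

text \<open>The errors add up instead of multiplying with the number of outcomes, because the
  contracted operators of one factor have total trace \<open>qtrace \<rho>\<close> when summed over
  its outcomes.\<close>

lemma close_tens:
  fixes E E' :: "'a \<Rightarrow> 'o::finite \<Rightarrow> kernel"
  assumes "\<And>a. a \<in> set as \<Longrightarrow> instrument UNIV 1 0 (E a)" "\<And>a. a \<in> set as \<Longrightarrow> instrument UNIV 1 0 (E' a)"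
    and "\<And>a. a \<in> set as \<Longrightarrow> close 1 (E a) (E' a) (\<delta> a)"
    and "psd (length as) \<rho>"
  shows "(\<Sum>xs\<in>listset (map (\<lambda>_. UNIV) as). cmod (val (length as) (tens 1 0 (map2 E as xs)) \<rho> -
      val (length as) (tens 1 0 (map2 E' as xs)) \<rho>)) \<le> (\<Sum>a\<leftarrow>as. \<delta> a) * Re (qtrace \<rho>)"
  using assms
proof (induction as arbitrary: \<rho>)
  case Nil
  then show ?case by simp
next
  case (Cons a as)
  let ?n = "length as" let ?L = "listset (map (\<lambda>_. UNIV :: 'o set) as)"
  let ?T = "\<lambda>xs. tens 1 0 (map2 E as xs)" let ?T' = "\<lambda>xs. tens 1 0 (map2 E' as xs)"
  \<comment> \<open>The intermediate measurement is E' on the first factor and E on all others.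
    Hence \<open>\<rho>2\<close> contracts the tail with E, to compare the heads, and
    \<open>\<rho>1\<close> contracts the head with E', to compare the tails.\<close>
  define \<rho>1 where "\<rho>1 x = sop 0 1 0 ?n (E' a x) \<rho>" for x
  define \<rho>2 where "\<rho>2 xs = sop 1 ?n 0 0 (?T xs) \<rho>" for xs
  have \<rho>: "psd (1 + ?n) \<rho>" using Cons.prems by simp
  have iE: "instrument UNIV 1 0 (E a)" and iE': "instrument UNIV 1 0 (E' a)" and cl: "close 1 (E a) (E' a) (\<delta> a)"
    using Cons.prems by auto
  have iT: "instrument ?L ?n 0 ?T"
    using instrument_tens[of as "\<lambda>_. UNIV" 1 0 E] Cons.prems by simp
  have psd1: "psd ?n (\<rho>1 x)" for x
    using instrument_psd[OF iE', of x 0 ?n \<rho>] \<rho> by (simp add: \<rho>1_def)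
  have psd2: "psd 1 (\<rho>2 xs)" if "xs \<in> ?L" for xs
    using instrument_psd[OF iT that, of 1 0 \<rho>] \<rho> by (simp add: \<rho>2_def)
  have tr1: "(\<Sum>x\<in>UNIV. Re (qtrace (\<rho>1 x))) = Re (qtrace \<rho>)"
    using instrument_qtrace[OF iE', of 0 ?n \<rho>] \<rho> by (simp add: \<rho>1_def flip: Re_sum)
  have tr2: "(\<Sum>xs\<in>?L. Re (qtrace (\<rho>2 xs))) = Re (qtrace \<rho>)"
    using instrument_qtrace[OF iT, of 1 0 \<rho>] \<rho> by (simp add: \<rho>2_def flip: Re_sum)
  have "(\<Sum>xs\<in>listset (map (\<lambda>_. UNIV) (a # as)). cmod (val (length (a # as)) (tens 1 0 (map2 E (a # as) xs)) \<rho> -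
      val (length (a # as)) (tens 1 0 (map2 E' (a # as) xs)) \<rho>)) =
    (\<Sum>x\<in>UNIV. \<Sum>xs\<in>?L. cmod (val (1 + ?n) (kten 1 0 (E a x) (?T xs)) \<rho> - val (1 + ?n) (kten 1 0 (E' a x) (?T' xs)) \<rho>))"
    unfolding list.map listset_Cons
    by (subst sum.reindex[OF inj_on_Cons]) (simp add: sum.cartesian_product split_def)
  also have "\<dots> \<le> (\<Sum>x\<in>UNIV. \<Sum>xs\<in>?L. cmod (val 1 (E a x) (\<rho>2 xs) - val 1 (E' a x) (\<rho>2 xs)) +
       cmod (val ?n (?T xs) (\<rho>1 x) - val ?n (?T' xs) (\<rho>1 x)))"
  proof (intro sum_mono)
    fix x xs
    have "val (1 + ?n) (kten 1 0 (E a x) (?T xs)) \<rho> - val (1 + ?n) (kten 1 0 (E' a x) (?T' xs)) \<rho> =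
      (val 1 (E a x) (\<rho>2 xs) - val 1 (E' a x) (\<rho>2 xs)) + (val ?n (?T xs) (\<rho>1 x) - val ?n (?T' xs) (\<rho>1 x))"
      unfolding \<rho>1_def \<rho>2_def val_kten val_kten' by simp
    then show "cmod (val (1 + ?n) (kten 1 0 (E a x) (?T xs)) \<rho> - val (1 + ?n) (kten 1 0 (E' a x) (?T' xs)) \<rho>) \<le>
       cmod (val 1 (E a x) (\<rho>2 xs) - val 1 (E' a x) (\<rho>2 xs)) + cmod (val ?n (?T xs) (\<rho>1 x) - val ?n (?T' xs) (\<rho>1 x))"
      using norm_triangle_ineq by metis
  qed
  also have "\<dots> = (\<Sum>xs\<in>?L. \<Sum>x\<in>UNIV. cmod (val 1 (E a x) (\<rho>2 xs) - val 1 (E' a x) (\<rho>2 xs))) +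
       (\<Sum>x\<in>UNIV. \<Sum>xs\<in>?L. cmod (val ?n (?T xs) (\<rho>1 x) - val ?n (?T' xs) (\<rho>1 x)))"
    by (simp add: sum.distrib sum.swap[of _ ?L])
  also have "\<dots> \<le> (\<Sum>xs\<in>?L. \<delta> a * Re (qtrace (\<rho>2 xs))) + (\<Sum>x\<in>UNIV. (\<Sum>a\<leftarrow>as. \<delta> a) * Re (qtrace (\<rho>1 x)))"
  proof (intro add_mono sum_mono)
    show "(\<Sum>x\<in>UNIV. cmod (val 1 (E a x) (\<rho>2 xs) - val 1 (E' a x) (\<rho>2 xs))) \<le> \<delta> a * Re (qtrace (\<rho>2 xs))"
      if "xs \<in> ?L" for xs using cl psd2[OF that] by (simp add: close_def)
    show "(\<Sum>xs\<in>?L. cmod (val ?n (?T xs) (\<rho>1 x) - val ?n (?T' xs) (\<rho>1 x))) \<le> (\<Sum>a\<leftarrow>as. \<delta> a) * Re (qtrace (\<rho>1 x))" for x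
      by (rule Cons.IH) (use Cons.prems psd1 in auto)
  qed
  also have "\<dots> = \<delta> a * Re (qtrace \<rho>) + (\<Sum>a\<leftarrow>as. \<delta> a) * Re (qtrace \<rho>)"
    unfolding sum_distrib_left[symmetric] tr1 tr2 ..
  also have "\<dots> = (\<Sum>a\<leftarrow>a # as. \<delta> a) * Re (qtrace \<rho>)"
    by (simp add: algebra_simps)
  finally show ?case .
qed

section \<open>Interchange law, product measurements and classical post-processing\<close>

lemma kcomp_kten:
  "kcomp (s + S) (kten s t K2 K2') (kten k s K1 K1') = kten k t (kcomp s K2 K1) (kcomp S K2' K1')"
proof (intro ext)
  let ?B = bitstrings
  fix u v U V
  have "kcomp (s + S) (kten s t K2 K2') (kten k s K1 K1') u v U V =
    (\<Sum>a\<in>?B s. \<Sum>a'\<in>?B S. \<Sum>b\<in>?B s. \<Sum>b'\<in>?B S.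
       (K2 a b (take t U) (take t V) * K1 (take k u) (take k v) a b) *
       (K2' a' b' (drop t U) (drop t V) * K1' (drop k u) (drop k v) a' b'))"
    by (simp add: kcomp_def sum_bitstrings_append kten_def mem_bitstrings mult_ac cong: sum.cong_simp)
  also have "\<dots> = (\<Sum>a\<in>?B s. \<Sum>b\<in>?B s. \<Sum>a'\<in>?B S. \<Sum>b'\<in>?B S.
       (K2 a b (take t U) (take t V) * K1 (take k u) (take k v) a b) *
       (K2' a' b' (drop t U) (drop t V) * K1' (drop k u) (drop k v) a' b'))"
    by (intro sum.cong refl sum.swap)
  also have "\<dots> = kten k t (kcomp s K2 K1) (kcomp S K2' K1') u v U V"
    by (simp add: kten_def kcomp_def sum_distrib_left sum_distrib_right) (rule sum_double_swap)
  finally show "kcomp (s + S) (kten s t K2 K2') (kten k s K1 K1') u v U V = \<dots>" .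
qed

lemma kcomp_tens:
  "length \<kappa>2s = length \<kappa>1s \<Longrightarrow>
   kcomp (s * length \<kappa>1s) (tens s t \<kappa>2s) (tens k s \<kappa>1s) = tens k t (map2 (kcomp s) \<kappa>2s \<kappa>1s)"
proof (induction \<kappa>2s \<kappa>1s rule: list_induct2)
  case Nil
  show ?case by (intro ext) (simp add: kcomp_def)
qed (simp add: kcomp_kten)

text \<open>An opening measures its whole block at once, while the inner commitments act on
  sub-blocks; both bases are product bases, so the measurement splits accordingly.\<close>

lemma meas_kernel_concat:
  assumes "\<And>z. z \<in> set zs \<Longrightarrow> length z = k" "length u = k * length zs" "length v = k * length zs"
  shows "meas_kernel c (concat zs) u v U V = tens k 0 (map (meas_kernel c) zs) u v U V"
  using assms
proof (induction zs arbitrary: u v U V)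
  case Nil
  then show ?case by (simp add: meas_kernel_eq basis_amp_def hadamard_def ip_def)
next
  case (Cons z zs)
  have *: "basis_amp c u (z @ concat zs) = basis_amp c (take k u) z * basis_amp c (drop k u) (concat zs)"
    if "length u = k * length (z # zs)" for u
    using basis_amp_append[of "take k u" z c "drop k u" "concat zs"] that Cons.prems(1)[of z] by simp
  have "meas_kernel c (concat zs) (drop k u) (drop k v) (drop 0 U) (drop 0 V) =
      tens k 0 (map (meas_kernel c) zs) (drop k u) (drop k v) (drop 0 U) (drop 0 V)"
    by (rule Cons.IH) (use Cons.prems in auto)
  moreover have "meas_kernel c (concat (z # zs)) u v U V =
      meas_kernel c z (take k u) (take k v) (take 0 U) (take 0 V) *
      meas_kernel c (concat zs) (drop k u) (drop k v) (drop 0 U) (drop 0 V)"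
    using Cons.prems by (simp add: meas_kernel_eq *)
  ultimately show ?case by (simp add: kten_def)
qed

text \<open>Classical post-processing: the effect of the event that the raw outcome decodes to
  x.\<close>

definition coarse :: "'c set \<Rightarrow> ('c \<Rightarrow> 'o) \<Rightarrow> ('c \<Rightarrow> kernel) \<Rightarrow> 'o \<Rightarrow> kernel" where
  "coarse C dec e x = (\<lambda>u v U V. \<Sum>c\<in>{c \<in> C. dec c = x}. e c u v U V)"

lemma val_coarse: "val N (coarse C dec e x) \<rho> = (\<Sum>c\<in>{c \<in> C. dec c = x}. val N (e c) \<rho>)"
  by (simp add: coarse_def val_sum)

lemma instrument_coarse:
  fixes dec :: "'c \<Rightarrow> 'o::finite"
  assumes "instrument C k s e"
  shows "instrument UNIV k s (coarse C dec e)"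
  unfolding instrument_def
proof (intro conjI ballI allI impI)
  show "cp k s (coarse C dec e x)" for x
    unfolding coarse_def using assms by (intro cp_sum) (simp add: instrument_def)
  fix p r \<rho> assume \<rho>: "supported (p + k + r) \<rho>"
  have "qtrace (sop p k s r (coarse C dec e x) \<rho>) = (\<Sum>c\<in>{c \<in> C. dec c = x}. qtrace (sop p k s r (e c) \<rho>))" for x
  proof -
    have "supported (p + s + r) (\<lambda>i j. \<Sum>c\<in>{c \<in> C. dec c = x}. sop p k s r (e c) \<rho> i j)"
      using supported_sop[of p s r k "coarse C dec e x" \<rho>] by (simp add: coarse_def sop_sum_kernel)
    then show ?thesis
      by (simp add: coarse_def sop_sum_kernel qtrace_eq_sum[of "p + s + r"] supported_sop) (rule sum.swap)
  qed
  then have "(\<Sum>x\<in>UNIV. qtrace (sop p k s r (coarse C dec e x) \<rho>)) =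
      (\<Sum>x\<in>UNIV. \<Sum>c\<in>{c \<in> C. dec c = x}. qtrace (sop p k s r (e c) \<rho>))" by simp
  also have "\<dots> = (\<Sum>c\<in>C. qtrace (sop p k s r (e c) \<rho>))"
    using assms by (intro sum.group) (auto simp: instrument_def)
  finally show "(\<Sum>x\<in>UNIV. qtrace (sop p k s r (coarse C dec e x) \<rho>)) = qtrace \<rho>"
    using assms \<rho> by (simp add: instrument_def)
qed simp

text \<open>Distributivity: decoding entry by entry makes each fibre a product of fibres, so a sum
  of tensor products becomes a tensor product of sums.\<close>

lemma tens_coarse:
  assumes "length xs = length as"
  shows "(\<Sum>cs\<in>{cs \<in> listset (map C as). map2 dec as cs = xs}. tens k s (map2 e as cs) u v U V) =
    tens k s (map2 (\<lambda>a. coarse (C a) (dec a) (e a)) as xs) u v U V"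
  using assms
proof (induction xs as arbitrary: u v U V rule: list_induct2)
  case Nil
  have "{cs \<in> listset (map C []). map2 dec [] cs = []} = {[]}" by auto
  then show ?case by simp
next
  case (Cons x xs a as)
  have set: "{cs \<in> listset (map C (a # as)). map2 dec (a # as) cs = x # xs} =
     (\<lambda>(c, cs). c # cs) ` ({c \<in> C a. dec a c = x} \<times> {cs \<in> listset (map C as). map2 dec as cs = xs})"
    unfolding list.map listset_Cons by auto
  have "tens k s (map2 (\<lambda>a. coarse (C a) (dec a) (e a)) (a # as) (x # xs)) u v U V =
    (\<Sum>c\<in>{c \<in> C a. dec a c = x}. e a c (take k u) (take k v) (take s U) (take s V)) *
    (\<Sum>cs\<in>{cs \<in> listset (map C as). map2 dec as cs = xs}. tens k s (map2 e as cs) (drop k u) (drop k v) (drop s U) (drop s V))"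
    unfolding Cons.IH by (simp add: kten_def coarse_def[of "C a"])
  then show ?case
    unfolding set
    by (subst sum.reindex[OF inj_on_Cons]) (simp add: kten_def sum_product sum.cartesian_product split_def)
qed

text \<open>\<open>None\<close> is rejection, which the ideal measurement never produces; it is kept
  as an outcome with effect zero so that both measurements share the type
  \<open>bool option\<close>.\<close>

definition ideal :: "bool \<Rightarrow> bool option \<Rightarrow> kernel" where
  "ideal c x = (case x of None \<Rightarrow> (\<lambda>_ _ _ _. 0) | Some m \<Rightarrow> meas_kernel c [m])"

lemma UNIV_bool_option: "UNIV = {None, Some False, Some True}"
  by (auto simp: UNIV_option_conv UNIV_bool)

lemma ideal_eq_coarse: "ideal c = coarse (bitstrings 1) (\<lambda>z. Some (hd z)) (meas_kernel c)"
proof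
  fix x
  have "{z \<in> bitstrings 1. Some (hd z) = x} = (case x of None \<Rightarrow> {} | Some m \<Rightarrow> {[m]})"
    by (auto simp: bitstrings_def length_Suc_conv split: option.split)
  then show "ideal c x = coarse (bitstrings 1) (\<lambda>z. Some (hd z)) (meas_kernel c) x"
    by (simp add: ideal_def coarse_def split: option.split)
qed

lemma instrument_ideal: "instrument UNIV 1 0 (ideal c)"
  unfolding ideal_eq_coarse by (intro instrument_coarse instrument_meas)

section \<open>Total variation distance and negligible functions\<close>

lemma tv_dist_leI: "(\<And>A. \<bar>measure_pmf.prob p A - measure_pmf.prob q A\<bar> \<le> d) \<Longrightarrow> tv_dist p q \<le> d"
  unfolding tv_dist_def by (rule cSUP_least) auto

lemma bdd_above_tv: "bdd_above (range (\<lambda>A. \<bar>measure_pmf.prob p A - measure_pmf.prob q A\<bar>))"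
proof (rule bdd_aboveI2)
  show "\<bar>measure_pmf.prob p A - measure_pmf.prob q A\<bar> \<le> 1" for A
    using measure_pmf.prob_le_1[of p A] measure_pmf.prob_le_1[of q A]
      measure_nonneg[of "measure_pmf p" A] measure_nonneg[of "measure_pmf q" A] by linarith
qed

lemma tv_dist_ge: "\<bar>measure_pmf.prob p A - measure_pmf.prob q A\<bar> \<le> tv_dist p q"
  unfolding tv_dist_def by (rule cSUP_upper[OF _ bdd_above_tv]) simp

lemma tv_dist_nonneg: "0 \<le> tv_dist p q"
  using tv_dist_ge[of p "{}" q] by simp

lemma tv_dist_map: "tv_dist (map_pmf f p) (map_pmf f q) \<le> tv_dist p q"
  by (rule tv_dist_leI) (simp add: measure_map_pmf tv_dist_ge)

text \<open>Used to average over the keys: the comparison distribution \<open>q\<close> does not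
  depend on them, so a bound for every key in the support holds for the mixture.\<close>

lemma tv_dist_bind_le:
  assumes "\<And>x. x \<in> set_pmf p \<Longrightarrow> tv_dist (f x) q \<le> d"
  shows "tv_dist (bind_pmf p f) q \<le> d"
proof (rule tv_dist_leI)
  fix A
  have int: "integrable (measure_pmf p) (\<lambda>x. measure_pmf.prob (f x) A)"
    by (rule measure_pmf.integrable_const_bound[where B = 1]) (auto simp: measure_pmf.prob_le_1)
  have b: "measure_pmf.prob (f x) A \<le> measure_pmf.prob q A + d" "measure_pmf.prob q A - d \<le> measure_pmf.prob (f x) A"
    if "x \<in> set_pmf p" for x
    using tv_dist_ge[of "f x" A q] assms[OF that] by linarith+
  have "measure_pmf.prob (bind_pmf p f) A = (\<integral>x. measure_pmf.prob (f x) A \<partial>measure_pmf p)"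
    by (subst measure_pmf_bind)
       (rule measure_pmf.measure_bind[where N = "count_space UNIV"], auto simp: measure_pmf_in_subprob_algebra)
  moreover have "(\<integral>x. measure_pmf.prob (f x) A \<partial>measure_pmf p) \<le> measure_pmf.prob q A + d"
    by (rule measure_pmf.integral_le_const[OF int]) (auto simp: AE_measure_pmf_iff b)
  moreover have "(\<integral>x. measure_pmf.prob (f x) A \<partial>measure_pmf p) \<ge> measure_pmf.prob q A - d"
    by (rule measure_pmf.integral_ge_const[OF int]) (auto simp: AE_measure_pmf_iff b)
  ultimately show "\<bar>measure_pmf.prob (bind_pmf p f) A - measure_pmf.prob q A\<bar> \<le> d" by linarith
qed

text \<open>The sum is twice the distance; a constant factor is harmless for negligibility.\<close>

lemma tv_dist_le_sum:
  assumes "finite S" "set_pmf p \<subseteq> S" "set_pmf q \<subseteq> S"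
  shows "tv_dist p q \<le> (\<Sum>x\<in>S. \<bar>pmf p x - pmf q x\<bar>)"
proof (rule tv_dist_leI)
  fix A
  have prob: "measure_pmf.prob r A = (\<Sum>x\<in>S \<inter> A. pmf r x)" if "set_pmf r \<subseteq> S" for r :: "'a pmf"
  proof -
    have "measure_pmf.prob r A = measure_pmf.prob r (A \<inter> set_pmf r)" by (simp add: measure_Int_set_pmf)
    also have "\<dots> = measure_pmf.prob r (S \<inter> A)"
      using that by (intro measure_pmf.finite_measure_eq_AE) (auto simp: AE_measure_pmf_iff)
    finally show ?thesis using assms(1) by (simp add: measure_measure_pmf_finite)
  qed
  have "\<bar>measure_pmf.prob p A - measure_pmf.prob q A\<bar> = \<bar>\<Sum>x\<in>S \<inter> A. pmf p x - pmf q x\<bar>"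
    using assms by (simp add: prob sum_subtractf)
  also have "\<dots> \<le> (\<Sum>x\<in>S \<inter> A. \<bar>pmf p x - pmf q x\<bar>)" by (rule sum_abs)
  also have "\<dots> \<le> (\<Sum>x\<in>S. \<bar>pmf p x - pmf q x\<bar>)" by (rule sum_mono2) (use assms in auto)
  finally show "\<bar>measure_pmf.prob p A - measure_pmf.prob q A\<bar> \<le> (\<Sum>x\<in>S. \<bar>pmf p x - pmf q x\<bar>)" .
qed

lemma negl_mono:
  assumes "negl g" "\<And>n. \<bar>f n\<bar> \<le> \<bar>g n\<bar>"
  shows "negl f"
  unfolding negl_def
proof
  fix c
  have "f \<in> O(g)" using assms(2) by (intro landau_o.big_mono) auto
  also have "g \<in> O(\<lambda>n. inverse (real n ^ c))" using assms(1) by (simp add: negl_def)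
  finally show "f \<in> O(\<lambda>n. inverse (real n ^ c))" .
qed

lemma negl_add: "negl f \<Longrightarrow> negl g \<Longrightarrow> negl (\<lambda>n. f n + g n)"
  by (simp add: negl_def sum_in_bigo)

lemma negl_cmult: "negl f \<Longrightarrow> negl (\<lambda>n. c * f n)"
  by (cases "c = 0") (simp_all add: negl_def)

lemma negl_poly_mult:
  assumes "poly_bounded L" "negl f"
  shows "negl (\<lambda>n. real (L n) * f n)"
  unfolding negl_def
proof
  fix c
  obtain e where e: "\<And>n. L n \<le> n ^ e + e" using assms(1) by (auto simp: poly_bounded_def)
  have "(\<lambda>n. real (L n)) \<in> O(\<lambda>n. real n ^ e)"
  proof (rule landau_o.bigI[of "1 + real e"])
    show "\<forall>\<^sub>F n in at_top. norm (real (L n)) \<le> (1 + real e) * norm (real n ^ e)"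
    proof (rule eventually_mono[OF eventually_ge_at_top[of 1]])
      fix n :: nat assume "1 \<le> n"
      then have "1 \<le> real n ^ e" by (simp add: one_le_power)
      then have "real e \<le> real e * real n ^ e" by (simp add: mult_le_cancel_left1)
      moreover have "real (L n) \<le> real n ^ e + real e"
        using e[of n] by (metis of_nat_add of_nat_le_iff of_nat_power)
      ultimately show "norm (real (L n)) \<le> (1 + real e) * norm (real n ^ e)" by (simp add: algebra_simps)
    qed
  qed simp
  \<comment> \<open>The exponent \<open>e + c\<close> compensates the growth of \<open>L\<close> of
    order e and leaves decay of order c.\<close>
  moreover have "f \<in> O(\<lambda>n. inverse (real n ^ (e + c)))" using assms(2) by (simp add: negl_def)
  ultimately have "(\<lambda>n. real (L n) * f n) \<in> O(\<lambda>n. real n ^ e * inverse (real n ^ (e + c)))"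
    by (rule landau_o.big_mult)
  also have "(\<lambda>n. real n ^ e * inverse (real n ^ (e + c))) \<in> O(\<lambda>n. inverse (real n ^ c))"
    by (intro landau_o.big_mono eventually_mono[OF eventually_gt_at_top[of 0]]) (simp add: power_add field_simps)
  finally show "(\<lambda>n. real (L n) * f n) \<in> O(\<lambda>n. inverse (real n ^ c))" .
qed

section \<open>Opening a weak commitment\<close>

text \<open>Both branches of \<open>Ver1\<close> and \<open>Out1\<close> consist of this test: the
  outer commitment is decoded with \<open>c = b\<close>, the inner ones with
  \<open>c = (\<not> b)\<close>.\<close>

definition weak_decode :: "ntcf_algorithms \<Rightarrow> nat \<Rightarrow> bool \<Rightarrow> bits \<Rightarrow> bits \<Rightarrow> bits \<Rightarrow> bits \<Rightarrow> bool option" where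
  "weak_decode F n c pk sk y z =
     (if c then (case Invert F sk y of None \<Rightarrow> None
         | Some (x0, x1) \<Rightarrow> if z \<in> good_set F n x0 x1 then Some (claw_bit z x0 x1) else None)
      else if Check F pk (hd z) (tl z) y then Some (hd z) else None)"

definition opened_kernel :: "nat \<Rightarrow> nat \<Rightarrow> (bool \<Rightarrow> bits \<Rightarrow> complex) \<Rightarrow> bool \<Rightarrow> bits \<times> bits \<Rightarrow> kernel" where
  "opened_kernel w G \<psi> c = (\<lambda>(y, z). kcomp (Suc w) (meas_kernel c z) (prep_kernel G \<psi> y))"

text \<open>The amplitude of the outcome (y, z) on the input bit a. The content g of the discarded
  work qubits is kept as an index, so that kernel entries are inner products of amplitude
  vectors.\<close>

definition opened_amp :: "nat \<Rightarrow> (bool \<Rightarrow> bits \<Rightarrow> complex) \<Rightarrow> bool \<Rightarrow> bool \<Rightarrow> bits \<times> bits \<times> bits \<Rightarrow> complex" where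
  "opened_amp w \<psi> c a = (\<lambda>(y, z, g). \<Sum>U\<in>bitstrings (Suc w). basis_amp c U z * prep_vec \<psi> [a] (U @ y @ g))"

lemma opened_kernel_entry:
  "opened_kernel w G \<psi> c (y, z) [a] [b] [] [] =
     (\<Sum>g\<in>bitstrings G. opened_amp w \<psi> c a (y, z, g) * cnj (opened_amp w \<psi> c b (y, z, g)))"
proof -
  let ?B = bitstrings
  have "opened_kernel w G \<psi> c (y, z) [a] [b] [] [] =
    (\<Sum>U\<in>?B (Suc w). \<Sum>V\<in>?B (Suc w). \<Sum>g\<in>?B G.
      (basis_amp c U z * prep_vec \<psi> [a] (U @ y @ g)) * cnj (basis_amp c V z * prep_vec \<psi> [b] (V @ y @ g)))"
    by (simp add: opened_kernel_def kcomp_def meas_kernel_eq prep_kernel_def kraus_def sum_distrib_left mult_ac)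
  also have "\<dots> = (\<Sum>g\<in>?B G. \<Sum>U\<in>?B (Suc w). \<Sum>V\<in>?B (Suc w).
      (basis_amp c U z * prep_vec \<psi> [a] (U @ y @ g)) * cnj (basis_amp c V z * prep_vec \<psi> [b] (V @ y @ g)))"
    by (rule sum_rotate3[symmetric])
  also have "\<dots> = (\<Sum>g\<in>?B G. opened_amp w \<psi> c a (y, z, g) * cnj (opened_amp w \<psi> c b (y, z, g)))"
    by (simp add: opened_amp_def sum_product cnj_sum)
  finally show ?thesis .
qed

lemma basis_amp_parseval:
  "(\<Sum>z\<in>bitstrings k. (cmod (\<Sum>U\<in>bitstrings k. basis_amp c U z * f U))\<^sup>2) = (\<Sum>U\<in>bitstrings k. (cmod (f U))\<^sup>2)"
proof -
  let ?B = bitstrings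
  have "complex_of_real (\<Sum>z\<in>?B k. (cmod (\<Sum>U\<in>?B k. basis_amp c U z * f U))\<^sup>2) =
    (\<Sum>z\<in>?B k. (\<Sum>U\<in>?B k. basis_amp c U z * f U) * cnj (\<Sum>V\<in>?B k. basis_amp c V z * f V))"
    by (simp only: of_real_sum complex_norm_square of_real_power[symmetric])
  also have "\<dots> = (\<Sum>z\<in>?B k. \<Sum>U\<in>?B k. \<Sum>V\<in>?B k. basis_amp c U z * basis_amp c V z * (f U * cnj (f V)))"
    by (simp add: sum_product cnj_sum mult_ac)
  also have "\<dots> = (\<Sum>U\<in>?B k. \<Sum>V\<in>?B k. \<Sum>z\<in>?B k. basis_amp c U z * basis_amp c V z * (f U * cnj (f V)))"
    by (rule sum_rotate3)
  also have "\<dots> = (\<Sum>U\<in>?B k. \<Sum>V\<in>?B k. of_bool (U = V) * (f U * cnj (f V)))"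
    by (intro sum.cong refl) (simp add: basis_amp_orthonormal mem_bitstrings flip: sum_distrib_right)
  also have "\<dots> = (\<Sum>U\<in>?B k. f U * cnj (f U))"
    by (intro sum.cong refl) (simp add: of_bool_def if_distrib[of "\<lambda>x. x * _"] cong: if_cong)
  also have "\<dots> = complex_of_real (\<Sum>U\<in>?B k. (cmod (f U))\<^sup>2)"
    by (simp only: of_real_sum complex_norm_square of_real_power[symmetric])
  finally show ?thesis by (simp only: of_real_eq_iff)
qed

lemma opened_amp_norm:
  "(\<Sum>t\<in>bitstrings R \<times> bitstrings (Suc w) \<times> bitstrings G. (cmod (opened_amp w \<psi> c a t))\<^sup>2) =
     (\<Sum>z\<in>bitstrings (w + R + G). (cmod (\<psi> a z))\<^sup>2)"
proof -
  let ?B = bitstrings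
  have vec: "(\<Sum>U\<in>?B (Suc w). (cmod (prep_vec \<psi> [a] (U @ t)))\<^sup>2) = (\<Sum>x\<in>?B w. (cmod (\<psi> a (x @ t)))\<^sup>2)" for t
    unfolding sum_bitstrings_Suc by (cases a) (simp_all add: UNIV_bool prep_vec_def)
  have "(\<Sum>t\<in>?B R \<times> ?B (Suc w) \<times> ?B G. (cmod (opened_amp w \<psi> c a t))\<^sup>2) =
    (\<Sum>y\<in>?B R. \<Sum>z\<in>?B (Suc w). \<Sum>g\<in>?B G. (cmod (opened_amp w \<psi> c a (y, z, g)))\<^sup>2)"
    by (simp add: sum.cartesian_product split_def)
  also have "\<dots> = (\<Sum>y\<in>?B R. \<Sum>g\<in>?B G. \<Sum>z\<in>?B (Suc w). (cmod (opened_amp w \<psi> c a (y, z, g)))\<^sup>2)"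
    by (rule sum.cong[OF refl], rule sum.swap)
  also have "\<dots> = (\<Sum>y\<in>?B R. \<Sum>g\<in>?B G. \<Sum>x\<in>?B w. (cmod (\<psi> a (x @ y @ g)))\<^sup>2)"
    by (simp only: opened_amp_def prod.case basis_amp_parseval vec)
  also have "\<dots> = (\<Sum>x\<in>?B w. \<Sum>y\<in>?B R. \<Sum>g\<in>?B G. (cmod (\<psi> a (x @ y @ g)))\<^sup>2)"
    by (rule sum_rotate3[symmetric])
  finally show ?thesis by (simp add: sum_bitstrings_append)
qed

text \<open>Amplitudes are linear in the prepared state, and by Parseval opening preserves their L2
  norm, so they differ by at most \<open>\<nu>\<close> as well. A product of two amplitudes is
  exchanged one factor at a time; Cauchy-Schwarz against unit vectors bounds each exchange by
  \<open>\<nu>\<close>, and \<open>close_1I\<close> contributes the 4.\<close>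

lemma close_opened_kernel:
  fixes dec :: "bits \<times> bits \<Rightarrow> 'o::finite"
  assumes \<psi>: "\<And>b. (\<Sum>z\<in>bitstrings (w + R + G). (cmod (\<psi> b z))\<^sup>2) = 1"
    and \<phi>: "\<And>b. (\<Sum>z\<in>bitstrings (w + R + G). (cmod (\<phi> b z))\<^sup>2) = 1"
    and diff: "\<And>b. L2_set (\<lambda>z. cmod (\<psi> b z - \<phi> b z)) (bitstrings (w + R + G)) \<le> \<nu>"
  shows "close (Suc 0) (coarse (bitstrings R \<times> bitstrings (Suc w)) dec (opened_kernel w G \<psi> c))
     (coarse (bitstrings R \<times> bitstrings (Suc w)) dec (opened_kernel w G \<phi> c)) (4 * (2 * \<nu>))"
proof (rule close_1I)
  let ?B = bitstrings
  fix a b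
  let ?C = "?B R \<times> ?B (Suc w)"
  let ?I = "?B R \<times> ?B (Suc w) \<times> ?B G"
  let ?S = "\<Sum>x\<in>UNIV. cmod (coarse ?C dec (opened_kernel w G \<psi> c) x [a] [b] [] [] - coarse ?C dec (opened_kernel w G \<phi> c) x [a] [b] [] [])"
  let ?\<alpha> = "opened_amp w \<psi> c" let ?\<beta> = "opened_amp w \<phi> c"
  let ?d = "\<lambda>x. opened_kernel w G \<psi> c x [a] [b] [] [] - opened_kernel w G \<phi> c x [a] [b] [] []"
  have amp_diff: "?\<alpha> a' t - ?\<beta> a' t = opened_amp w (\<lambda>b z. \<psi> b z - \<phi> b z) c a' t" for a' t
    by (auto simp: opened_amp_def prep_vec_def split_def algebra_simps simp flip: sum_subtractf intro!: sum.cong)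
  have n1: "L2_set (\<lambda>t. cmod (?\<alpha> a' t)) ?I = 1" "L2_set (\<lambda>t. cmod (?\<beta> a' t)) ?I = 1" for a'
    by (simp_all add: L2_set_def opened_amp_norm \<psi> \<phi>)
  have nd: "L2_set (\<lambda>t. cmod (?\<alpha> a' t - ?\<beta> a' t)) ?I \<le> \<nu>" for a'
    using diff[of a'] by (simp add: amp_diff L2_set_def opened_amp_norm)
  have "?S
     \<le> (\<Sum>x\<in>UNIV. \<Sum>t\<in>{t \<in> ?C. dec t = x}. cmod (?d t))"
    by (intro sum_mono) (simp add: coarse_def norm_sum flip: sum_subtractf)
  also have "\<dots> = (\<Sum>t\<in>?C. cmod (?d t))"
    by (rule sum.group) auto
  also have "\<dots> \<le> (\<Sum>(y, z)\<in>?C. \<Sum>g\<in>?B G. cmod (?\<alpha> a (y, z, g) * cnj (?\<alpha> b (y, z, g)) - ?\<beta> a (y, z, g) * cnj (?\<beta> b (y, z, g))))"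
    by (intro sum_mono) (auto simp: opened_kernel_entry norm_sum simp flip: sum_subtractf)
  also have "\<dots> = (\<Sum>t\<in>?I. cmod (?\<alpha> a t * cnj (?\<alpha> b t) - ?\<beta> a t * cnj (?\<beta> b t)))"
    by (simp add: sum.cartesian_product')
  also have "\<dots> \<le> (\<Sum>t\<in>?I. \<bar>cmod (?\<alpha> a t)\<bar> * \<bar>cmod (?\<alpha> b t - ?\<beta> b t)\<bar> + \<bar>cmod (?\<alpha> a t - ?\<beta> a t)\<bar> * \<bar>cmod (?\<beta> b t)\<bar>)"
  proof (intro sum_mono)
    fix t
    have "?\<alpha> a t * cnj (?\<alpha> b t) - ?\<beta> a t * cnj (?\<beta> b t) =
       ?\<alpha> a t * cnj (?\<alpha> b t - ?\<beta> b t) + (?\<alpha> a t - ?\<beta> a t) * cnj (?\<beta> b t)"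
      by (simp add: algebra_simps)
    then show "cmod (?\<alpha> a t * cnj (?\<alpha> b t) - ?\<beta> a t * cnj (?\<beta> b t)) \<le>
      \<bar>cmod (?\<alpha> a t)\<bar> * \<bar>cmod (?\<alpha> b t - ?\<beta> b t)\<bar> + \<bar>cmod (?\<alpha> a t - ?\<beta> a t)\<bar> * \<bar>cmod (?\<beta> b t)\<bar>"
      by (metis abs_norm_cancel complex_mod_cnj norm_mult norm_triangle_ineq)
  qed
  also have "\<dots> \<le> L2_set (\<lambda>t. cmod (?\<alpha> a t)) ?I * L2_set (\<lambda>t. cmod (?\<alpha> b t - ?\<beta> b t)) ?I +
      L2_set (\<lambda>t. cmod (?\<alpha> a t - ?\<beta> a t)) ?I * L2_set (\<lambda>t. cmod (?\<beta> b t)) ?I"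
    unfolding sum.distrib by (intro add_mono L2_set_mult_ineq)
  also have "\<dots> \<le> 2 * \<nu>" using nd[of a] nd[of b] by (simp add: n1)
  finally show "?S \<le> 2 * \<nu>" .
qed

text \<open>
  In the ideal case the string \<open>y\<close> has probability \<open>q y\<close> and leaves the basis vector \<open>a\<close> in the
  state \<open>a # X y a\<close>, so that it suffices to bound the error for every single \<open>y\<close>.
\<close>

lemma close_opened_ideal:
  fixes q :: "bits \<Rightarrow> real"
  assumes \<phi>: "\<And>a x y g. \<lbrakk>length x = w; length y = R; length g = G\<rbrakk> \<Longrightarrow>
      \<phi> a (x @ y @ g) = (if x = X y a \<and> g = replicate G False then complex_of_real (sqrt (q y)) else 0)"
    and X: "\<And>y a. length (X y a) = w"
    and q: "\<And>y. 0 \<le> q y" "(\<Sum>y\<in>bitstrings R. q y) = 1"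
    and err: "\<And>y x a b. \<lbrakk>length y = R; q y \<noteq> 0\<rbrakk> \<Longrightarrow>
      cmod ((\<Sum>z\<in>{z \<in> bitstrings (Suc w). dec (y, z) = x}. basis_amp c (a # X y a) z * basis_amp c (b # X y b) z)
        - ideal c x [a] [b] [] []) \<le> \<nu>"
  shows "close (Suc 0) (coarse (bitstrings R \<times> bitstrings (Suc w)) dec (opened_kernel w G \<phi> c)) (ideal c) (4 * (3 * \<nu>))"
proof (rule close_1I)
  let ?B = bitstrings
  fix a b
  let ?C = "?B R \<times> ?B (Suc w)"
  let ?E = "coarse ?C dec (opened_kernel w G \<phi> c)"
  let ?s = "\<lambda>y x. \<Sum>z\<in>{z \<in> ?B (Suc w). dec (y, z) = x}. basis_amp c (a # X y a) z * basis_amp c (b # X y b) z"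
  have amp: "opened_amp w \<phi> c a (y, z, g) = (if g = replicate G False then complex_of_real (sqrt (q y)) * basis_amp c (a # X y a) z else 0)"
    if "length y = R" "length g = G" for y z g a
  proof -
    have "opened_amp w \<phi> c a (y, z, g) = (\<Sum>x\<in>?B w. basis_amp c (a # x) z * \<phi> a (x @ y @ g))"
      unfolding opened_amp_def sum_bitstrings_Suc by (cases a) (simp_all add: UNIV_bool prep_vec_def)
    also have "\<dots> = (\<Sum>x\<in>?B w. if x = X y a then (if g = replicate G False then complex_of_real (sqrt (q y)) * basis_amp c (a # X y a) z else 0) else 0)"
      using that by (intro sum.cong refl) (auto simp: \<phi> mem_bitstrings)
    finally show ?thesis using X by (simp add: mem_bitstrings)
  qed
  have entry: "opened_kernel w G \<phi> c (y, z) [a] [b] [] [] = complex_of_real (q y) * (basis_amp c (a # X y a) z * basis_amp c (b # X y b) z)"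
    if "length y = R" for y z
  proof -
    let ?p = "\<lambda>g. if g = replicate G False then complex_of_real (q y) * (basis_amp c (a # X y a) z * basis_amp c (b # X y b) z) else 0"
    have "opened_kernel w G \<phi> c (y, z) [a] [b] [] [] =
      (\<Sum>g\<in>?B G. ?p g)"
      unfolding opened_kernel_entry
    proof (intro sum.cong refl)
      fix g assume "g \<in> ?B G"
      moreover have "complex_of_real (sqrt (q y)) * complex_of_real (sqrt (q y)) = complex_of_real (q y)"
        using q(1)[of y] by (simp flip: of_real_mult)
      ultimately show "opened_amp w \<phi> c a (y, z, g) * cnj (opened_amp w \<phi> c b (y, z, g)) =
         ?p g"
        using that by (simp add: amp mem_bitstrings)
    qed
    then show ?thesis by (simp add: mem_bitstrings)
  qed
  have main: "cmod (?E x [a] [b] [] [] - ideal c x [a] [b] [] []) \<le> \<nu>" for x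
  proof -
    have set: "{t \<in> ?C. dec t = x} = Sigma (?B R) (\<lambda>y. {z \<in> ?B (Suc w). dec (y, z) = x})" by auto
    have "?E x [a] [b] [] [] = (\<Sum>y\<in>?B R. complex_of_real (q y) * ?s y x)"
      unfolding coarse_def set
      unfolding sum_distrib_left by (subst sum.Sigma, simp, simp, intro sum.cong refl) (auto simp: entry mem_bitstrings)
    moreover have "ideal c x [a] [b] [] [] = (\<Sum>y\<in>?B R. complex_of_real (q y) * ideal c x [a] [b] [] [])"
      by (simp add: q(2) flip: sum_distrib_right of_real_sum)
    ultimately have "?E x [a] [b] [] [] - ideal c x [a] [b] [] [] =
      (\<Sum>y\<in>?B R. complex_of_real (q y) * (?s y x - ideal c x [a] [b] [] []))"
      by (simp only: sum_subtractf right_diff_distrib)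
    also have "cmod \<dots> \<le> (\<Sum>y\<in>?B R. q y * \<nu>)"
    proof (rule sum_norm_le)
      fix y assume "y \<in> ?B R"
      then show "cmod (complex_of_real (q y) * (?s y x - ideal c x [a] [b] [] [])) \<le> q y * \<nu>"
        using err[of y a b x] q(1)[of y] by (cases "q y = 0") (auto simp: norm_mult mem_bitstrings intro!: mult_left_mono)
    qed
    also have "\<dots> = \<nu>" by (simp add: q(2) flip: sum_distrib_right)
    finally show ?thesis .
  qed
  \<comment> \<open>There are three decoded outcomes, each with error at most
    \<open>\<nu>\<close>.\<close>
  have "(\<Sum>x\<in>UNIV. cmod (?E x [a] [b] [] [] - ideal c x [a] [b] [] [])) \<le> (\<Sum>x\<in>(UNIV :: bool option set). \<nu>)"
    by (intro sum_mono main)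
  then show "(\<Sum>x\<in>UNIV. cmod (?E x [a] [b] [] [] - ideal c x [a] [b] [] [])) \<le> 3 * \<nu>"
    by (simp add: UNIV_bool_option)
qed

section \<open>Signs of Hadamard amplitudes and the bit decoded from a claw\<close>

lemma ip_bxor:
  "length x0 = length t \<Longrightarrow> length x1 = length t \<Longrightarrow> ip (bxor x0 x1) t \<longleftrightarrow> ip x0 t \<noteq> ip x1 t"
proof (induction t arbitrary: x0 x1)
  case (Cons a t)
  then obtain b0 y0 b1 y1 where "x0 = b0 # y0" "x1 = b1 # y1" by (metis length_Suc_conv)
  then show ?case using Cons by (auto simp: bxor_def ip_Cons)
qed (simp add: ip_def)

lemma claw_bit_eq:
  assumes "length z = Suc w" "length x0 = w" "length x1 = w"
  shows "claw_bit z x0 x1 \<longleftrightarrow> ip (False # x0) z \<noteq> ip (True # x1) z"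
proof -
  obtain h t where "z = h # t" "length t = w" using assms by (metis length_Suc_conv)
  then show ?thesis using assms by (auto simp: claw_bit_def ip_commute[of t] ip_Cons ip_bxor)
qed

lemma hadamard_mult_hadamard:
  assumes "length z = k" "length u = k" "length v = k"
  shows "hadamard u z * hadamard v z = (if ip u z \<noteq> ip v z then -1 else 1) / 2 ^ k"
proof -
  have "complex_of_real (sqrt 2) ^ k * complex_of_real (sqrt 2) ^ k = 2 ^ k"
    by (simp add: of_real_sqrt2_squared flip: power_mult_distrib)
  then show ?thesis using assms by (simp add: hadamard_def)
qed

text \<open>The interference of the two claw members: the product of their signs is the parity of z
  against (1, x0 xor x1), which is the decoded bit. For a = b the signs cancel.\<close>

lemma hadamard_claw:
  assumes "length z = Suc w" "length (X False) = w" "length (X True) = w"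
  shows "hadamard (a # X a) z * hadamard (b # X b) z =
    (if a \<noteq> b \<and> claw_bit z (X False) (X True) then -1 else 1) / 2 ^ Suc w"
proof -
  have "hadamard (a # X a) z * hadamard (b # X b) z = (if ip (a # X a) z \<noteq> ip (b # X b) z then -1 else 1) / 2 ^ Suc w"
    using assms by (intro hadamard_mult_hadamard) (cases a; cases b; simp)+
  then show ?thesis
    using assms by (cases a; cases b) (auto simp: claw_bit_eq)
qed

text \<open>The vector paired with z begins with \<open>True\<close>, so every tail has exactly one
  first bit that yields m.\<close>

lemma card_claw_bit:
  assumes "length x0 = w" "length x1 = w"
  shows "card {z \<in> bitstrings (Suc w). claw_bit z x0 x1 = m} = 2 ^ w"
proof -
  have "{z \<in> bitstrings (Suc w). claw_bit z x0 x1 = m} = (\<lambda>t. (m \<noteq> ip t (bxor x0 x1)) # t) ` bitstrings w"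
    using assms by (auto simp: bitstrings_def length_Suc_conv claw_bit_def ip_Cons image_iff)
  then show ?thesis by (simp add: card_image inj_on_def card_bitstrings)
qed

abbreviation prep_error :: "ntcf_algorithms \<Rightarrow> nat \<Rightarrow> bits \<Rightarrow> bool \<Rightarrow> real" where
  "prep_error F n pk b \<equiv> L2_set (\<lambda>z. cmod (run_circuit (prep_qubits F n pk) (Prep F pk b) z -
     range_superposition F n pk b z)) (bitstrings (prep_qubits F n pk))"

abbreviation weak_measurement :: "ntcf_algorithms \<Rightarrow> nat \<Rightarrow> bool \<Rightarrow> bits \<Rightarrow> bits \<Rightarrow> bool option \<Rightarrow> kernel" where
  "weak_measurement F n c pk sk \<equiv> coarse (bitstrings (range_len F n) \<times> bitstrings (Suc (width F n)))
     (\<lambda>(y, z). weak_decode F n c pk sk y z) (opened_kernel (width F n) (anc F pk) (real_prep F n pk) c)"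

section \<open>Weak commitments for a fixed key pair\<close>

locale ntcf_key =
  fixes F :: ntcf_algorithms and n :: nat and pk sk :: bits
  assumes F: "ntcf F" and key: "(pk, sk) \<in> set_pmf (GenF F n)"
begin

abbreviation "w \<equiv> width F n"
abbreviation "R \<equiv> range_len F n"
abbreviation "G \<equiv> anc F pk"
abbreviation "D \<equiv> Dom F pk"

lemma Dom_finite: "finite D" "D \<noteq> {}" "x \<in> D \<Longrightarrow> length x = w"
proof -
  have "D \<noteq> {}" "D \<subseteq> bitstrings w"
    using F key unfolding ntcf_def ntcf_syntax_def by fast+
  then show "finite D" "D \<noteq> {}" "x \<in> D \<Longrightarrow> length x = w"
    by (auto simp: mem_bitstrings intro: finite_subset)
qed

lemma Rng: "Rng F pk \<subseteq> bitstrings R" "x \<in> D \<Longrightarrow> set_pmf (Eval F pk b x) \<subseteq> Rng F pk"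
  using F key unfolding ntcf_def ntcf_syntax_def by fast+

lemma Invert_Dom: "Invert F sk y = Some (x0, x1) \<Longrightarrow> x0 \<in> D \<and> x1 \<in> D"
  using F key unfolding ntcf_def ntcf_syntax_def by fast

lemma complete:
  "(\<forall>b. \<forall>x\<in>D. \<forall>y\<in>set_pmf (Eval F pk b x).
      \<exists>x0 x1. Invert F sk y = Some (x0, x1) \<and> (if b then x1 else x0) = x \<and>
        y \<in> set_pmf (Eval F pk False x0) \<and> y \<in> set_pmf (Eval F pk True x1)) \<and>
   (\<exists>M. perfect_matching D M \<and> (\<forall>x0\<in>D. \<forall>x1\<in>D.
      Eval F pk False x0 = Eval F pk True x1 \<longleftrightarrow> (x0, x1) \<in> M)) \<and>
   (\<forall>b. \<forall>x\<in>D. \<forall>y. Check F pk b x y \<longleftrightarrow> y \<in> set_pmf (Eval F pk b x))"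
proof -
  have "ntcf_complete F" using F by (simp add: ntcf_def)
  from conjunct1[OF this[unfolded ntcf_complete_def], THEN spec, THEN bspec, OF key]
  show ?thesis unfolding prod.case .
qed

lemma Invert_Eval:
  assumes "x \<in> D" "y \<in> set_pmf (Eval F pk b x)"
  obtains x0 x1 where "Invert F sk y = Some (x0, x1)" "(if b then x1 else x0) = x"
    "y \<in> set_pmf (Eval F pk False x0)" "y \<in> set_pmf (Eval F pk True x1)"
  using conjunct1[OF complete, THEN spec[of _ b], THEN bspec, OF assms(1), THEN bspec, OF assms(2)] by blast

text \<open>The partner of x0 in the matching has the same distribution as x0, so y lies in its
  support too. As \<open>Invert\<close> returns a single pair for y, the partner is x1; distinctness
  is the irreflexivity of the matching.\<close>

lemma claw:
  assumes "x \<in> D" "y \<in> set_pmf (Eval F pk b x)" "Invert F sk y = Some (x0, x1)"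
  shows "Eval F pk False x0 = Eval F pk True x1" "x0 \<noteq> x1"
proof -
  obtain M where M: "perfect_matching D M"
    "\<And>x0 x1. x0 \<in> D \<Longrightarrow> x1 \<in> D \<Longrightarrow> Eval F pk False x0 = Eval F pk True x1 \<longleftrightarrow> (x0, x1) \<in> M"
    using conjunct1[OF conjunct2[OF complete]] by blast
  have x0: "x0 \<in> D" "x1 \<in> D" using Invert_Dom assms(3) by blast+
  have y0: "y \<in> set_pmf (Eval F pk False x0)" using assms by (auto elim: Invert_Eval)
  obtain x1' where x1': "(x0, x1') \<in> M" using M(1) x0 unfolding perfect_matching_def by blast
  then have D': "x1' \<in> D" using M(1) by (auto simp: perfect_matching_def)
  then have "y \<in> set_pmf (Eval F pk True x1')" using M(2) x0 x1' y0 by metis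
  then have "x1 = x1'" using D' assms(3) by (auto elim: Invert_Eval)
  then show "Eval F pk False x0 = Eval F pk True x1" "x0 \<noteq> x1"
    using M x0 x1' D' by (auto simp: perfect_matching_def irrefl_def)
qed

lemma Check: "x \<in> D \<Longrightarrow> Check F pk b x y \<longleftrightarrow> y \<in> set_pmf (Eval F pk b x)"
  using conjunct2[OF conjunct2[OF complete]] by blast

lemma range_superposition_append:
  assumes "length x = w" "length y = R"
  shows "range_superposition F n pk b (x @ y @ g) =
    (if x \<in> D \<and> y \<in> Rng F pk \<and> g = replicate G False
     then complex_of_real (sqrt (pmf (Eval F pk b x) y) / sqrt (card D)) else 0)"
  using assms by (simp add: range_superposition_def)

lemma norm_range_superposition:
  "(\<Sum>z\<in>bitstrings (w + R + G). (cmod (range_superposition F n pk b z))\<^sup>2) = 1"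
proof -
  let ?B = bitstrings
  have sub: "D \<subseteq> ?B w" using Dom_finite(3) by (auto simp: mem_bitstrings)
  have "(\<Sum>z\<in>?B (w + R + G). (cmod (range_superposition F n pk b z))\<^sup>2) =
    (\<Sum>x\<in>?B w. \<Sum>y\<in>?B R. \<Sum>g\<in>?B G.
       if g = replicate G False then (if x \<in> D then if y \<in> Rng F pk then pmf (Eval F pk b x) y / card D else 0 else 0) else 0)"
    unfolding sum_bitstrings_append add.assoc
    by (intro sum.cong refl) (auto simp: mem_bitstrings range_superposition_append power_divide norm_divide)
  also have "\<dots> = (\<Sum>x\<in>?B w. if x \<in> D then (\<Sum>y\<in>?B R. if y \<in> Rng F pk then pmf (Eval F pk b x) y / card D else 0) else 0)"
    by (intro sum.cong refl) (simp add: mem_bitstrings)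
  also have "\<dots> = (\<Sum>x\<in>D. \<Sum>y\<in>Rng F pk. pmf (Eval F pk b x) y / card D)"
    using sub Rng(1) by (simp add: sum.If_cases Int_absorb1)
  also have "\<dots> = (\<Sum>x\<in>D. 1 / card D)"
    using Rng finite_subset[OF Rng(1)] by (intro sum.cong refl) (simp add: sum_pmf_eq_1 flip: sum_divide_distrib)
  also have "\<dots> = 1" using Dom_finite by simp
  finally show ?thesis .
qed

definition hit :: "bits \<Rightarrow> bool" where
  "hit y \<longleftrightarrow> (\<exists>b. \<exists>x\<in>D. y \<in> set_pmf (Eval F pk b x))"

text \<open>The member of the claw of y that belongs to a. The all-zero default outside the image
  keeps the length equal to w for every y.\<close>

definition pre :: "bits \<Rightarrow> bool \<Rightarrow> bits" where
  "pre y a = (if hit y then (if a then snd else fst) (the (Invert F sk y)) else replicate w False)"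

text \<open>The probability of y in an ideal weak commitment. One preimage suffices: each bit has
  exactly one, and the two members of a claw have equal densities.\<close>

definition weight :: "bits \<Rightarrow> real" where
  "weight y = (if hit y then pmf (Eval F pk False (pre y False)) y / card D else 0)"

lemma hit:
  assumes "hit y"
  shows "Invert F sk y = Some (pre y False, pre y True)" "pre y a \<in> D" "pre y False \<noteq> pre y True"
    "Eval F pk a (pre y a) = Eval F pk False (pre y False)" "y \<in> set_pmf (Eval F pk a (pre y a))"
    "x \<in> D \<Longrightarrow> y \<in> set_pmf (Eval F pk a x) \<Longrightarrow> x = pre y a"
proof -
  obtain b x' where x': "x' \<in> D" "y \<in> set_pmf (Eval F pk b x')" using assms by (auto simp: hit_def)
  obtain x0 x1 where inv: "Invert F sk y = Some (x0, x1)"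
    and y: "y \<in> set_pmf (Eval F pk False x0)" "y \<in> set_pmf (Eval F pk True x1)"
    using Invert_Eval[OF x'] by metis
  then have pre: "pre y False = x0" "pre y True = x1" using assms by (auto simp: pre_def)
  show "Invert F sk y = Some (pre y False, pre y True)" using inv pre by simp
  show "pre y a \<in> D" using Invert_Dom[OF inv] pre by (cases a) auto
  show "pre y False \<noteq> pre y True" using claw(2)[OF x' inv] pre by simp
  show "Eval F pk a (pre y a) = Eval F pk False (pre y False)" using claw(1)[OF x' inv] pre by (cases a) auto
  show "y \<in> set_pmf (Eval F pk a (pre y a))" using y pre by (cases a) auto
  show "x = pre y a" if x: "x \<in> D" "y \<in> set_pmf (Eval F pk a x)"
  proof -
    obtain x0' x1' where "Invert F sk y = Some (x0', x1')" "(if a then x1' else x0') = x"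
      using Invert_Eval[OF x] by metis
    then show ?thesis using inv pre by (cases a) auto
  qed
qed

lemma length_pre: "length (pre y a) = w"
  using hit(2) Dom_finite(3) by (cases "hit y") (auto simp: pre_def)

text \<open>For fixed y and a only one x survives, with an amplitude that does not depend on a. Thus
  y reveals nothing about the committed bit and the superposition stays coherent.\<close>

lemma range_superposition_pre:
  assumes "length x = w" "length y = R"
  shows "range_superposition F n pk a (x @ y @ g) =
    (if x = pre y a \<and> g = replicate G False then complex_of_real (sqrt (weight y)) else 0)"
proof (cases "hit y")
  case True
  then have yR: "y \<in> Rng F pk" using Rng(2) by (auto simp: hit_def)
  have "pmf (Eval F pk a x) y = 0" if "x \<in> D" "x \<noteq> pre y a"
    using hit(6)[OF True that(1)] that(2) by (auto simp: set_pmf_iff)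
  then show ?thesis
    using assms hit(2)[OF True] yR True
    by (auto simp: range_superposition_append weight_def real_sqrt_divide hit(4)[OF True, of a])
next
  case False
  then have "pmf (Eval F pk a x) y = 0" if "x \<in> D"
    using that by (auto simp: hit_def set_pmf_iff)
  then show ?thesis using assms False by (auto simp: range_superposition_append weight_def)
qed

lemma weight_nonneg: "0 \<le> weight y"
  by (simp add: weight_def)

text \<open>The weights add up to the squared norm of the ideal superposition for the bit
  \<open>False\<close>, which is known to be 1.\<close>

lemma sum_weight: "(\<Sum>y\<in>bitstrings R. weight y) = 1"
proof -
  let ?B = bitstrings
  have "(\<Sum>y\<in>?B R. weight y) = (\<Sum>y\<in>?B R. \<Sum>x\<in>?B w. if x = pre y False then
       (\<Sum>g\<in>?B G. if g = replicate G False then weight y else 0) else 0)"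
    using length_pre by (simp add: mem_bitstrings)
  also have "\<dots> = (\<Sum>y\<in>?B R. \<Sum>x\<in>?B w. \<Sum>g\<in>?B G. (cmod (range_superposition F n pk False (x @ y @ g)))\<^sup>2)"
  proof (intro sum.cong refl)
    fix y x assume yx: "y \<in> ?B R" "x \<in> ?B w"
    have "(cmod (range_superposition F n pk False (x @ y @ g)))\<^sup>2 =
      (if x = pre y False then (if g = replicate G False then weight y else 0) else 0)" for g
      using yx weight_nonneg[of y] by (simp add: range_superposition_pre mem_bitstrings)
    then show "(if x = pre y False then (\<Sum>g\<in>?B G. if g = replicate G False then weight y else 0) else 0) =
      (\<Sum>g\<in>?B G. (cmod (range_superposition F n pk False (x @ y @ g)))\<^sup>2)"
      by simp
  qed
  also have "\<dots> = (\<Sum>x\<in>?B w. \<Sum>y\<in>?B R. \<Sum>g\<in>?B G. (cmod (range_superposition F n pk False (x @ y @ g)))\<^sup>2)"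
    by (rule sum.swap)
  also have "\<dots> = 1" using norm_range_superposition[of False] by (simp add: sum_bitstrings_append add.assoc)
  finally show ?thesis .
qed

text \<open>The input a yields the single string \<open>a # pre y a\<close>, which passes
  \<open>Check\<close> and decodes to a; there is no error in this basis.\<close>

lemma decode_standard_error:
  assumes "length y = R" "weight y \<noteq> 0"
  shows "(\<Sum>z\<in>{z \<in> bitstrings (Suc w). weak_decode F n False pk sk y z = x}.
      basis_amp False (a # pre y a) z * basis_amp False (b # pre y b) z) = ideal False x [a] [b] [] []"
proof -
  have hity: "hit y" using assms(2) by (auto simp: weight_def split: if_splits)
  have dec: "weak_decode F n False pk sk y (a # pre y a) = Some a"
    using hit(2,5)[OF hity, of a] by (simp add: weak_decode_def Check)
  have "(\<Sum>z\<in>{z \<in> bitstrings (Suc w). weak_decode F n False pk sk y z = x}.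
      basis_amp False (a # pre y a) z * basis_amp False (b # pre y b) z) =
    (\<Sum>z\<in>{z \<in> bitstrings (Suc w). weak_decode F n False pk sk y z = x}. if z = a # pre y a then of_bool (a = b) else 0)"
    by (intro sum.cong refl) (auto simp: basis_amp_def)
  also have "\<dots> = of_bool (Some a = x \<and> a = b)"
    using dec length_pre by (subst sum.delta, simp) (auto simp: mem_bitstrings)
  also have "\<dots> = ideal False x [a] [b] [] []"
    by (auto simp: ideal_def meas_kernel_eq basis_amp_def split: option.split)
  finally show ?thesis .
qed

text \<open>Half of the \<open>2 ^ Suc w\<close> strings decode to a given bit, all with the same
  sign and magnitude \<open>1 / 2 ^ Suc w\<close>. Without bad strings they would add up to plus or
  minus 1/2, the ideal entry, so the error is at most the share of bad strings.\<close>

lemma decode_hadamard_error: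
  assumes y: "length y = R" "weight y \<noteq> 0"
    and good: "\<And>x0 x1. \<lbrakk>x0 \<in> D; x1 \<in> D; x0 \<noteq> x1\<rbrakk> \<Longrightarrow> real (card (good_set F n x0 x1)) / 2 ^ (w + 1) \<ge> 1 - \<nu>"
  shows "cmod ((\<Sum>z\<in>{z \<in> bitstrings (Suc w). weak_decode F n True pk sk y z = x}.
      basis_amp True (a # pre y a) z * basis_amp True (b # pre y b) z) - ideal True x [a] [b] [] []) \<le> \<nu>"
proof -
  have hity: "hit y" using y by (auto simp: weight_def split: if_splits)
  let ?x0 = "pre y False" let ?x1 = "pre y True" let ?B = "bitstrings (Suc w)"
  define A where "A = good_set F n ?x0 ?x1"
  have A: "A \<subseteq> ?B" by (auto simp: A_def good_set_def)
  then have finA: "finite A" by (rule finite_subset) simp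
  define bad where "bad = real (card (?B - A)) / 2 ^ Suc w"
  have bad: "bad \<le> \<nu>"
  proof -
    have "card A \<le> card ?B" using A by (intro card_mono) auto
    then have "real (card (?B - A)) = 2 ^ Suc w - real (card A)"
      using A finA by (simp add: card_Diff_subset card_bitstrings of_nat_diff)
    then have "bad = 1 - real (card A) / 2 ^ Suc w" by (simp add: bad_def diff_divide_distrib)
    then show ?thesis using good[of ?x0 ?x1] hit(2,3)[OF hity] by (simp add: A_def)
  qed
  let ?s = "\<lambda>m. if a \<noteq> b \<and> m then -1 else 1 :: complex"
  have dec: "weak_decode F n True pk sk y z = (if z \<in> A then Some (claw_bit z ?x0 ?x1) else None)" for z
    by (simp add: weak_decode_def hit(1)[OF hity] A_def)
  have amp: "basis_amp True (a # pre y a) z * basis_amp True (b # pre y b) z = ?s (claw_bit z ?x0 ?x1) / 2 ^ Suc w"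
    if "z \<in> ?B" for z
    unfolding basis_amp_def using that hadamard_claw[of z w "pre y" a b] by (simp add: mem_bitstrings length_pre)
  show ?thesis
  proof (cases x)
    \<comment> \<open>Rejection happens exactly on the bad strings, and its ideal effect is
      zero.\<close>
    case None
    then have set: "{z \<in> ?B. weak_decode F n True pk sk y z = x} = ?B - A" by (auto simp: dec)
    have "cmod (\<Sum>z\<in>?B - A. basis_amp True (a # pre y a) z * basis_amp True (b # pre y b) z) \<le> (\<Sum>z\<in>?B - A. 1 / 2 ^ Suc w)"
      by (rule sum_norm_le) (auto simp: amp norm_divide norm_power norm_mult)
    also have "\<dots> = bad" by (simp add: bad_def)
    finally show ?thesis unfolding set using bad None by (simp add: ideal_def)
  next
    case (Some m)
    let ?Z = "{z \<in> ?B. claw_bit z ?x0 ?x1 = m}"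
    have set: "{z \<in> ?B. weak_decode F n True pk sk y z = x} = ?Z \<inter> A" by (auto simp: dec Some)
    have cardZ: "card ?Z = 2 ^ w" by (rule card_claw_bit) (simp_all add: length_pre)
    have "(\<Sum>z\<in>?Z \<inter> A. basis_amp True (a # pre y a) z * basis_amp True (b # pre y b) z) = (\<Sum>z\<in>?Z \<inter> A. ?s m / 2 ^ Suc w)"
      by (intro sum.cong refl) (auto simp: amp)
    also have "\<dots> = ?s m * (of_nat (card (?Z \<inter> A)) / 2 ^ Suc w)" by simp
    \<comment> \<open>Counting the missing strings separates the ideal value from the error, which
      concerns only bad strings that decode to m.\<close>
    also have "card (?Z \<inter> A) = 2 ^ w - card (?Z - A)"
      using card_Int_Diff[of ?Z A] cardZ by simp
    also have "of_nat (2 ^ w - card (?Z - A)) = (2 ^ w - of_nat (card (?Z - A)) :: complex)"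
      using card_mono[of ?Z "?Z - A"] cardZ by (subst of_nat_diff) auto
    finally have sum: "(\<Sum>z\<in>?Z \<inter> A. basis_amp True (a # pre y a) z * basis_amp True (b # pre y b) z) =
       ?s m / 2 - ?s m * (of_nat (card (?Z - A)) / 2 ^ Suc w)"
      by (simp add: diff_divide_distrib)
    have ideal: "ideal True x [a] [b] [] [] = ?s m / 2"
      using of_real_sqrt2_squared by (cases a; cases b) (auto simp: Some ideal_def meas_kernel_eq basis_amp_def hadamard_1)
    have "cmod (?s m * (of_nat (card (?Z - A)) / 2 ^ Suc w)) = real (card (?Z - A)) / 2 ^ Suc w"
      by (simp add: norm_mult norm_divide norm_power)
    also have "\<dots> \<le> bad"
      unfolding bad_def by (intro divide_right_mono) (auto intro!: card_mono)
    finally have "cmod (?s m * (of_nat (card (?Z - A)) / 2 ^ Suc w)) \<le> \<nu>" using bad by simp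
    then show ?thesis unfolding set sum ideal by simp
  qed
qed

text \<open>The circuit is first replaced by the ideal superposition, at cost 4 * 2 times
  \<open>\<nu>1\<close>, then the opened ideal state by the ideal measurement, at cost 4 * 3 times
  \<open>\<nu>2\<close>.\<close>

lemma close_weak_commitment:
  assumes dist: "\<And>b. prep_error F n pk b \<le> \<nu>1"
    and good: "\<And>x0 x1. \<lbrakk>x0 \<in> D; x1 \<in> D; x0 \<noteq> x1\<rbrakk> \<Longrightarrow> real (card (good_set F n x0 x1)) / 2 ^ (w + 1) \<ge> 1 - \<nu>2"
    and "0 \<le> \<nu>2" and wf: "\<And>b g. g \<in> set (Prep F pk b) \<Longrightarrow> wf_gate (prep_qubits F n pk) g"
  shows "close 1 (weak_measurement F n c pk sk) (ideal c) (8 * \<nu>1 + 12 * \<nu>2)"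
proof -
  let ?C = "bitstrings R \<times> bitstrings (Suc w)" let ?dec = "\<lambda>(y, z). weak_decode F n c pk sk y z"
  have "close (Suc 0) (coarse ?C ?dec (opened_kernel w G (real_prep F n pk) c))
      (coarse ?C ?dec (opened_kernel w G (range_superposition F n pk) c)) (4 * (2 * \<nu>1))"
    by (rule close_opened_kernel)
       (use dist wf norm_run_circuit norm_range_superposition in \<open>simp_all add: real_prep_def prep_qubits_def\<close>)
  moreover have "close (Suc 0) (coarse ?C ?dec (opened_kernel w G (range_superposition F n pk) c)) (ideal c) (4 * (3 * \<nu>2))"
  proof (rule close_opened_ideal[where X = pre and q = weight])
    fix y x a b assume y: "length y = R" "weight y \<noteq> 0"
    show "cmod ((\<Sum>z\<in>{z \<in> bitstrings (Suc w). ?dec (y, z) = x}. basis_amp c (a # pre y a) z * basis_amp c (b # pre y b) z)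
        - ideal c x [a] [b] [] []) \<le> \<nu>2"
      using decode_standard_error[OF y, where x = x and a = a and b = b]
        decode_hadamard_error[OF y good, where x = x and a = a and b = b] \<open>0 \<le> \<nu>2\<close>
      by (cases c) simp_all
  qed (use weight_nonneg sum_weight length_pre range_superposition_pre in simp_all)
  ultimately show ?thesis using close_trans by fastforce
qed

end

section \<open>Lists of outcomes\<close>

lemma listset_iff: "xs \<in> listset As \<longleftrightarrow> length xs = length As \<and> (\<forall>i<length As. xs ! i \<in> As ! i)"
proof (induction As arbitrary: xs)
  case (Cons A As)
  show ?case
  proof (cases xs)
    case (Cons x ys)
    then show ?thesis using Cons.IH[of ys] by (auto simp: set_Cons_def nth_Cons' less_Suc_eq_0_disj)
  qed (auto simp: set_Cons_def)
qed auto

lemma finite_listset: "(\<And>A. A \<in> set As \<Longrightarrow> finite A) \<Longrightarrow> finite (listset As)"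
  by (induction As) (simp, simp only: listset_Cons, auto)

lemma listset_const: "xs \<in> listset (map (\<lambda>_. A) as) \<longleftrightarrow> length xs = length as \<and> set xs \<subseteq> A"
  unfolding listset_iff subset_eq all_set_conv_all_nth by auto

text \<open>The protocol commits to all positions before opening any, giving a pair of lists; the
  analysis by position works with a list of pairs.\<close>

lemma bij_betw_unzip_listset:
  "bij_betw (\<lambda>xs. (map fst xs, map snd xs)) (listset (map (\<lambda>a. A a \<times> B a) as))
     (listset (map A as) \<times> listset (map B as))"
  by (rule bij_betwI[where g = "\<lambda>(ys, zs). zip ys zs"]) (auto simp: listset_iff zip_map_fst_snd mem_Times_iff)

lemma blocks_concat:
  "\<lbrakk>length zs = k; \<And>z. z \<in> set zs \<Longrightarrow> length z = m\<rbrakk> \<Longrightarrow> blocks (replicate k m) (concat zs) = zs"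
  by (induction zs arbitrary: k) auto

lemma length_blocks: "length (blocks ks z) = length ks"
  by (induction ks arbitrary: z) auto

lemma length_in_blocks:
  "length z = k * m \<Longrightarrow> b \<in> set (blocks (replicate k m) z) \<Longrightarrow> length b = m"
proof (induction k arbitrary: z)
  case (Suc k)
  then show ?case using Suc.IH[of "drop m z"] by auto
qed simp

lemma concat_blocks: "length z = k * m \<Longrightarrow> concat (blocks (replicate k m) z) = z"
  by (induction k arbitrary: z) auto

lemma length_concat_const: "(\<And>z. z \<in> set zs \<Longrightarrow> length z = m) \<Longrightarrow> length (concat zs) = length zs * m"
  by (induction zs) auto

lemma sum_group_filter:
  assumes "finite M" "finite S" "g ` M \<subseteq> S"
  shows "(\<Sum>y\<in>{y \<in> S. P y}. \<Sum>x\<in>{x \<in> M. g x = y}. f x) = (\<Sum>x\<in>{x \<in> M. P (g x)}. f x)"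
proof -
  have "(\<Sum>y\<in>{y \<in> S. P y}. \<Sum>x\<in>{x \<in> M. g x = y}. f x) =
      (\<Sum>y\<in>{y \<in> S. P y}. \<Sum>x\<in>{x \<in> {x \<in> M. P (g x)}. g x = y}. f x)"
    by (intro sum.cong) auto
  also have "\<dots> = (\<Sum>x\<in>{x \<in> M. P (g x)}. f x)"
    by (rule sum.group) (use assms in auto)
  finally show ?thesis .
qed

lemma pmf_map_outcome:
  assumes "finite C" "\<And>c. c \<in> C \<Longrightarrow> psd N (\<Phi> c)" "(\<Sum>c\<in>C. qtrace (\<Phi> c)) = 1"
  shows "pmf (map_pmf f (outcome C \<Phi>)) x = (\<Sum>c\<in>{c \<in> C. f c = x}. Re (qtrace (\<Phi> c)))"
proof -
  note out = pmf_outcome[of C N \<Phi>, OF assms]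
  have sub: "set_pmf (outcome C \<Phi>) \<subseteq> C" using out by (auto simp: set_pmf_iff split: if_splits)
  have "pmf (map_pmf f (outcome C \<Phi>)) x = measure_pmf.prob (outcome C \<Phi>) (f -` {x})"
    by (simp add: pmf_map)
  also have "\<dots> = measure_pmf.prob (outcome C \<Phi>) {c \<in> C. f c = x}"
    using sub by (intro measure_pmf.finite_measure_eq_AE) (auto simp: AE_measure_pmf_iff)
  also have "\<dots> = (\<Sum>c\<in>{c \<in> C. f c = x}. pmf (outcome C \<Phi>) c)"
    using assms(1) by (intro measure_measure_pmf_finite) auto
  also have "\<dots> = (\<Sum>c\<in>{c \<in> C. f c = x}. Re (qtrace (\<Phi> c)))"
    by (intro sum.cong) (auto simp: out)
  finally show ?thesis .
qed

section \<open>A single position\<close>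

definition commit_kernel :: "ntcf_algorithms \<Rightarrow> nat \<Rightarrow> bits list \<Rightarrow> bits list \<Rightarrow> kernel" where
  "commit_kernel F n pk y = kcomp (Suc (width F n))
     (kcomp (Suc (width F n)) (tens 1 (Suc (width F n)) (map2 (weak_kernel F n) (tl pk) (tl y))) (kraus hadamard))
     (weak_kernel F n (hd pk) (hd y))"

text \<open>\<open>Open1\<close> measures in the standard basis for basis bit 1 and in the Hadamard
  basis for 0, opposite to \<open>meas_kernel\<close>, hence the negation.\<close>

definition position_kernel :: "ntcf_algorithms \<Rightarrow> nat \<Rightarrow> bits list \<Rightarrow> bool \<Rightarrow> bits list \<times> bits \<Rightarrow> kernel" where
  "position_kernel F n pk b = (\<lambda>(y, z). kcomp (Suc (width F n) * Suc (width F n)) (meas_kernel (\<not> b) z) (commit_kernel F n pk y))"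

definition position_outcomes :: "ntcf_algorithms \<Rightarrow> nat \<Rightarrow> bits list \<Rightarrow> (bits list \<times> bits) set" where
  "position_outcomes F n pk = listset (map (\<lambda>_. bitstrings (range_len F n)) pk) \<times> bitstrings (Suc (width F n) * Suc (width F n))"

definition position_decode :: "ntcf_algorithms \<Rightarrow> nat \<Rightarrow> bits list \<Rightarrow> bits list \<Rightarrow> bool \<Rightarrow> bits list \<times> bits \<Rightarrow> bool option" where
  "position_decode F n pk sk b = (\<lambda>(y, z). if Ver1 F n pk sk y b z then Some (Out1 F n sk y b z) else None)"

text \<open>The decoded inner bits play the role of the measured register of the outer commitment;
  one inner rejection rejects the position.\<close>

definition outer_decode :: "ntcf_algorithms \<Rightarrow> nat \<Rightarrow> bool \<Rightarrow> bits \<times> bits \<Rightarrow> bits \<Rightarrow> bool option list \<Rightarrow> bool option" where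
  "outer_decode F n b k y xs = (if None \<in> set xs then None else weak_decode F n b (fst k) (snd k) y (map the xs))"

text \<open>For b = 1 the inner checks certify the bits \<open>hd\<close>, which form the string d
  for the outer claw. For b = 0 the inner claws yield the bits, which the outer check reads as a
  committed bit followed by its preimage.\<close>

lemma position_decode_eq:
  assumes len: "length ks = Suc (width F n)" "length xs = Suc (width F n)"
    and xs: "\<And>x. x \<in> set xs \<Longrightarrow> length (snd x) = Suc (width F n)"
  shows "position_decode F n (map fst (k # ks)) (map snd (k # ks)) b (y # map fst xs, concat (map snd xs)) =
    outer_decode F n b k y (map2 (\<lambda>k (y, z). weak_decode F n (\<not> b) (fst k) (snd k) y z) ks xs)"
proof -
  let ?w = "width F n"
  have Z: "opening_blocks F n (concat (map snd xs)) = map snd xs"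
    unfolding opening_blocks_def using len xs by (intro blocks_concat) auto
  define os where "os = map2 (\<lambda>k (y, z). weak_decode F n (\<not> b) (fst k) (snd k) y z) ks xs"
  have os: "length os = Suc ?w" "\<And>i. i < Suc ?w \<Longrightarrow> os ! i =
      weak_decode F n (\<not> b) (fst (ks ! i)) (snd (ks ! i)) (fst (xs ! i)) (snd (xs ! i))"
    using len by (auto simp: os_def split_def)
  have None: "None \<in> set os \<longleftrightarrow> (\<exists>i<Suc ?w. os ! i = None)"
    by (metis os(1) in_set_conv_nth)
  have nth: "\<And>i. i < Suc ?w \<Longrightarrow> map fst xs ! i = fst (xs ! i)" "\<And>i. i < Suc ?w \<Longrightarrow> map snd xs ! i = snd (xs ! i)"
    "\<And>i. i < Suc ?w \<Longrightarrow> map fst ks ! i = fst (ks ! i)" "\<And>i. i < Suc ?w \<Longrightarrow> map snd ks ! i = snd (ks ! i)"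
    using len by auto
  show ?thesis
  proof (cases b)
    case True
    let ?chk = "\<forall>i<Suc ?w. Check F (fst (ks ! i)) (hd (snd (xs ! i))) (tl (snd (xs ! i))) (fst (xs ! i))"
    have check: "(\<exists>i<Suc ?w. os ! i = None) \<longleftrightarrow> \<not> (?chk)"
      using os(2) True by (auto simp: weak_decode_def)
    have "map the os = map hd (map snd xs)" if "?chk"
      using that os len True by (intro nth_equalityI) (auto simp: weak_decode_def)
    then show ?thesis
      unfolding os_def[symmetric] outer_decode_def None check position_decode_def
      using True by (auto simp: Ver1_def Out1_def Let_def Z weak_decode_def nth split: option.split)
  next
    case False
    let ?bit = "decoded_bit F (map snd (k # ks)) (y # map fst xs) (map snd xs)"
    let ?inv = "\<forall>i<Suc ?w. case Invert F (snd (ks ! i)) (fst (xs ! i)) of None \<Rightarrow> False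
          | Some (x0, x1) \<Rightarrow> snd (xs ! i) \<in> good_set F n x0 x1"
    have inv: "(\<exists>i<Suc ?w. os ! i = None) \<longleftrightarrow> \<not> ?inv"
      using os(2) False by (fastforce simp: weak_decode_def split: option.splits prod.splits if_splits)
    have bits: "map the os = map ?bit [0..<Suc ?w]" if "\<forall>i<Suc ?w. os ! i \<noteq> None"
    proof (rule nth_equalityI)
      fix i assume "i < length (map the os)"
      then have i: "i < Suc ?w" by (simp add: os)
      then have "os ! i \<noteq> None" using that by blast
      then show "map the os ! i = map ?bit [0..<Suc ?w] ! i"
        using i os False by (auto simp: decoded_bit_def weak_decode_def nth split: option.splits if_splits simp del: upt_Suc)
    qed (simp add: os)
    \<comment> \<open>The decoded bit with index 0 is the committed bit and the remaining w bits are
      the preimage, matching \<open>hd\<close> and \<open>tl\<close> in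
      \<open>weak_decode\<close>.\<close>
    have upt: "map ?bit [0..<Suc ?w] = ?bit 0 # map ?bit [1..<Suc ?w]"
      by (simp add: upt_conv_Cons del: upt_Suc)
    have ver: "Ver1 F n (map fst (k # ks)) (map snd (k # ks)) (y # map fst xs) b (concat (map snd xs)) \<longleftrightarrow>
        \<not> (\<exists>i<Suc ?w. os ! i = None) \<and> Check F (fst k) (?bit 0) (map ?bit [1..<Suc ?w]) y"
    proof -
      have "(\<forall>i<Suc ?w. case Invert F (map snd (k # ks) ! (i + 1)) ((y # map fst xs) ! (i + 1)) of None \<Rightarrow> False
          | Some (x0, x1) \<Rightarrow> map snd xs ! i \<in> good_set F n x0 x1) \<longleftrightarrow>
        ?inv"
        by (intro all_cong) (simp add: nth split: option.split)
      then show ?thesis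
        unfolding inv using False by (simp add: Ver1_def Let_def Z del: upt_Suc)
    qed
    have out: "Out1 F n (map snd (k # ks)) (y # map fst xs) b (concat (map snd xs)) = ?bit 0"
      using False by (simp add: Out1_def Let_def Z)
    show ?thesis
    proof (cases "\<exists>i<Suc ?w. os ! i = None")
      case True
      then show ?thesis
        unfolding os_def[symmetric] outer_decode_def None position_decode_def prod.case ver by (simp only: if_True simp_thms if_False)
    next
      case N: False
      then have "map the os = ?bit 0 # map ?bit [1..<Suc ?w]" using bits upt by simp
      then show ?thesis
        unfolding os_def[symmetric] outer_decode_def None position_decode_def prod.case ver out
        using False N by (simp add: weak_decode_def del: upt_Suc)
    qed
  qed
qed

text \<open>The interface between the analysis of a single weak commitment and that of the scheme.
  Closeness is asked for both bases because outer and inner commitments are opened in opposite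
  ones.\<close>

locale scheme_bound =
  fixes F :: ntcf_algorithms and n :: nat and \<delta> :: real
  assumes wf: "\<And>pk b g. \<lbrakk>pk \<in> pks F n; g \<in> set (Prep F pk b)\<rbrakk> \<Longrightarrow> wf_gate (prep_qubits F n pk) g"
    and weak: "\<And>pk sk c. (pk, sk) \<in> set_pmf (GenF F n) \<Longrightarrow>
      close 1 (weak_measurement F n c pk sk) (ideal c) \<delta>"
begin

abbreviation "w \<equiv> width F n"
abbreviation "R \<equiv> range_len F n"

lemma implements_weak: "pk \<in> pks F n \<Longrightarrow> implements (weak_commit F n pk) (bitstrings R) 1 (Suc w) (weak_kernel F n pk)"
  using wf by (rule implements_weak_commit)

lemma implements_Commit1:
  assumes "length pk = Suc (Suc w)" "set pk \<subseteq> pks F n"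
  shows "implements (Commit1 F n pk) (listset (map (\<lambda>_. bitstrings R) pk)) 1 (Suc w * Suc w) (commit_kernel F n pk)"
proof -
  let ?B = bitstrings
  obtain p0 ps where pk: "pk = p0 # ps" "length ps = Suc w" using assms(1) by (metis length_Suc_conv)
  have 1: "implements (weak_commit F n p0) (?B R) 1 (Suc w) (weak_kernel F n p0)"
    using assms pk by (intro implements_weak) auto
  have "implements (in_sequence (weak_commit F n) (Suc w) ps) (listset (map (\<lambda>_. ?B R) ps)) (1 * length ps) (Suc w * length ps)
     (\<lambda>ys. tens 1 (Suc w) (map2 (weak_kernel F n) ps ys))"
    using assms pk by (intro implements_in_sequence implements_weak) auto
  then have 2: "implements (in_sequence (weak_commit F n) (Suc w) ps) (listset (map (\<lambda>_. ?B R) ps)) (Suc w) (Suc w * Suc w)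
     (\<lambda>ys. tens 1 (Suc w) (map2 (weak_kernel F n) ps ys))"
    by (simp only: pk(2) mult_1)
  have "implements (\<lambda>p \<rho>. bind_pmf (weak_commit F n p0 p \<rho>) (\<lambda>(c, \<rho>').
      bind_pmf (in_sequence (weak_commit F n) (Suc w) ps p (hadamard_block p (Suc w) \<rho>')) (\<lambda>(d, \<rho>''). return_pmf (c # d, \<rho>''))))
     ((\<lambda>(c, d). c # d) ` (?B R \<times> listset (map (\<lambda>_. ?B R) ps))) 1 (Suc w * Suc w) (commit_kernel F n pk)"
    by (rule implements_kcomp[OF 1 implements_after_hadamard[OF 2]])
       (auto simp: commit_kernel_def pk inj_on_Cons)
  moreover have "Commit1 F n pk = (\<lambda>p \<rho>. bind_pmf (weak_commit F n p0 p \<rho>) (\<lambda>(c, \<rho>').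
      bind_pmf (in_sequence (weak_commit F n) (Suc w) ps p (hadamard_block p (Suc w) \<rho>')) (\<lambda>(d, \<rho>''). return_pmf (c # d, \<rho>''))))"
    by (intro ext) (simp add: Commit1_def pk)
  ultimately show ?thesis by (simp only: pk list.map listset_Cons)
qed

lemma implements_Open1: "implements (Open1 F n b) (bitstrings (Suc w * Suc w)) (Suc w * Suc w) 0 (meas_kernel (\<not> b))"
proof -
  have "Open1 F n b = (\<lambda>p \<rho>. measure_block p (Suc w * Suc w) (if \<not> b then hadamard_block p (Suc w * Suc w) \<rho> else \<rho>))"
    by (intro ext) (simp add: Open1_def Let_def power2_eq_square)
  then show ?thesis using implements_measure[of "Suc w * Suc w" "\<not> b"] by simp
qed

lemma instrument_position:
  assumes "length pk = Suc (Suc w)" "set pk \<subseteq> pks F n"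
  shows "instrument (position_outcomes F n pk) 1 0 (position_kernel F n pk b)"
proof -
  have "instrument ((\<lambda>(c, d). Pair c d) ` (listset (map (\<lambda>_. bitstrings R) pk) \<times> bitstrings (Suc w * Suc w))) 1 0 (position_kernel F n pk b)"
    by (rule instrument_kcomp[OF _ instrument_meas])
       (use implements_Commit1[OF assms] in \<open>auto simp: implements_def position_kernel_def inj_on_def\<close>)
  then show ?thesis by (simp add: position_outcomes_def)
qed

text \<open>By the interchange law each inner commitment meets its own part of the opening and forms
  an \<open>opened_kernel\<close> on one qubit. The outer commitment and the Hadamard layer are
  absorbed into the operator on which these act.\<close>

lemma val_position:
  assumes "length pk = Suc w" "length xs = Suc w" "\<And>x. x \<in> set xs \<Longrightarrow> length (snd x) = Suc w"
  shows "val 1 (position_kernel F n (p0 # pk) b (y # map fst xs, concat (map snd xs))) \<rho> =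
    val (Suc w) (tens 1 0 (map2 (\<lambda>p. opened_kernel w (anc F p) (real_prep F n p) (\<not> b)) pk xs))
      (sop 0 (Suc w) (Suc w) 0 (kraus hadamard) (sop 0 1 (Suc w) 0 (weak_kernel F n p0 y) \<rho>))"
    (is "_ = val _ _ ?X")
proof -
  let ?m = "Suc w"
  let ?W = "map2 (weak_kernel F n) pk (map fst xs)"
  have "val 1 (position_kernel F n (p0 # pk) b (y # map fst xs, concat (map snd xs))) \<rho> =
    val ?m (kcomp (?m * ?m) (meas_kernel (\<not> b) (concat (map snd xs))) (tens 1 ?m ?W)) ?X"
    by (simp only: position_kernel_def commit_kernel_def prod.case list.sel val_sop[symmetric] sop_sop[symmetric])
  also have "\<dots> = val ?m (kcomp (?m * ?m) (tens ?m 0 (map (meas_kernel (\<not> b)) (map snd xs))) (tens 1 ?m ?W)) ?X"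
  proof (rule val_cong)
    fix u v :: bits
    have "meas_kernel (\<not> b) (concat (map snd xs)) a a' [] [] = tens ?m 0 (map (meas_kernel (\<not> b)) (map snd xs)) a a' [] []"
      if "length a = ?m * ?m" "length a' = ?m * ?m" for a a'
      by (rule meas_kernel_concat) (use assms that in auto)
    then show "kcomp (?m * ?m) (meas_kernel (\<not> b) (concat (map snd xs))) (tens 1 ?m ?W) u v [] [] =
       kcomp (?m * ?m) (tens ?m 0 (map (meas_kernel (\<not> b)) (map snd xs))) (tens 1 ?m ?W) u v [] []"
      unfolding kcomp_def by (intro sum.cong refl) (simp add: mem_bitstrings)
  qed
  also have "kcomp (?m * ?m) (tens ?m 0 (map (meas_kernel (\<not> b)) (map snd xs))) (tens 1 ?m ?W) =
     tens 1 0 (map2 (kcomp ?m) (map (meas_kernel (\<not> b)) (map snd xs)) ?W)"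
    using kcomp_tens[of "map (meas_kernel (\<not> b)) (map snd xs)" ?W ?m 0 1] assms by simp
  also have "map2 (kcomp ?m) (map (meas_kernel (\<not> b)) (map snd xs)) ?W =
     map2 (\<lambda>p. opened_kernel w (anc F p) (real_prep F n p) (\<not> b)) pk xs"
    using assms by (intro nth_equalityI) (auto simp: opened_kernel_def split_def)
  finally show ?thesis .
qed

text \<open>The scheme lists all commitment strings and then one long opening; the analysis needs
  the outer string together with a list of inner pairs.\<close>

lemma bij_betw_position_outcomes:
  assumes "length ks = Suc w"
  shows "bij_betw (\<lambda>(y, xs). (y # map fst xs, concat (map snd xs)))
    (bitstrings R \<times> listset (map (\<lambda>_. bitstrings R \<times> bitstrings (Suc w)) ks)) (position_outcomes F n (p0 # map fst ks))"
    (is "bij_betw ?f ?A ?B")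
proof (rule bij_betwI[where g = "\<lambda>(y, z). (hd y, zip (tl y) (blocks (replicate (Suc w) (Suc w)) z))"])
  let ?g = "\<lambda>(y, z). (hd y, zip (tl y) (blocks (replicate (Suc w) (Suc w)) z))"
  show "?f \<in> ?A \<rightarrow> ?B"
  proof (intro funcsetI, clarify)
    fix y xs assume y: "y \<in> bitstrings R" and xs: "xs \<in> listset (map (\<lambda>_. bitstrings R \<times> bitstrings (Suc w)) ks)"
    have "y # map fst xs \<in> listset (map (\<lambda>_. bitstrings R) (p0 # map fst ks))"
      using y xs by (subst listset_const) (auto simp: listset_const)
    moreover have "length (concat (map snd xs)) = Suc w * Suc w"
      using xs assms by (subst length_concat_const[of _ "Suc w"]) (auto simp: listset_const mem_bitstrings)
    ultimately show "(y # map fst xs, concat (map snd xs)) \<in> ?B"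
      by (simp add: position_outcomes_def mem_bitstrings)
  qed
  show "?g \<in> ?B \<rightarrow> ?A"
  proof (rule funcsetI)
    fix x assume "x \<in> ?B"
    then obtain y z where x: "x = (y, z)" and yz: "(y, z) \<in> ?B"
      by (cases x) auto
    then have "y \<in> listset (map (\<lambda>_. bitstrings R) (p0 # map fst ks))" and z: "length z = Suc w * Suc w"
      by (simp_all only: position_outcomes_def mem_bitstrings mem_Sigma_iff)
    then have "length y = Suc (length ks)" "set y \<subseteq> bitstrings R"
      by (simp_all only: listset_const length_map list.size add_Suc_right add_0_right)
    then obtain y0 ys where y: "y = y0 # ys" "length ys = length ks" "y0 \<in> bitstrings R" "set ys \<subseteq> bitstrings R"
      by (cases y) auto
    have "length (blocks (replicate (Suc w) (Suc w)) z) = length ks"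
      using assms by (simp only: length_blocks length_replicate)
    moreover have "set (blocks (replicate (Suc w) (Suc w)) z) \<subseteq> bitstrings (Suc w)"
      using length_in_blocks[OF z] by (auto simp only: mem_bitstrings)
    ultimately have "zip ys (blocks (replicate (Suc w) (Suc w)) z) \<in> listset (map (\<lambda>_. bitstrings R \<times> bitstrings (Suc w)) ks)"
      using y unfolding listset_const by (auto dest: set_zip_leftD set_zip_rightD simp del: replicate_Suc)
    then show "(case x of (y, z) \<Rightarrow> (hd y, zip (tl y) (blocks (replicate (Suc w) (Suc w)) z))) \<in> ?A"
      using y by (simp add: x del: replicate_Suc)
  qed
next
  fix x assume "x \<in> ?A"
  then obtain y xs where x: "x = (y, xs)" "length xs = Suc w" "set xs \<subseteq> bitstrings R \<times> bitstrings (Suc w)"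
    using assms by (auto simp: listset_const)
  have "blocks (replicate (Suc w) (Suc w)) (concat (map snd xs)) = map snd xs"
    using x by (intro blocks_concat) (auto simp: mem_bitstrings)
  then show "(case (case x of (y, xs) \<Rightarrow> (y # map fst xs, concat (map snd xs))) of
      (y, z) \<Rightarrow> (hd y, zip (tl y) (blocks (replicate (Suc w) (Suc w)) z))) = x"
    by (simp add: x(1) zip_map_fst_snd del: replicate_Suc)
next
  fix x assume "x \<in> ?B"
  then obtain y z where x: "x = (y, z)" "y \<in> listset (map (\<lambda>_. bitstrings R) (p0 # map fst ks))" "length z = Suc w * Suc w"
    by (auto simp only: position_outcomes_def mem_bitstrings mem_Sigma_iff)
  then have "length y = Suc (Suc w)"
    using assms by (simp only: listset_const length_map list.size add_Suc_right add_0_right)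
  then obtain y0 ys where y: "y = y0 # ys" "length ys = Suc w" by (cases y) auto
  have len: "length (blocks (replicate (Suc w) (Suc w)) z) = Suc w" by (simp only: length_blocks length_replicate)
  show "(case (case x of (y, z) \<Rightarrow> (hd y, zip (tl y) (blocks (replicate (Suc w) (Suc w)) z))) of
      (y, xs) \<Rightarrow> (y # map fst xs, concat (map snd xs))) = x"
    using concat_blocks[OF x(3)] y len by (simp add: x(1) del: replicate_Suc)
qed

text \<open>The factor counts the w + 1 inner commitments and the outer one. The outer string y is
  kept fixed while the inner commitments are exchanged, since the outer decoding depends on it; the
  errors for single y are weighted by traces that sum to the trace of \<open>\<rho>\<close>.\<close>

lemma close_position:
  assumes ks: "length ks = Suc (Suc w)" "set ks \<subseteq> set_pmf (GenF F n)"
  shows "close 1 (coarse (position_outcomes F n (map fst ks)) (position_decode F n (map fst ks) (map snd ks) b)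
      (position_kernel F n (map fst ks) b)) (ideal b) (real (Suc (Suc w)) * \<delta>)"
proof -
  obtain k0 ks' where k: "ks = k0 # ks'" "length ks' = Suc w" using ks(1) by (metis length_Suc_conv)
  let ?m = "Suc w" let ?c = "\<not> b"
  let ?o = "outer_decode F n b k0" let ?do = "weak_decode F n b (fst k0) (snd k0)"
  let ?eo = "opened_kernel w (anc F (fst k0)) (real_prep F n (fst k0)) b"
  let ?PO = "position_outcomes F n (map fst ks)" let ?pk = "position_kernel F n (map fst ks) b"
  let ?pd = "position_decode F n (map fst ks) (map snd ks) b"
  let ?e = "\<lambda>k. opened_kernel w (anc F (fst k)) (real_prep F n (fst k)) ?c"
  let ?dec = "\<lambda>k (y, z). weak_decode F n ?c (fst k) (snd k) y z"
  let ?C = "bitstrings R \<times> bitstrings ?m"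
  let ?E = "\<lambda>k. coarse ?C (?dec k) (?e k)"
  let ?XS = "listset (map (\<lambda>_. ?C) ks')"
  let ?OS = "listset (map (\<lambda>_. UNIV :: bool option set) ks')"
  let ?MS = "listset (map (\<lambda>_. bitstrings 1) ks')"
  let ?pos = "coarse (?PO) (?pd) (?pk)"
  let ?out = "weak_measurement F n b (fst k0) (snd k0)"
  have key: "k \<in> set_pmf (GenF F n)" "fst k \<in> pks F n" if "k \<in> insert k0 (set ks')" for k
    using that ks(2) by (auto simp: k pks_def)
  have finOS: "finite ?OS" and finXS: "finite ?XS" and finMS: "finite ?MS"
    by (auto intro!: finite_listset)
  have instW: "instrument (bitstrings R) 1 ?m (weak_kernel F n (fst k))" if "k \<in> insert k0 (set ks')" for k
    using implements_weak[OF key(2)[OF that]] by (simp add: implements_def)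
  have instE: "instrument UNIV 1 0 (?E k)" if "k \<in> set ks'" for k
  proof (rule instrument_coarse)
    have "instrument ((\<lambda>(c, d). Pair c d) ` (bitstrings R \<times> bitstrings ?m)) 1 0 (?e k)"
      by (rule instrument_kcomp[OF instW instrument_meas]) (use that in \<open>auto simp: opened_kernel_def inj_on_def\<close>)
    then show "instrument ?C 1 0 (?e k)" by simp
  qed
  have "close 1 ?pos ?out (real ?m * \<delta>)"
    unfolding close_def
  proof (intro allI impI)
    fix \<rho> assume \<rho>: "psd 1 \<rho>"
    \<comment> \<open>\<open>Y y\<close> is the unnormalised residual operator of the outer
      commitment for the outcome y, and \<open>X y\<close> the same after the Hadamard
      layer.\<close>
    define Y where "Y y = sop 0 1 ?m 0 (weak_kernel F n (fst k0) y) \<rho>" for y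
    define X where "X y = sop 0 ?m ?m 0 (kraus hadamard) (Y y)" for y
    have psdY: "psd ?m (Y y)" if "y \<in> bitstrings R" for y
      using instrument_psd[OF instW that, of k0 0 0 \<rho>] \<rho> by (simp add: Y_def)
    have psdX: "psd ?m (X y)" and trX: "qtrace (X y) = qtrace (Y y)" if "y \<in> bitstrings R" for y
      using instrument_psd[OF instrument_hadamard, of "()" 0 ?m 0 "Y y"] instrument_qtrace[OF instrument_hadamard, of 0 ?m 0 "Y y"] psdY[OF that]
      by (simp_all add: X_def)
    have trY: "(\<Sum>y\<in>bitstrings R. qtrace (Y y)) = qtrace \<rho>"
      using instrument_qtrace[OF instW, of k0 0 0 \<rho>] \<rho> by (simp add: Y_def)
    let ?V = "\<lambda>y xs. val ?m (tens 1 0 (map2 ?e ks' xs)) (X y)"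
    let ?M = "\<lambda>y ms. val ?m (tens 1 0 (map2 (\<lambda>_. meas_kernel ?c) ks' ms)) (X y)"
    let ?A = "\<lambda>y os. val ?m (tens 1 0 (map2 ?E ks' os)) (X y)"
    let ?B = "\<lambda>y os. val ?m (tens 1 0 (map2 (\<lambda>_. ideal ?c) ks' os)) (X y)"
    \<comment> \<open>The transcripts of the position are grouped by the list \<open>os\<close> of
      decoded inner outcomes, on which the verdict depends besides y.\<close>
    have A: "val 1 (?pos x) \<rho> = (\<Sum>y\<in>bitstrings R. \<Sum>os\<in>{os \<in> ?OS. ?o y os = x}. ?A y os)" for x
    proof -
      let ?j = "\<lambda>(y, xs). (y # map fst xs, concat (map snd xs))"
      have bij: "bij_betw ?j (bitstrings R \<times> ?XS) (?PO)"
        using bij_betw_position_outcomes[OF k(2), of "fst k0"] by (simp add: k)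
      have xs: "length xs = ?m" "\<And>x. x \<in> set xs \<Longrightarrow> length (snd x) = ?m" if "xs \<in> ?XS" for xs
        using that k(2) by (auto simp: listset_const mem_bitstrings)
      have dec: "?pd (?j (y, xs)) = ?o y (map2 ?dec ks' xs)"
        if "xs \<in> ?XS" for y xs
        unfolding k prod.case by (rule position_decode_eq[OF k(2) xs[OF that]])
      have "val 1 (?pos x) \<rho> = (\<Sum>t\<in>?PO.
          if ?pd t = x then val 1 (?pk t) \<rho> else 0)"
        unfolding val_coarse
        by (rule sum.inter_filter) (use bij_betw_finite[OF bij] finXS in simp)
      also have "\<dots> = (\<Sum>t\<in>bitstrings R \<times> ?XS. if ?pd (?j t) = x
          then val 1 (?pk (?j t)) \<rho> else 0)"
        by (rule sum.reindex_bij_betw[OF bij, symmetric])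
      also have "\<dots> = (\<Sum>y\<in>bitstrings R. \<Sum>xs\<in>?XS. if ?o y (map2 ?dec ks' xs) = x
          then ?V y xs else 0)"
        unfolding sum.cartesian_product'
      proof (intro sum.cong refl)
        fix y xs assume xsX: "xs \<in> ?XS"
        have map_fst: "map2 (\<lambda>p. opened_kernel w (anc F p) (real_prep F n p) ?c) (map fst ks') xs = map2 ?e ks' xs"
          using xs(1)[OF xsX] k(2) by (intro nth_equalityI) auto
        have "val 1 (?pk (?j (y, xs))) \<rho> = ?V y xs"
          using val_position[of "map fst ks'" xs "fst k0" b y \<rho>] k(2) xs[OF xsX]
          unfolding map_fst by (simp add: k X_def Y_def)
        then show "(if ?pd (?j (y, xs)) = x then val 1 (?pk (?j (y, xs))) \<rho> else 0) =
           (if ?o y (map2 ?dec ks' xs) = x then ?V y xs else 0)"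
          by (simp only: dec[OF xsX])
      qed
      also have "\<dots> = (\<Sum>y\<in>bitstrings R. \<Sum>os\<in>{os \<in> ?OS. ?o y os = x}. ?A y os)"
      proof (rule sum.cong[OF refl])
        fix y
        have "?A y os = (\<Sum>xs\<in>{xs \<in> ?XS. map2 ?dec ks' xs = os}. ?V y xs)" if "os \<in> ?OS" for os
          using tens_coarse[where xs = os and as = ks' and C = "\<lambda>_. ?C" and dec = ?dec and k = 1 and s = 0 and e = ?e] that
          by (subst val_sum[symmetric], intro val_cong) (simp add: listset_const)
        then have "(\<Sum>os\<in>{os \<in> ?OS. ?o y os = x}. ?A y os) =
           (\<Sum>os\<in>{os \<in> ?OS. ?o y os = x}. \<Sum>xs\<in>{xs \<in> ?XS. map2 ?dec ks' xs = os}. ?V y xs)"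
          by (intro sum.cong) auto
        also have "\<dots> = (\<Sum>xs\<in>{xs \<in> ?XS. ?o y (map2 ?dec ks' xs) = x}. ?V y xs)"
          by (rule sum_group_filter[OF finXS finOS]) (auto simp: listset_const)
        also have "\<dots> = (\<Sum>xs\<in>?XS. if ?o y (map2 ?dec ks' xs) = x then ?V y xs else 0)"
          by (rule sum.inter_filter[OF finXS])
        finally show "(\<Sum>xs\<in>?XS. if ?o y (map2 ?dec ks' xs) = x then ?V y xs else 0) =
          (\<Sum>os\<in>{os \<in> ?OS. ?o y os = x}. ?A y os)" ..
      qed
      finally show ?thesis .
    qed
    \<comment> \<open>With ideal inner measurements the position becomes the opening of the outer
      commitment alone; rejecting lists have no preimage among the measured bit lists, so only lists
      of \<open>Some\<close> contribute.\<close>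
    have B: "val 1 (?out x) \<rho> = (\<Sum>y\<in>bitstrings R. \<Sum>os\<in>{os \<in> ?OS. ?o y os = x}. ?B y os)" for x
    proof -
      have inner: "(\<Sum>os\<in>{os \<in> ?OS. ?o y os = x}. ?B y os) =
         (\<Sum>d\<in>{d \<in> bitstrings ?m. ?do y d = x}.
            val 1 (?eo (y, d)) \<rho>)" for y
      proof -
        let ?hd = "\<lambda>_ z. Some (hd z) :: bool option"
        have "?B y os = (\<Sum>ms\<in>{ms \<in> ?MS. map2 ?hd ks' ms = os}. ?M y ms)"
          if "os \<in> ?OS" for os
          unfolding ideal_eq_coarse
          using tens_coarse[where xs = os and as = ks' and C = "\<lambda>_. bitstrings 1" and dec = ?hd and k = 1 and s = 0 and e = "\<lambda>_. meas_kernel ?c"] that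
          by (subst val_sum[symmetric], intro val_cong) (simp add: listset_const)
        then have "(\<Sum>os\<in>{os \<in> ?OS. ?o y os = x}. ?B y os) =
           (\<Sum>os\<in>{os \<in> ?OS. ?o y os = x}. \<Sum>ms\<in>{ms \<in> ?MS. map2 ?hd ks' ms = os}. ?M y ms)"
          by (intro sum.cong) auto
        also have "\<dots> = (\<Sum>ms\<in>{ms \<in> ?MS. ?o y (map2 ?hd ks' ms) = x}. ?M y ms)"
          by (rule sum_group_filter[OF finMS finOS]) (auto simp: listset_const)
        also have "\<dots> = (\<Sum>d\<in>{d \<in> bitstrings ?m. ?do y d = x}.
            val 1 (?eo (y, d)) \<rho>)"
        proof (rule sum.reindex_bij_witness[where i = "map (\<lambda>h. [h])" and j = "map hd"])
          fix ms assume "ms \<in> {ms \<in> ?MS. ?o y (map2 ?hd ks' ms) = x}"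
          then have ms: "length ms = ?m" "set ms \<subseteq> bitstrings 1" "?o y (map2 ?hd ks' ms) = x"
            using k(2) by (auto simp: listset_const)
          have single: "z = [hd z]" if "z \<in> set ms" for z using subsetD[OF ms(2) that] by (cases z) (auto simp: bitstrings_def)
          then show id: "map (\<lambda>h. [h]) (map hd ms) = ms" by (simp add: map_idI)
          have some: "map2 ?hd ks' ms = map Some (map hd ms)"
            using ms(1) k(2) by (intro nth_equalityI) auto
          show "map hd ms \<in> {d \<in> bitstrings ?m. ?do y d = x}"
            using ms(1,3) unfolding some by (auto simp: outer_decode_def mem_bitstrings o_def)
          have cc: "concat ms = map hd ms"
            using concat_map_singleton[of "\<lambda>h. h" "map hd ms"] unfolding id by simp
          have "val 1 (?eo (y, map hd ms)) \<rho> =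
             val ?m (meas_kernel b (map hd ms)) (Y y)"
            by (simp add: opened_kernel_def Y_def val_sop)
          \<comment> \<open>Measuring \<open>Y y\<close> in the basis b is measuring
            \<open>X y\<close> in the opposite basis.\<close>
          also have "\<dots> = val ?m (meas_kernel ?c (map hd ms)) (X y)"
            using sop_meas_hadamard[of "map hd ms" ?m 0 0 b "Y y"] ms(1) by (simp add: val_def X_def sop_sop)
          also have "\<dots> = val ?m (tens 1 0 (map (meas_kernel ?c) ms)) (X y)"
            unfolding cc[symmetric] using ms by (intro val_cong meas_kernel_concat) (auto simp: mem_bitstrings)
          also have "map (meas_kernel ?c) ms = map2 (\<lambda>_. meas_kernel ?c) ks' ms"
            using ms(1) k(2) by (intro nth_equalityI) auto
          finally show "val 1 (?eo (y, map hd ms)) \<rho> =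
             ?M y ms" .
        next
          fix d assume "d \<in> {d \<in> bitstrings ?m. ?do y d = x}"
          then have d: "length d = ?m" "?do y d = x" by (auto simp: mem_bitstrings)
          show "map hd (map (\<lambda>h. [h]) d) = d" by (simp add: o_def)
          have some: "map2 ?hd ks' (map (\<lambda>h. [h]) d) = map Some d"
            using d(1) k(2) by (intro nth_equalityI) auto
          show "map (\<lambda>h. [h]) d \<in> {ms \<in> ?MS. ?o y (map2 ?hd ks' ms) = x}"
            using d k(2) by (auto simp: some listset_const mem_bitstrings outer_decode_def o_def)
        qed
        finally show ?thesis .
      qed
      have set: "{t \<in> ?C. (case t of (y, z) \<Rightarrow> ?do y z) = x} =
         Sigma (bitstrings R) (\<lambda>y. {d \<in> bitstrings ?m. ?do y d = x})" by auto
      show ?thesis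
        unfolding val_coarse set inner by (subst sum.Sigma) (auto simp: split_def)
    qed
    \<comment> \<open>The fibres of the outer decoding partition the lists \<open>os\<close>, so the
      triangle inequality bounds the distance by that of the undecoded inner outcomes, to which
      \<open>close_tens\<close> applies for each y.\<close>
    have "(\<Sum>x\<in>UNIV. cmod (val 1 (?pos x) \<rho> - val 1 (?out x) \<rho>)) \<le>
       (\<Sum>x\<in>UNIV. \<Sum>y\<in>bitstrings R. \<Sum>os\<in>{os \<in> ?OS. ?o y os = x}. cmod (?A y os - ?B y os))"
      unfolding A B sum_subtractf[symmetric] by (intro sum_mono order.trans[OF norm_sum] sum_mono norm_sum)
    also have "\<dots> = (\<Sum>y\<in>bitstrings R. \<Sum>x\<in>UNIV. \<Sum>os\<in>{os \<in> ?OS. ?o y os = x}. cmod (?A y os - ?B y os))"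
      by (rule sum.swap)
    also have "\<dots> = (\<Sum>y\<in>bitstrings R. \<Sum>os\<in>?OS. cmod (?A y os - ?B y os))"
      by (intro sum.cong refl sum.group finOS) auto
    also have "\<dots> \<le> (\<Sum>y\<in>bitstrings R. (real ?m * \<delta>) * Re (qtrace (Y y)))"
    proof (rule sum_mono)
      fix y assume y: "y \<in> bitstrings R"
      have "(\<Sum>os\<in>?OS. cmod (val (length ks') (tens 1 0 (map2 ?E ks' os)) (X y) - val (length ks') (tens 1 0 (map2 (\<lambda>_. ideal ?c) ks' os)) (X y)))
        \<le> (\<Sum>k\<leftarrow>ks'. \<delta>) * Re (qtrace (X y))"
        by (rule close_tens)
           (use instE instrument_ideal weak[of "fst k" "snd k" ?c for k] key psdX[OF y] k(2) in auto)
      then show "(\<Sum>os\<in>?OS. cmod (?A y os - ?B y os)) \<le> (real ?m * \<delta>) * Re (qtrace (Y y))"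
        using trX[OF y] by (simp add: k(2) sum_list_triv)
    qed
    also have "\<dots> = real ?m * \<delta> * Re (qtrace \<rho>)"
      by (simp add: trY[symmetric] sum_distrib_left)
    finally show "(\<Sum>x\<in>UNIV. cmod (val 1 (?pos x) \<rho> - val 1 (?out x) \<rho>)) \<le> real ?m * \<delta> * Re (qtrace \<rho>)" .
  qed
  moreover have "close 1 ?out (ideal b) \<delta>"
    using weak[of "fst k0" "snd k0" b] key(1)[of k0] by simp
  ultimately have "close 1 ?pos (ideal b) (real ?m * \<delta> + \<delta>)" by (rule close_trans)
  then show ?thesis by (simp add: algebra_simps)
qed

end

section \<open>All positions\<close>

definition combine :: "bool option list \<Rightarrow> bits option" where
  "combine xs = (if None \<in> set xs then None else Some (map the xs))"

text \<open>The verdict on all positions is a function of the list of verdicts, so it may be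
  compared before combining.\<close>

lemma tv_dist_map_combine: "tv_dist (map_pmf combine p) (map_pmf Some q) \<le> tv_dist p (map_pmf (map Some) q)"
proof -
  have "map_pmf Some q = map_pmf combine (map_pmf (map Some) q)"
    by (simp add: map_pmf_comp combine_def o_def)
  then show ?thesis using tv_dist_map[of combine p "map_pmf (map Some) q"] by simp
qed

lemma implements_measure_qubit: "implements (measure_qubit b) (bitstrings 1) 1 0 (meas_kernel b)"
proof -
  have "measure_qubit b = (\<lambda>p \<rho>. measure_block p 1 (if b then hadamard_block p 1 \<rho> else \<rho>))"
    by (intro ext) (simp add: measure_qubit_def)
  then show ?thesis using implements_measure[of 1 b] by simp
qed

lemma map_fst_instr: "map_pmf fst (instr C \<Phi>) = outcome C \<Phi>"
  by (simp add: instr_def map_pmf_comp)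

lemma pmf_map_implements:
  assumes f: "implements f C N 0 \<kappa>" and \<sigma>: "density_operator N \<sigma>"
  shows "pmf (map_pmf (\<lambda>(c, _). h c) (f 0 \<sigma>)) x = (\<Sum>c\<in>{c \<in> C. h c = x}. Re (val N (\<kappa> c) \<sigma>))"
proof -
  have inst: "instrument C N 0 \<kappa>" and "f 0 \<sigma> = instr C (\<lambda>c. sop 0 N 0 0 (\<kappa> c) \<sigma>)"
    using f \<sigma> by (auto simp: implements_def)
  then have "map_pmf (\<lambda>(c, _). h c) (f 0 \<sigma>) = map_pmf h (outcome C (\<lambda>c. sop 0 N 0 0 (\<kappa> c) \<sigma>))"
    by (simp add: map_pmf_comp split_def flip: map_fst_instr)
  also have "pmf \<dots> x = (\<Sum>c\<in>{c \<in> C. h c = x}. Re (qtrace (sop 0 N 0 0 (\<kappa> c) \<sigma>)))"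
    by (rule pmf_map_outcome[of _ 0])
       (use inst \<sigma> instrument_psd[OF inst, of _ 0 0 \<sigma>] instrument_qtrace[OF inst, of 0 0 \<sigma>] in
         \<open>auto simp: density_operator_iff instrument_finite\<close>)
  finally show ?thesis by (simp add: qtrace_sop_eq_val)
qed

lemma set_pmf_map_implements:
  assumes f: "implements f C N 0 \<kappa>" and \<sigma>: "density_operator N \<sigma>"
    and x: "x \<in> set_pmf (map_pmf (\<lambda>(c, _). h c) (f 0 \<sigma>))"
  obtains c where "c \<in> C" "h c = x"
proof -
  have "(\<Sum>c\<in>{c \<in> C. h c = x}. Re (val N (\<kappa> c) \<sigma>)) \<noteq> 0"
    using pmf_map_implements[OF f \<sigma>, of h x] x unfolding set_pmf_iff by argo
  then obtain c where "c \<in> {c \<in> C. h c = x}" by (rule sum.not_neutral_contains_not_neutral)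
  then show thesis using that by blast
qed

lemma implements_basis:
  "implements (in_sequence measure_qubit 0 (map \<beta> as)) (listset (map (\<lambda>_. bitstrings 1) as)) (length as) 0
     (\<lambda>ms. tens 1 0 (map2 (\<lambda>a. meas_kernel (\<beta> a)) as ms))"
proof -
  have "implements (in_sequence measure_qubit 0 (map \<beta> as)) (listset (map (\<lambda>_. bitstrings 1) (map \<beta> as)))
      (1 * length (map \<beta> as)) (0 * length (map \<beta> as)) (\<lambda>ms. tens 1 0 (map2 meas_kernel (map \<beta> as) ms))"
    by (intro implements_in_sequence implements_measure_qubit)
  then show ?thesis by (simp add: o_def zip_map1 split_def)
qed

lemma basis_measurement_Some:
  "map_pmf (map Some) (basis_measurement \<sigma> bs) =
     map_pmf (\<lambda>(ms, _). map Some (concat ms)) (in_sequence measure_qubit 0 bs 0 \<sigma>)"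
  by (simp add: basis_measurement_def map_pmf_comp split_def)

text \<open>Puts the target distribution into the form of the real one, a tensor product of
  one-qubit effects, so that \<open>close_tens\<close> can compare them.\<close>

lemma pmf_basis_measurement:
  assumes \<sigma>: "density_operator (length as) \<sigma>" and os: "length os = length as"
  shows "pmf (map_pmf (map Some) (basis_measurement \<sigma> (map \<beta> as))) os =
    Re (val (length as) (tens 1 0 (map2 (\<lambda>a. ideal (\<beta> a)) as os)) \<sigma>)"
proof -
  let ?N = "length as" let ?MS = "listset (map (\<lambda>_. bitstrings 1) as)"
  let ?k = "\<lambda>ms. tens 1 0 (map2 (\<lambda>a. meas_kernel (\<beta> a)) as ms)"
  have set_eq: "{ms \<in> ?MS. map Some (concat ms) = os} = {ms \<in> ?MS. map2 (\<lambda>_ z. Some (hd z)) as ms = os}"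
  proof -
    have "map Some (concat ms) = map2 (\<lambda>_ z. Some (hd z)) as ms" if "ms \<in> ?MS" for ms
    proof -
      have ms: "length ms = ?N" "set ms \<subseteq> bitstrings 1" using that by (auto simp: listset_const)
      have single: "[hd z] = z" if "z \<in> set ms" for z
        using subsetD[OF ms(2) that] by (cases z) (auto simp: bitstrings_def)
      have "concat ms = concat (map (\<lambda>z. [hd z]) ms)" using single by (simp add: map_idI)
      also have "\<dots> = map hd ms" by simp
      finally show ?thesis using ms(1) by (intro nth_equalityI) auto
    qed
    then show ?thesis by auto
  qed
  have "pmf (map_pmf (map Some) (basis_measurement \<sigma> (map \<beta> as))) os =
      (\<Sum>ms\<in>{ms \<in> ?MS. map2 (\<lambda>_ z. Some (hd z)) as ms = os}. Re (val ?N (?k ms) \<sigma>))"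
    unfolding basis_measurement_Some set_eq[symmetric]
    by (rule pmf_map_implements[OF implements_basis \<sigma>])
  also have "\<dots> = Re (val ?N (tens 1 0 (map2 (\<lambda>a. ideal (\<beta> a)) as os)) \<sigma>)"
    unfolding ideal_eq_coarse
    using tens_coarse[where xs = os and as = as and C = "\<lambda>_. bitstrings 1" and dec = "\<lambda>_ z. Some (hd z)"
        and k = 1 and s = 0 and e = "\<lambda>a. meas_kernel (\<beta> a)", OF os]
    by (subst Re_sum[symmetric], subst val_sum[symmetric], intro arg_cong[of _ _ Re] val_cong) simp
  finally show ?thesis .
qed

context scheme_bound begin

text \<open>An entry of \<open>kb\<close> joins the key pairs of a position with its basis bit, so a
  position is one element of the list to which \<open>close_tens\<close> is applied.\<close>

lemma tv_dist_fixed_keys: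
  fixes kb :: "((bits \<times> bits) list \<times> bool) list"
  defines "pk \<equiv> map (\<lambda>x. map fst (fst x)) kb" and "sk \<equiv> map (\<lambda>x. map snd (fst x)) kb" and "bs \<equiv> map snd kb"
  assumes keys: "\<And>x. x \<in> set kb \<Longrightarrow> length (fst x) = Suc (Suc w) \<and> set (fst x) \<subseteq> set_pmf (GenF F n)"
    and \<sigma>: "density_operator (length kb) \<sigma>"
  shows "tv_dist (bind_pmf (Commit F n pk \<sigma>) (\<lambda>(y, \<rho>). bind_pmf (Open F n \<rho> bs) (\<lambda>z.
      return_pmf (if Ver F n pk sk y bs z then Some (Out F n sk y bs z) else None))))
    (map_pmf Some (basis_measurement \<sigma> bs)) \<le> real (length kb) * (real (Suc (Suc w)) * \<delta>)"
    (is "tv_dist ?R _ \<le> _")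
proof -
  let ?B = bitstrings
  let ?N = "length kb" let ?M = "Suc w * Suc w"
  let ?pk = "\<lambda>x :: (bits \<times> bits) list \<times> bool. map fst (fst x)"
  let ?e = "\<lambda>x. position_kernel F n (?pk x) (snd x)"
  let ?dec = "\<lambda>x. position_decode F n (?pk x) (map snd (fst x)) (snd x)"
  let ?A = "\<lambda>x. listset (map (\<lambda>_. ?B R) (?pk x))"
  let ?C = "\<lambda>x. position_outcomes F n (?pk x)"
  let ?YS = "listset (map ?A kb)" let ?ZS = "listset (map (\<lambda>_. ?B ?M) kb)"
  let ?XS = "listset (map ?C kb)" let ?OS = "listset (map (\<lambda>_. UNIV :: bool option set) kb)"
  let ?E = "\<lambda>x. coarse (?C x) (?dec x) (?e x)" let ?I = "\<lambda>x. ideal (snd x)"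
  let ?ky = "\<lambda>ys. tens 1 ?M (map2 (\<lambda>x. commit_kernel F n (?pk x)) kb ys)"
  let ?kz = "\<lambda>zs. tens ?M 0 (map2 (\<lambda>x. meas_kernel (\<not> snd x)) kb zs)"
  let ?k = "\<lambda>(ys, zs). kcomp (?M * ?N) (?kz zs) (?ky ys)"
  let ?run = "\<lambda>p \<rho>. bind_pmf (in_sequence (Commit1 F n) ?M pk p \<rho>) (\<lambda>(ys, \<rho>').
      bind_pmf (in_sequence (Open1 F n) 0 bs p \<rho>') (\<lambda>(zs, \<rho>''). return_pmf ((ys, zs), \<rho>'')))"
  let ?h = "\<lambda>(ys, zs). map2 ?dec kb (zip ys zs)"
  have pks: "length (?pk x) = Suc (Suc w)" "set (?pk x) \<subseteq> pks F n" if "x \<in> set kb" for x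
    using keys[OF that] by (auto simp: pks_def)
  have "implements (in_sequence (Commit1 F n) ?M pk) (listset (map (\<lambda>pk. listset (map (\<lambda>_. ?B R) pk)) pk))
      (1 * length pk) (?M * length pk) (\<lambda>ys. tens 1 ?M (map2 (commit_kernel F n) pk ys))"
  proof (rule implements_in_sequence)
    fix p assume "p \<in> set pk"
    then obtain x where x: "x \<in> set kb" "p = ?pk x" unfolding pk_def set_map by (elim imageE)
    show "implements (Commit1 F n p) (listset (map (\<lambda>_. ?B R) p)) 1 ?M (commit_kernel F n p)"
      unfolding x(2) by (rule implements_Commit1[OF pks[OF x(1)]])
  qed
  then have C: "implements (in_sequence (Commit1 F n) ?M pk) ?YS ?N (?M * ?N) ?ky"
    by (simp add: pk_def o_def zip_map1 split_def)
  have "implements (in_sequence (Open1 F n) 0 bs) (listset (map (\<lambda>_. ?B ?M) bs))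
      (?M * length bs) (0 * length bs) (\<lambda>zs. tens ?M 0 (map2 (\<lambda>b. meas_kernel (\<not> b)) bs zs))"
    by (rule implements_in_sequence, rule implements_Open1)
  then have O: "implements (in_sequence (Open1 F n) 0 bs) ?ZS (?M * ?N) 0 ?kz"
    by (simp add: bs_def o_def zip_map1 split_def)
  have "implements ?run ((\<lambda>(c, d). Pair c d) ` (?YS \<times> ?ZS)) ?N 0 ?k"
    by (rule implements_kcomp[OF C O]) (auto simp: inj_on_def)
  then have run: "implements ?run (?YS \<times> ?ZS) ?N 0 ?k" by simp
  let ?P = "map_pmf (\<lambda>(c, _). ?h c) (?run 0 \<sigma>)"
  let ?Q = "map_pmf (map Some) (basis_measurement \<sigma> bs)"
  have bij: "bij_betw (\<lambda>xs. (map fst xs, map snd xs)) ?XS (?YS \<times> ?ZS)"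
    unfolding position_outcomes_def by (rule bij_betw_unzip_listset)
  have finXS: "finite ?XS"
    using instrument_position[OF pks] by (intro finite_listset) (auto dest: instrument_finite)
  \<comment> \<open>Committing to all positions and then opening all of them is, by the interchange
    law, a tensor product over the positions.\<close>
  have kernel: "?k (map fst xs, map snd xs) = tens 1 0 (map2 ?e kb xs)" if "length xs = ?N" for xs
  proof -
    have "?k (map fst xs, map snd xs) = tens 1 0 (map2 (kcomp ?M)
        (map2 (\<lambda>x. meas_kernel (\<not> snd x)) kb (map snd xs)) (map2 (\<lambda>x. commit_kernel F n (?pk x)) kb (map fst xs)))"
      using kcomp_tens[of "map2 (\<lambda>x. meas_kernel (\<not> snd x)) kb (map snd xs)"
          "map2 (\<lambda>x. commit_kernel F n (?pk x)) kb (map fst xs)" ?M 0 1] that by simp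
    also have "map2 (kcomp ?M) (map2 (\<lambda>x. meas_kernel (\<not> snd x)) kb (map snd xs))
        (map2 (\<lambda>x. commit_kernel F n (?pk x)) kb (map fst xs)) = map2 ?e kb xs"
      using that by (intro nth_equalityI) (auto simp: position_kernel_def split_def)
    finally show ?thesis .
  qed
  have lenXS: "length xs = ?N" if "xs \<in> ?XS" for xs using that by (simp add: listset_iff)
  have P: "pmf ?P os = Re (val ?N (tens 1 0 (map2 ?E kb os)) \<sigma>)" if os: "length os = ?N" for os
  proof -
    have "pmf ?P os = (\<Sum>t\<in>{t \<in> ?YS \<times> ?ZS. ?h t = os}. Re (val ?N (?k t) \<sigma>))"
      by (rule pmf_map_implements[OF run \<sigma>])
    also have "\<dots> = (\<Sum>t\<in>?YS \<times> ?ZS. if ?h t = os then Re (val ?N (?k t) \<sigma>) else 0)"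
      using bij_betw_finite[OF bij] finXS by (intro sum.inter_filter) simp
    also have "\<dots> = (\<Sum>xs\<in>?XS. if ?h (map fst xs, map snd xs) = os then Re (val ?N (?k (map fst xs, map snd xs)) \<sigma>) else 0)"
      by (rule sum.reindex_bij_betw[OF bij, symmetric])
    also have "\<dots> = (\<Sum>xs\<in>?XS. if map2 ?dec kb xs = os then Re (val ?N (tens 1 0 (map2 ?e kb xs)) \<sigma>) else 0)"
    proof (rule sum.cong[OF refl])
      fix xs assume "xs \<in> ?XS"
      then show "(if ?h (map fst xs, map snd xs) = os then Re (val ?N (?k (map fst xs, map snd xs)) \<sigma>) else 0) =
        (if map2 ?dec kb xs = os then Re (val ?N (tens 1 0 (map2 ?e kb xs)) \<sigma>) else 0)"
        unfolding kernel[OF lenXS[OF \<open>xs \<in> ?XS\<close>]] by (simp add: zip_map_fst_snd)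
    qed
    also have "\<dots> = (\<Sum>xs\<in>{xs \<in> ?XS. map2 ?dec kb xs = os}. Re (val ?N (tens 1 0 (map2 ?e kb xs)) \<sigma>))"
      by (rule sum.inter_filter[OF finXS, symmetric])
    also have "\<dots> = Re (val ?N (tens 1 0 (map2 ?E kb os)) \<sigma>)"
      using tens_coarse[where xs = os and as = kb and C = ?C and dec = ?dec and k = 1 and s = 0 and e = ?e, OF os]
      by (subst Re_sum[symmetric], subst val_sum[symmetric], intro arg_cong[of _ _ Re] val_cong) simp
    finally show ?thesis .
  qed
  have Q: "pmf ?Q os = Re (val ?N (tens 1 0 (map2 ?I kb os)) \<sigma>)" if "length os = ?N" for os
    unfolding bs_def by (rule pmf_basis_measurement[OF \<sigma> that])
  have set_run: "set_pmf ?P \<subseteq> ?OS"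
  proof
    fix os assume "os \<in> set_pmf ?P"
    then obtain t where "t \<in> ?YS \<times> ?ZS" "?h t = os"
      by (rule set_pmf_map_implements[OF run \<sigma>])
    then obtain ys zs where "os = map2 ?dec kb (zip ys zs)" "length ys = ?N" "length zs = ?N"
      by (auto simp: listset_iff)
    then show "os \<in> ?OS" by (simp add: listset_const)
  qed
  have set_basis: "set_pmf ?Q \<subseteq> ?OS"
  proof
    fix os assume "os \<in> set_pmf ?Q"
    then obtain ms where "ms \<in> listset (map (\<lambda>_. ?B 1) kb)" and os: "map Some (concat ms) = os"
      unfolding basis_measurement_Some bs_def by (rule set_pmf_map_implements[OF implements_basis \<sigma>])
    then have "length (concat ms) = ?N"
      by (subst length_concat_const[of _ 1]) (auto simp: listset_const mem_bitstrings)
    then show "os \<in> ?OS" by (simp add: listset_const flip: os)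
  qed
  have finOS: "finite ?OS" by (auto intro!: finite_listset)
  have "tv_dist ?P ?Q \<le> (\<Sum>os\<in>?OS. \<bar>pmf ?P os - pmf ?Q os\<bar>)"
    by (rule tv_dist_le_sum[OF finOS set_run set_basis])
  also have "\<dots> \<le> (\<Sum>os\<in>?OS. cmod (val ?N (tens 1 0 (map2 ?E kb os)) \<sigma> - val ?N (tens 1 0 (map2 ?I kb os)) \<sigma>))"
  proof (rule sum_mono)
    fix os assume "os \<in> ?OS"
    then have "length os = ?N" by (simp add: listset_const)
    then show "\<bar>pmf ?P os - pmf ?Q os\<bar> \<le> cmod (val ?N (tens 1 0 (map2 ?E kb os)) \<sigma> - val ?N (tens 1 0 (map2 ?I kb os)) \<sigma>)"
      unfolding P[OF \<open>length os = ?N\<close>] Q[OF \<open>length os = ?N\<close>] by (metis abs_Re_le_cmod minus_complex.sel(1))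
  qed
  also have "\<dots> \<le> (\<Sum>x\<leftarrow>kb. real (Suc (Suc w)) * \<delta>) * Re (qtrace \<sigma>)"
  proof (rule close_tens)
    show "instrument UNIV 1 0 (?E x)" if "x \<in> set kb" for x
      by (intro instrument_coarse instrument_position pks that)
    show "close 1 (?E x) (?I x) (real (Suc (Suc w)) * \<delta>)" if "x \<in> set kb" for x
      using keys[OF that] by (intro close_position) auto
  qed (use \<sigma> instrument_ideal in \<open>auto simp: density_operator_iff\<close>)
  also have "\<dots> = real ?N * (real (Suc (Suc w)) * \<delta>)"
    using \<sigma> by (simp add: density_operator_iff sum_list_triv)
  finally have tv: "tv_dist ?P ?Q \<le> real ?N * (real (Suc (Suc w)) * \<delta>)" .
  have "?R =
    map_pmf (\<lambda>(c, _). case c of (y, z) \<Rightarrow> if Ver F n pk sk y bs z then Some (Out F n sk y bs z) else None) (?run 0 \<sigma>)"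
    by (simp add: Commit_def Open_def map_pmf_def bind_assoc_pmf bind_return_pmf split_def power2_eq_square cong: if_cong)
  also have "\<dots> = map_pmf (\<lambda>(c, _). combine (?h c)) (?run 0 \<sigma>)"
  proof (rule map_pmf_cong[OF refl])
    \<comment> \<open>The rewriting of the verdict is restricted to sampled transcripts, whose lists
      have one entry for each position.\<close>
    fix t assume t: "t \<in> set_pmf (?run 0 \<sigma>)"
    obtain ys zs \<rho> where t_eq: "t = ((ys, zs), \<rho>)" by (metis prod.collapse)
    from t have "(ys, zs) \<in> set_pmf (map_pmf (\<lambda>(c, _). c) (?run 0 \<sigma>))"
      unfolding set_map_pmf t_eq by (rule rev_image_eqI) simp
    then have "(ys, zs) \<in> ?YS \<times> ?ZS"
      by (rule set_pmf_map_implements[OF run \<sigma>]) (simp only:)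
    then have len: "length ys = ?N" "length zs = ?N" by (auto simp: listset_iff)
    have lens: "length pk = ?N" "length sk = ?N" "length bs = ?N" by (simp_all add: pk_def sk_def bs_def)
    have os: "map2 ?dec kb (zip ys zs) ! j = (if Ver1 F n (pk ! j) (sk ! j) (ys ! j) (bs ! j) (zs ! j)
        then Some (Out1 F n (sk ! j) (ys ! j) (bs ! j) (zs ! j)) else None)" if "j < ?N" for j
      using that len by (simp add: position_decode_def pk_def sk_def bs_def)
    have len_os: "length (map2 ?dec kb (zip ys zs)) = ?N" using len by simp
    have Ver: "Ver F n pk sk ys bs zs \<longleftrightarrow> None \<notin> set (map2 ?dec kb (zip ys zs))"
      unfolding Ver_def in_set_conv_nth len_os lens by (auto simp: os split: if_splits)
    moreover have "Out F n sk ys bs zs = map the (map2 ?dec kb (zip ys zs))" if "Ver F n pk sk ys bs zs"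
    proof (rule nth_equalityI)
      fix j assume "j < length (Out F n sk ys bs zs)"
      then have j: "j < ?N" by (simp add: Out_def lens)
      then show "Out F n sk ys bs zs ! j = map the (map2 ?dec kb (zip ys zs)) ! j"
        using that len_os by (simp only: nth_map os) (simp add: Ver_def Out_def lens)
    qed (use len in \<open>simp add: Out_def lens\<close>)
    ultimately show "(case t of (c, _) \<Rightarrow> case c of (y, z) \<Rightarrow>
        if Ver F n pk sk y bs z then Some (Out F n sk y bs z) else None) = (case t of (c, _) \<Rightarrow> combine (?h c))"
      unfolding combine_def t_eq prod.case by (cases "Ver F n pk sk ys bs zs") (simp_all only: if_True if_False not_not simp_thms)
  qed
  also have "\<dots> = map_pmf combine ?P" by (simp add: map_pmf_comp split_def)
  finally have real: "?R = map_pmf combine ?P" .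
  show ?thesis unfolding real by (rule order.trans[OF tv_dist_map_combine tv])
qed

lemma tv_dist_Real_experiment:
  assumes \<sigma>: "density_operator N \<sigma>" and b: "length b = N"
  shows "tv_dist (Real_experiment F n N \<sigma> b) (map_pmf Some (basis_measurement \<sigma> b)) \<le>
    real N * (real (Suc (Suc w)) * \<delta>)"
  unfolding Real_experiment_def
proof (rule tv_dist_bind_le, clarify)
  fix pk sk assume "(pk, sk) \<in> set_pmf (Gen F n N)"
  then obtain kks where kks: "pk = map fst kks" "sk = map snd kks" "length kks = N" "set kks \<subseteq> set_pmf (Gen1 F n)"
    by (auto simp: Gen_def set_replicate_pmf)
  \<comment> \<open>\<open>Gen1\<close> stores public and secret keys in separate lists. Elements of
    \<open>?K\<close> are the underlying lists of pairs, which retain that each pair was generated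
    together.\<close>
  let ?K = "{ks. length ks = Suc (Suc w) \<and> set ks \<subseteq> set_pmf (GenF F n)}"
  let ?g = "\<lambda>ks :: (bits \<times> bits) list. (map fst ks, map snd ks)"
  have "{ks \<in> lists (set_pmf (GenF F n)). length ks = w + 2} = ?K" by auto
  then have "set_pmf (Gen1 F n) = ?g ` ?K"
    by (simp only: Gen1_def set_map_pmf set_replicate_pmf)
  then have "kks \<in> lists (?g ` ?K)" using kks(4) by auto
  then obtain kss where kss: "kss \<in> lists ?K" "kks = map ?g kss" unfolding lists_image by blast
  define kb where "kb = zip kss b"
  have len: "length kss = N" using kss kks by simp
  have eqs: "pk = map (\<lambda>x. map fst (fst x)) kb" "sk = map (\<lambda>x. map snd (fst x)) kb" "b = map snd kb" "length kb = N"
    using len b by (auto simp: kb_def kks(1,2) kss(2) intro!: nth_equalityI)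
  show "tv_dist (bind_pmf (Commit F n pk \<sigma>) (\<lambda>(y, \<rho>). bind_pmf (Open F n \<rho> b) (\<lambda>z.
      return_pmf (if Ver F n pk sk y b z then Some (Out F n sk y b z) else None))))
    (map_pmf Some (basis_measurement \<sigma> b)) \<le> real N * (real (Suc (Suc w)) * \<delta>)"
    unfolding eqs(1-3) eqs(4)[symmetric]
  proof (rule tv_dist_fixed_keys)
    show "length (fst x) = Suc (Suc w) \<and> set (fst x) \<subseteq> set_pmf (GenF F n)" if "x \<in> set kb" for x
    proof -
      have "fst x \<in> set kss" using that unfolding kb_def by (metis prod.collapse set_zip_leftD)
      then show ?thesis using kss(1) by auto
    qed
    show "density_operator (length kb) \<sigma>" using \<sigma> eqs(4) by simp
  qed
qed

end

theorem theoremB1: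
  fixes F :: ntcf_algorithms
    and L :: "nat \<Rightarrow> nat"
    and \<sigma> :: "nat \<Rightarrow> qop"
    and b :: "nat \<Rightarrow> bits"
  assumes "ntcf F"
    and "poly_bounded L"
    and "\<And>n. density_operator (L n) (\<sigma> n)"
    and "\<And>n. b n \<in> bitstrings (L n)"
  shows "negl (\<lambda>n. tv_dist (Real_experiment F n (L n) (\<sigma> n) (b n))
                                 (map_pmf Some (basis_measurement (\<sigma> n) (b n))))"
proof -
  let ?d = "\<lambda>n. tv_dist (Real_experiment F n (L n) (\<sigma> n) (b n)) (map_pmf Some (basis_measurement (\<sigma> n) (b n)))"
  obtain \<nu>1 where \<nu>1: "negl \<nu>1" "\<And>n pk b. pk \<in> pks F n \<Longrightarrow>
      prep_error F n pk b \<le> \<nu>1 n"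
    using assms(1) unfolding ntcf_def ntcf_range_superposition_def by blast
  obtain \<nu>2 where \<nu>2: "negl \<nu>2" "\<And>n pk x0 x1. \<lbrakk>pk \<in> pks F n; x0 \<in> Dom F pk; x1 \<in> Dom F pk; x0 \<noteq> x1\<rbrakk> \<Longrightarrow>
      real (card (good_set F n x0 x1)) / 2 ^ (width F n + 1) \<ge> 1 - \<nu>2 n"
  proof -
    have "ntcf_complete F" using assms(1) by (simp add: ntcf_def)
    from conjunct2[OF this[unfolded ntcf_complete_def]] obtain \<nu> where "negl \<nu>"
      and \<nu>: "\<forall>n. \<forall>pk\<in>pks F n. \<forall>x0\<in>Dom F pk. \<forall>x1\<in>Dom F pk. x0 \<noteq> x1 \<longrightarrow>
        real (card (good_set F n x0 x1)) / 2 ^ (width F n + 1) \<ge> 1 - \<nu> n"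
      by (elim exE conjE)
    show ?thesis
      by (rule that[OF \<open>negl \<nu>\<close>]) (use \<nu> in blast)
  qed
  \<comment> \<open>The constants are those of \<open>close_weak_commitment\<close>. The absolute
    values are there because a negligible function may take negative values, while the bound on the
    good set requires a nonnegative one.\<close>
  define \<delta> where "\<delta> n = 8 * \<bar>\<nu>1 n\<bar> + 12 * \<bar>\<nu>2 n\<bar>" for n
  have bound: "scheme_bound F n (\<delta> n)" for n
  proof
    show wf: "wf_gate (prep_qubits F n pk) g" if "pk \<in> pks F n" "g \<in> set (Prep F pk b)" for pk b g
    proof -
      have "uniform_circuits {(n, pk, b). pk \<in> pks F n} (\<lambda>(n, pk, b). [unary n, pk, [b]])
          (\<lambda>(n, pk, b). prep_qubits F n pk) (\<lambda>(n, pk, b). Prep F pk b)"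
        using assms(1) by (simp add: ntcf_def ntcf_range_superposition_def)
      from conjunct2[OF this[unfolded uniform_circuits_def], THEN bspec, of "(n, pk, b)"] that
      show ?thesis by simp
    qed
    fix pk sk c assume key: "(pk, sk) \<in> set_pmf (GenF F n)"
    then have pk: "pk \<in> pks F n" by (force simp: pks_def)
    interpret ntcf_key F n pk sk using assms(1) key by unfold_locales
    show "close 1 (weak_measurement F n c pk sk) (ideal c) (\<delta> n)"
      unfolding \<delta>_def
    proof (rule close_weak_commitment)
      show "prep_error F n pk b \<le> \<bar>\<nu>1 n\<bar>" for b
        using \<nu>1(2)[OF pk, of b] by linarith
      show "1 - \<bar>\<nu>2 n\<bar> \<le> real (card (good_set F n x0 x1)) / 2 ^ (width F n + 1)"
        if "x0 \<in> Dom F pk" "x1 \<in> Dom F pk" "x0 \<noteq> x1" for x0 x1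
        using \<nu>2(2)[OF pk that] by linarith
    qed (use wf pk in auto)
  qed
  have \<delta>: "negl \<delta>"
    unfolding \<delta>_def using \<nu>1(1) \<nu>2(1) by (intro negl_add negl_cmult) (auto elim: negl_mono)
  have "poly_bounded (width F)" using assms(1) by (simp add: ntcf_def ntcf_syntax_def)
  \<comment> \<open>The factor w + 2 is split, since polynomial boundedness is available for the
    width itself and the constant 2 is handled separately.\<close>
  then have "negl (\<lambda>n. real (L n) * (real (width F n) * \<delta> n + 2 * \<delta> n))"
    using assms(2) \<delta> by (intro negl_poly_mult negl_add negl_cmult)
  then show ?thesis
  proof (rule negl_mono)
    fix n
    have "?d n \<le>
        real (L n) * (real (Suc (Suc (width F n))) * \<delta> n)"
      using scheme_bound.tv_dist_Real_experiment[OF bound assms(3)] assms(4) by (simp add: mem_bitstrings)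
    also have "\<dots> = real (L n) * (real (width F n) * \<delta> n + 2 * \<delta> n)" by (simp add: algebra_simps)
    finally show "\<bar>?d n\<bar> \<le>
        \<bar>real (L n) * (real (width F n) * \<delta> n + 2 * \<delta> n)\<bar>"
      using tv_dist_nonneg[of "Real_experiment F n (L n) (\<sigma> n) (b n)" "map_pmf Some (basis_measurement (\<sigma> n) (b n))"]
      by linarith
  qed
qed

end
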